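(* Let $V=(M_\psi\otimes K^* )\mathscr V(M_\psi\otimes K)$ with $\nu_0>3$, $0\le\mathscr V\in\mathcal B(\ell^2(\mathbb Z_h,\mathcal G))$ and $K\in\mathfrak S_2(\mathcal G)$, and suppose $\dim(\mathcal G)<+\infty$. Then: (i) $\sigma_{\rm ess}(H_Q\pm V)=\sigma_{\rm ess}(H_Q)=[0,\frac4{h^2}]+\sigma(Q)$. (ii) The bound states (discrete eigenvalues) of the operators $H_Q\pm V$ do not accumulate at any point of $\mathscr E_Q$. In particular, $\#\sigma_{\rm disc}(H_Q\pm V)<\infty$.
   Context: Let $h>0$, $\mathbb Z_h=\{hn:n\in\mathbb Z\}$, and let $\mathcal G$ be a complex Hilbert space. $\ell^2(\mathbb Z_h)=\ell^2(\mathbb Z_h,\mathbb C)$ has scalar product $\langle\varphi,\phi\rangle=\sum_{n\in\mathbb Z}\overline{\varphi(hn)}\phi(hn)$, and $\ell^2(\mathbb Z_h,\mathcal G)$ is identified with $\ell^2(\mathbb Z_h)\otimes\mathcal G$. On $\ell^2(\mathbb Z_h)$, $(-\Delta_h\phi)(hn)=h^{-2}\big(2\phi(hn)-\phi(h(n+1))-\phi(h(n-1))\big)$. $Q$ is a self-adjoint operator on $\mathcal G$ (possibly $0$), with distinct eigenvalues $\mu_1,\dots,\mu_d$ if $Q\neq0$. $H_Q=-\Delta_h\otimes I_{\mathcal G}+I_{\ell^2(\mathbb Z_h)}\otimes Q$. The threshold set is $\mathscr E_Q=\{0,4/h^2\}$ if $Q=0$ and $\mathscr E_Q=\{\mu_s,\mu_s+4/h^2\}_{s=1}^d$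 if $Q\neq0$. $\mathfrak S_2$ is the Hilbert–Schmidt class. $\langle n\rangle=(1+n^2)^{1/2}$, $\psi(hn)=\langle n\rangle^{-\nu_0/2}$, $M_\psi$ is multiplication by $\psi$ on $\ell^2(\mathbb Z_h)$. $\sigma_{\rm disc}$ is the discrete spectrum (isolated eigenvalues of finite multiplicity), counted with multiplicity. *)

theory Defs
  imports "HOL-Analysis.Analysis" "HOL-Library.Nonpos_Ints"
begin

section \<open>Complex Hilbert spaces\<close>

text \<open>
  The scalar product is conjugate-linear in the first argument. The norm is the one of the
  underlying real inner product space; by \<open>inner_eq_Re_cinner\<close> it is the one
  induced by \<open>cinner\<close>.
\<close>

class complex_inner_space = real_inner +
  fixes scaleC :: "complex \<Rightarrow> 'a \<Rightarrow> 'a"  (infixr \<open>*\<^sub>C\<close> 75)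
    and cinner :: "'a \<Rightarrow> 'a \<Rightarrow> complex"
  assumes scaleC_add_right: "a *\<^sub>C (x + y) = a *\<^sub>C x + a *\<^sub>C y"
    and scaleC_add_left: "(a + b) *\<^sub>C x = a *\<^sub>C x + b *\<^sub>C x"
    and scaleC_scaleC: "a *\<^sub>C (b *\<^sub>C x) = (a * b) *\<^sub>C x"
    and scaleC_of_real: "complex_of_real r *\<^sub>C x = r *\<^sub>R x"
    and cinner_commute: "cinner x y = cnj (cinner y x)"
    and cinner_add_right: "cinner x (y + z) = cinner x y + cinner x z"
    and cinner_scaleC_right: "cinner x (a *\<^sub>C y) = a * cinner x y"
    and inner_eq_Re_cinner: "inner x y = Re (cinner x y)"

class complex_hilbert_space = complex_inner_space + complete_space

lemma vector_space_scaleC: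
  "vector_space (scaleC :: complex \<Rightarrow> 'a \<Rightarrow> 'a::complex_inner_space)"
  by unfold_locales
    (use scaleC_of_real[of 1] in \<open>simp_all add: scaleC_add_right scaleC_add_left scaleC_scaleC\<close>)

global_interpretation complex_vec: vector_space "scaleC :: complex \<Rightarrow> 'a \<Rightarrow> 'a::complex_inner_space"
  defines cspan = complex_vec.span and cdim = complex_vec.dim
  by (rule vector_space_scaleC)

lemma norm_sq_eq_cinner: "(norm x)\<^sup>2 = Re (cinner x x)"
  by (simp add: power2_norm_eq_inner inner_eq_Re_cinner)

lemma norm_scaleC: "norm (a *\<^sub>C x) = norm a * norm (x::'a::complex_inner_space)"
proof -
  have "cinner (a *\<^sub>C x) (a *\<^sub>C x) = a * cnj (a * cinner x x)"
    using cinner_commute[of "a *\<^sub>C x" x] by (simp add: cinner_scaleC_right)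
  also have "\<dots> = (a * cnj a) * cinner x x"
    using cinner_commute[of x x] by simp
  also have "\<dots> = of_real ((norm a)\<^sup>2) * cinner x x"
    by (simp only: complex_norm_square)
  finally have "(norm (a *\<^sub>C x))\<^sup>2 = (norm a * norm x)\<^sup>2"
    unfolding norm_sq_eq_cinner power_mult_distrib by simp
  then show ?thesis
    by (rule power2_eq_imp_eq) simp_all
qed

lemma norm_cinner_le: "norm (cinner x y) \<le> norm x * norm (y::'a::complex_inner_space)"
proof -
  define z where "z = cinner x y"
  have "cnj (sgn z) * z = of_real (norm z)"
  proof (cases "z = 0")
    case False
    have "cnj (sgn z) * z = of_real ((norm z)\<^sup>2) / of_real (norm z)"
      unfolding complex_norm_square by (simp add: sgn_eq)
    also have "\<dots> = of_real (norm z)"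
      using False by (simp add: power2_eq_square)
    finally show ?thesis .
  qed simp
  then have "norm z = Re (cnj (sgn z) * z)" by simp
  also have "\<dots> = inner x (cnj (sgn z) *\<^sub>C y)"
    by (simp only: inner_eq_Re_cinner cinner_scaleC_right z_def)
  also have "\<dots> \<le> norm x * norm (cnj (sgn z) *\<^sub>C y)"
    by (rule norm_cauchy_schwarz)
  also have "\<dots> \<le> norm x * norm y"
    by (intro mult_left_mono) (auto simp: norm_scaleC norm_sgn)
  finally show ?thesis by (simp only: z_def)
qed

instantiation complex :: complex_hilbert_space
begin

definition scaleC_complex_def [simp]: "a *\<^sub>C (x::complex) = a * x"

definition cinner_complex_def [simp]: "cinner x y = cnj x * (y::complex)"

instance
  by standard (simp_all add: algebra_simps scaleR_conv_of_real inner_complex_def)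

end


section \<open>Operators\<close>

definition bounded_clinear :: "('a::complex_inner_space \<Rightarrow> 'b::complex_inner_space) \<Rightarrow> bool" where
  "bounded_clinear T \<longleftrightarrow> bounded_linear T \<and> (\<forall>a x. T (a *\<^sub>C x) = a *\<^sub>C T x)"

definition cadjoint :: "('a::complex_inner_space \<Rightarrow> 'b::complex_inner_space) \<Rightarrow> 'b \<Rightarrow> 'a" where
  "cadjoint T = (THE S. \<forall>x y. cinner (S y) x = cinner y (T x))"

text \<open>Everywhere defined (hence bounded) self-adjoint operators.\<close>
definition selfadjoint :: "('a::complex_inner_space \<Rightarrow> 'a) \<Rightarrow> bool" where
  "selfadjoint T \<longleftrightarrow> bounded_clinear T \<and> (\<forall>x y. cinner (T x) y = cinner x (T y))"

definition nonneg_operator :: "('a::complex_inner_space \<Rightarrow> 'a) \<Rightarrow> bool" where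
  "nonneg_operator T \<longleftrightarrow> (\<forall>x. cinner x (T x) \<in> \<real>\<^sub>\<ge>\<^sub>0)"

definition orthonormal_basis :: "'a::complex_inner_space set \<Rightarrow> bool" where
  "orthonormal_basis E \<longleftrightarrow>
     (\<forall>e\<in>E. \<forall>f\<in>E. cinner e f = (if e = f then 1 else 0)) \<and> closure (cspan E) = UNIV"

definition hilbert_schmidt :: "('a::complex_inner_space \<Rightarrow> 'b::complex_inner_space) \<Rightarrow> bool" where
  "hilbert_schmidt T \<longleftrightarrow> bounded_clinear T \<and>
     (\<exists>E. orthonormal_basis E \<and> (\<lambda>e. (norm (T e))\<^sup>2) summable_on E)"


section \<open>Spectra\<close>

definition cfinite_dim :: "'a::complex_inner_space set \<Rightarrow> bool" where
  "cfinite_dim S \<longleftrightarrow> (\<exists>B. finite B \<and> S \<subseteq> cspan B)"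

definition resolvent_set :: "('a::complex_inner_space \<Rightarrow> 'a) \<Rightarrow> complex set" where
  "resolvent_set T = {z. \<exists>R. bounded_clinear R \<and>
     (\<forall>x. R (T x - z *\<^sub>C x) = x) \<and> (\<forall>x. T (R x) - z *\<^sub>C R x = x)}"

definition spectrum :: "('a::complex_inner_space \<Rightarrow> 'a) \<Rightarrow> complex set" where
  "spectrum T = - resolvent_set T"

definition eigenspace :: "('a::complex_inner_space \<Rightarrow> 'a) \<Rightarrow> complex \<Rightarrow> 'a set" where
  "eigenspace T z = {x. T x = z *\<^sub>C x}"

definition eigenvalues :: "('a::complex_inner_space \<Rightarrow> 'a) \<Rightarrow> complex set" where
  "eigenvalues T = {z. \<exists>x. x \<noteq> 0 \<and> T x = z *\<^sub>C x}"

definition discrete_spectrum :: "('a::complex_inner_space \<Rightarrow> 'a) \<Rightarrow> complex set" where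
  "discrete_spectrum T =
     {z \<in> eigenvalues T. \<not> z islimpt spectrum T \<and> cfinite_dim (eigenspace T z)}"

text \<open>The usual definition for self-adjoint operators, the only ones it is applied to here.\<close>
definition essential_spectrum :: "('a::complex_inner_space \<Rightarrow> 'a) \<Rightarrow> complex set" where
  "essential_spectrum T = spectrum T - discrete_spectrum T"

text \<open>Number of discrete eigenvalues counted with multiplicity.\<close>
definition discrete_count :: "('a::complex_inner_space \<Rightarrow> 'a) \<Rightarrow> enat" where
  "discrete_count T = (\<Sum>\<^sub>\<infinity>z\<in>discrete_spectrum T. enat (cdim (eigenspace T z)))"


section \<open>The space of square-summable functions on the lattice\<close>

text \<open>
  A function on the lattice of mesh \<open>h\<close> is represented by its values in the
  points \<open>h n\<close>: for \<open>f :: 'g ell2\<close> the value in \<open>h n\<close> is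
  \<open>ell2_at f n\<close>. The scalar product does not involve \<open>h\<close>.
\<close>

typedef (overloaded) 'g ell2 =
  "{f :: int \<Rightarrow> 'g::complex_inner_space. (\<lambda>n. (norm (f n))\<^sup>2) summable_on UNIV}"
  morphisms ell2_at Abs_ell2
  by (rule exI[of _ "\<lambda>_. 0"]) simp

setup_lifting type_definition_ell2

lemma ell2_summable_add:
  fixes f g :: "int \<Rightarrow> 'g::complex_inner_space"
  assumes "(\<lambda>n. (norm (f n))\<^sup>2) summable_on UNIV" "(\<lambda>n. (norm (g n))\<^sup>2) summable_on UNIV"
  shows "(\<lambda>n. (norm (f n + g n))\<^sup>2) summable_on UNIV"
proof (rule summable_on_comparison_test)
  show "(\<lambda>n. 2 * (norm (f n))\<^sup>2 + 2 * (norm (g n))\<^sup>2) summable_on UNIV"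
    by (intro summable_on_add summable_on_cmult_right assms)
  fix n
  have "(norm (f n + g n))\<^sup>2 \<le> (norm (f n) + norm (g n))\<^sup>2"
    by (intro power_mono norm_triangle_ineq) auto
  also have "\<dots> \<le> 2 * (norm (f n))\<^sup>2 + 2 * (norm (g n))\<^sup>2"
    using sum_squares_bound[of "norm (f n)" "norm (g n)"] by (simp add: power2_sum)
  finally show "(norm (f n + g n))\<^sup>2 \<le> 2 * (norm (f n))\<^sup>2 + 2 * (norm (g n))\<^sup>2" .
qed auto


lemma ell2_summable_scaleC:
  fixes f :: "int \<Rightarrow> 'g::complex_inner_space"
  assumes "(\<lambda>n. (norm (f n))\<^sup>2) summable_on UNIV"
  shows "(\<lambda>n. (norm (a *\<^sub>C f n))\<^sup>2) summable_on UNIV"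
  using summable_on_cmult_right[OF assms, of "(norm a)\<^sup>2"]
  by (simp add: norm_scaleC power_mult_distrib)

lemma ell2_summable_cinner:
  fixes f g :: "int \<Rightarrow> 'g::complex_inner_space"
  assumes "(\<lambda>n. (norm (f n))\<^sup>2) summable_on UNIV" "(\<lambda>n. (norm (g n))\<^sup>2) summable_on UNIV"
  shows "(\<lambda>n. cinner (f n) (g n)) summable_on UNIV"
proof (rule abs_summable_summable, rule summable_on_comparison_test)
  show "(\<lambda>n. (norm (f n))\<^sup>2 + (norm (g n))\<^sup>2) summable_on UNIV"
    by (intro summable_on_add assms)
  fix n
  have "norm (cinner (f n) (g n)) \<le> 2 * norm (f n) * norm (g n)"
    using norm_cinner_le[of "f n" "g n"] mult_nonneg_nonneg[OF norm_ge_zero[of "f n"] norm_ge_zero[of "g n"]]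
    unfolding mult.assoc by linarith
  also have "\<dots> \<le> (norm (f n))\<^sup>2 + (norm (g n))\<^sup>2"
    by (rule sum_squares_bound)
  finally show "norm (cinner (f n) (g n)) \<le> (norm (f n))\<^sup>2 + (norm (g n))\<^sup>2" .
qed auto

instantiation ell2 :: (complex_inner_space) complex_inner_space
begin

lift_definition zero_ell2 :: "'a ell2" is "\<lambda>_. 0" by simp

lift_definition plus_ell2 :: "'a ell2 \<Rightarrow> 'a ell2 \<Rightarrow> 'a ell2" is "\<lambda>f g n. f n + g n"
  by (rule ell2_summable_add)

lift_definition uminus_ell2 :: "'a ell2 \<Rightarrow> 'a ell2" is "\<lambda>f n. - f n" by simp

lift_definition minus_ell2 :: "'a ell2 \<Rightarrow> 'a ell2 \<Rightarrow> 'a ell2" is "\<lambda>f g n. f n - g n"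
  subgoal for f g using ell2_summable_add[of f "\<lambda>n. - g n"] by simp
  done

lift_definition scaleC_ell2 :: "complex \<Rightarrow> 'a ell2 \<Rightarrow> 'a ell2" is "\<lambda>a f n. a *\<^sub>C f n"
  by (rule ell2_summable_scaleC)

lift_definition scaleR_ell2 :: "real \<Rightarrow> 'a ell2 \<Rightarrow> 'a ell2" is "\<lambda>r f n. r *\<^sub>R f n"
  subgoal for r f using ell2_summable_scaleC[of f "of_real r"] by (simp only: scaleC_of_real)
  done

lift_definition cinner_ell2 :: "'a ell2 \<Rightarrow> 'a ell2 \<Rightarrow> complex" is
  "\<lambda>f g. \<Sum>\<^sub>\<infinity>n. cinner (f n) (g n)" .

definition inner_ell2 :: "'a ell2 \<Rightarrow> 'a ell2 \<Rightarrow> real" where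
  "inner_ell2 f g = Re (cinner f g)"

definition norm_ell2 :: "'a ell2 \<Rightarrow> real" where
  "norm_ell2 f = sqrt (inner f f)"

definition sgn_ell2 :: "'a ell2 \<Rightarrow> 'a ell2" where
  "sgn_ell2 f = scaleR (inverse (norm f)) f"

definition dist_ell2 :: "'a ell2 \<Rightarrow> 'a ell2 \<Rightarrow> real" where
  "dist_ell2 f g = norm (f - g)"

definition uniformity_ell2 :: "('a ell2 \<times> 'a ell2) filter" where
  "uniformity_ell2 = (INF e\<in>{0<..}. principal {(x, y). dist x y < e})"

definition open_ell2 :: "'a ell2 set \<Rightarrow> bool" where
  "open_ell2 U \<longleftrightarrow> (\<forall>x\<in>U. \<forall>\<^sub>F (x', y) in uniformity. x' = x \<longrightarrow> y \<in> U)"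

instance
proof
  fix x y z :: "'a ell2" and a b :: complex and r s :: real
  show "x + y + z = x + (y + z)" by transfer (simp add: add.assoc)
  show "x + y = y + x" by transfer (simp add: add.commute)
  show "0 + x = x" by transfer simp
  show "- x + x = 0" by transfer simp
  show "x - y = x + - y" by transfer simp
  show "r *\<^sub>R (x + y) = r *\<^sub>R x + r *\<^sub>R y" by transfer (simp add: scaleR_add_right)
  show "(r + s) *\<^sub>R x = r *\<^sub>R x + s *\<^sub>R x" by transfer (simp add: scaleR_add_left)
  show "r *\<^sub>R s *\<^sub>R x = (r * s) *\<^sub>R x" by transfer simp
  show "1 *\<^sub>R x = x" by transfer simp
  show "sgn x = scaleR (inverse (norm x)) x" by (rule sgn_ell2_def)
  show "dist x y = norm (x - y)" by (rule dist_ell2_def)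
  show "(uniformity :: ('a ell2 \<times> 'a ell2) filter) = (INF e\<in>{0<..}. principal {(x, y). dist x y < e})"
    by (rule uniformity_ell2_def)
  show "\<And>U :: 'a ell2 set. open U \<longleftrightarrow> (\<forall>x\<in>U. \<forall>\<^sub>F (x', y) in uniformity. x' = x \<longrightarrow> y \<in> U)"
    by (rule open_ell2_def)
  show "norm x = sqrt (inner x x)" by (rule norm_ell2_def)
  show "a *\<^sub>C (x + y) = a *\<^sub>C x + a *\<^sub>C y" by transfer (simp add: scaleC_add_right)
  show "(a + b) *\<^sub>C x = a *\<^sub>C x + b *\<^sub>C x" by transfer (simp add: scaleC_add_left)
  show "a *\<^sub>C b *\<^sub>C x = (a * b) *\<^sub>C x" by transfer (simp add: scaleC_scaleC)
  show "complex_of_real r *\<^sub>C x = r *\<^sub>R x" by transfer (simp add: scaleC_of_real)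
  show commute: "cinner x y = cnj (cinner y x)" for x y :: "'a ell2"
    by transfer (simp flip: infsum_cnj cinner_commute)
  show add_right: "cinner x (y + z) = cinner x y + cinner x z" for x y z :: "'a ell2"
    by transfer (simp add: cinner_add_right infsum_add ell2_summable_cinner)
  show scaleC_right: "cinner x (a *\<^sub>C y) = a * cinner x y" for x y :: "'a ell2" and a
    by transfer (simp add: cinner_scaleC_right infsum_cmult_right')
  show "inner x y = Re (cinner x y)" by (rule inner_ell2_def)
  show "inner x y = inner y x"
    using commute[of x y] by (simp add: inner_ell2_def)
  show "inner (x + y) z = inner x z + inner y z"
    using commute[of "x + y" z] commute[of x z] commute[of y z] by (simp add: inner_ell2_def add_right)
  have "r *\<^sub>R x = complex_of_real r *\<^sub>C x" by transfer (simp add: scaleC_of_real)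
  then show "inner (r *\<^sub>R x) y = r * inner x y"
    using commute[of "r *\<^sub>R x" y] commute[of x y] by (simp add: inner_ell2_def scaleC_right)
  have eq: "inner x x = (\<Sum>\<^sub>\<infinity>n. (norm (ell2_at x n))\<^sup>2)"
    unfolding inner_ell2_def
    by transfer (simp add: norm_sq_eq_cinner ell2_summable_cinner flip: infsum_Re)
  show "0 \<le> inner x x"
    unfolding eq by (rule infsum_nonneg) simp
  show "inner x x = 0 \<longleftrightarrow> x = 0"
  proof
    assume "inner x x = 0"
    then have "(norm (ell2_at x n))\<^sup>2 = 0" for n
      unfolding eq by (intro nonneg_infsum_le_0D[of _ UNIV]) (use ell2_at[of x] in auto)
    then have "ell2_at x = (\<lambda>_. 0)" by auto
    then show "x = 0" by (simp add: zero_ell2.rep_eq flip: ell2_at_inject)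
  next
    assume "x = 0"
    then show "inner x x = 0" unfolding eq by (simp add: zero_ell2.rep_eq)
  qed
qed

end

lemma ell2_norm_sq: "(norm (f :: 'g::complex_inner_space ell2))\<^sup>2 = (\<Sum>\<^sub>\<infinity>n. (norm (ell2_at f n))\<^sup>2)"
  unfolding norm_sq_eq_cinner
  by transfer (simp add: norm_sq_eq_cinner ell2_summable_cinner flip: infsum_Re)

lemma ell2_finite_sum_le:
  fixes f :: "'g::complex_inner_space ell2"
  assumes "finite F"
  shows "(\<Sum>n\<in>F. (norm (ell2_at f n))\<^sup>2) \<le> (norm f)\<^sup>2"
  unfolding ell2_norm_sq
  by (rule finite_sum_le_infsum) (use ell2_at[of f] assms in auto)

lemma ell2_at_le: "norm (ell2_at f n) \<le> norm (f :: 'g::complex_inner_space ell2)"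
  using ell2_finite_sum_le[of "{n}" f] by simp

instance ell2 :: (complex_hilbert_space) complex_hilbert_space
proof
  fix X :: "nat \<Rightarrow> 'a ell2"
  assume X: "Cauchy X"
  have "Cauchy (\<lambda>m. ell2_at (X m) n)" for n
    unfolding Cauchy_def dist_norm
  proof (intro allI impI)
    fix e :: real assume "e > 0"
    then obtain M where "\<forall>m\<ge>M. \<forall>k\<ge>M. norm (X m - X k) < e"
      using X unfolding Cauchy_def dist_norm by blast
    moreover have "norm (ell2_at (X m) n - ell2_at (X k) n) \<le> norm (X m - X k)" for m k
      using ell2_at_le[of "X m - X k" n] by (simp add: minus_ell2.rep_eq)
    ultimately show "\<exists>M. \<forall>m\<ge>M. \<forall>k\<ge>M. norm (ell2_at (X m) n - ell2_at (X k) n) < e"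
      by (meson le_less_trans)
  qed
  then have "\<forall>n. \<exists>l. (\<lambda>m. ell2_at (X m) n) \<longlonglongrightarrow> l"
    by (simp add: Cauchy_convergent_iff convergent_def)
  then obtain l where l: "\<And>n. (\<lambda>m. ell2_at (X m) n) \<longlonglongrightarrow> l n" by metis
  have bound: "(\<Sum>n\<in>F. (norm (ell2_at (X m) n - l n))\<^sup>2) \<le> e\<^sup>2"
    if "\<forall>m\<ge>M. \<forall>k\<ge>M. norm (X m - X k) < e" "m \<ge> M" "finite F" for e M m F
  proof (rule tendsto_upperbound)
    show "(\<lambda>k. \<Sum>n\<in>F. (norm (ell2_at (X m) n - ell2_at (X k) n))\<^sup>2)
        \<longlonglongrightarrow> (\<Sum>n\<in>F. (norm (ell2_at (X m) n - l n))\<^sup>2)"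
      by (intro tendsto_intros l)
    show "\<forall>\<^sub>F k in sequentially. (\<Sum>n\<in>F. (norm (ell2_at (X m) n - ell2_at (X k) n))\<^sup>2) \<le> e\<^sup>2"
      unfolding eventually_sequentially
    proof (intro exI[of _ M] allI impI)
      fix k assume "M \<le> k"
      then have "norm (X m - X k) \<le> e"
        using that(1,2) less_imp_le by blast
      then have "(norm (X m - X k))\<^sup>2 \<le> e\<^sup>2"
        by (rule power_mono) simp
      then show "(\<Sum>n\<in>F. (norm (ell2_at (X m) n - ell2_at (X k) n))\<^sup>2) \<le> e\<^sup>2"
        using ell2_finite_sum_le[OF \<open>finite F\<close>, of "X m - X k"] by (simp add: minus_ell2.rep_eq)
    qed
  qed simp
  have summ: "(\<lambda>n. (norm (ell2_at (X m) n - l n))\<^sup>2) summable_on UNIV"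
    if "\<forall>m\<ge>M. \<forall>k\<ge>M. norm (X m - X k) < e" "m \<ge> M" for e M m
    by (rule nonneg_bdd_above_summable_on)
      (use bound[OF that] in \<open>auto intro!: bdd_aboveI[of _ "e\<^sup>2"]\<close>)
  obtain M where M: "\<forall>m\<ge>M. \<forall>k\<ge>M. norm (X m - X k) < 1"
    using X unfolding Cauchy_def dist_norm using zero_less_one by blast
  define L where "L = Abs_ell2 l"
  have "(\<lambda>n. (norm (l n))\<^sup>2) summable_on UNIV"
    using ell2_summable_add[of "\<lambda>n. l n - ell2_at (X M) n" "ell2_at (X M)"]
      summ[OF M order_refl] ell2_at[of "X M"] by (simp add: norm_minus_commute)
  then have L: "ell2_at L = l" by (simp add: L_def Abs_ell2_inverse)
  have "X \<longlonglongrightarrow> L"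
  proof (rule metric_LIMSEQ_I)
    fix e :: real assume "e > 0"
    then obtain N where N: "\<forall>m\<ge>N. \<forall>k\<ge>N. norm (X m - X k) < e / 2"
      using X unfolding Cauchy_def dist_norm using half_gt_zero by blast
    have "dist (X m) L < e" if "m \<ge> N" for m
    proof -
      have "(norm (X m - L))\<^sup>2 \<le> (e / 2)\<^sup>2"
        unfolding ell2_norm_sq minus_ell2.rep_eq L
        by (rule infsum_le_finite_sums) (use summ[OF N that] bound[OF N that] in auto)
      then have "norm (X m - L) \<le> e / 2"
        using \<open>e > 0\<close> by (simp add: power2_le_iff_abs_le)
      then show ?thesis using \<open>e > 0\<close> by (simp add: dist_norm)
    qed
    then show "\<exists>N. \<forall>m\<ge>N. dist (X m) L < e" by blast
  qed
  then show "convergent X" by (rule convergentI)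
qed


subsection \<open>Tensor products\<close>

lemma ell2_summable_tensor:
  "(\<lambda>n. (norm (ell2_at \<phi> n *\<^sub>C (x::'g::complex_inner_space)))\<^sup>2) summable_on UNIV"
  using summable_on_cmult_left[of "\<lambda>n. (norm (ell2_at \<phi> n))\<^sup>2" UNIV "(norm x)\<^sup>2"] ell2_at[of \<phi>]
  by (simp add: norm_scaleC power_mult_distrib)

lift_definition ell2_tensor :: "complex ell2 \<Rightarrow> 'g::complex_inner_space \<Rightarrow> 'g ell2"  (infixr \<open>\<otimes>\<^sub>v\<close> 70)
  is "\<lambda>\<phi> x n. \<phi> n *\<^sub>C x"
  subgoal for \<phi> x using ell2_summable_tensor[of "Abs_ell2 \<phi>" x] by (simp add: Abs_ell2_inverse)
  done

text \<open>
  For bounded \<open>A\<close> and \<open>B\<close>, the bounded operator on \<open>'g ell2\<close>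
  acting on elementary tensors as stated exists, and it is unique because these span a dense subspace.
\<close>
definition tensor_op ::
    "(complex ell2 \<Rightarrow> complex ell2) \<Rightarrow> ('g::complex_inner_space \<Rightarrow> 'g) \<Rightarrow> 'g ell2 \<Rightarrow> 'g ell2"
    (infixr \<open>\<otimes>\<^sub>o\<close> 70) where
  "A \<otimes>\<^sub>o B = (THE T. bounded_clinear T \<and> (\<forall>\<phi> x. T (\<phi> \<otimes>\<^sub>v x) = A \<phi> \<otimes>\<^sub>v B x))"


section \<open>The Hamiltonians\<close>

definition neg_laplacian :: "real \<Rightarrow> complex ell2 \<Rightarrow> complex ell2" where
  "neg_laplacian h \<phi> = Abs_ell2 (\<lambda>n.
     (2 * ell2_at \<phi> n - ell2_at \<phi> (n + 1) - ell2_at \<phi> (n - 1)) / complex_of_real (h\<^sup>2))"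

definition mult_op :: "(int \<Rightarrow> complex) \<Rightarrow> complex ell2 \<Rightarrow> complex ell2" where
  "mult_op f \<phi> = Abs_ell2 (\<lambda>n. f n * ell2_at \<phi> n)"

text \<open>The value of the weight in the lattice point \<open>h n\<close>.\<close>
definition weight :: "real \<Rightarrow> int \<Rightarrow> complex" where
  "weight \<nu> n = complex_of_real (sqrt (1 + (real_of_int n)\<^sup>2) powr (- \<nu> / 2))"

definition free_hamiltonian ::
    "real \<Rightarrow> ('g::complex_inner_space \<Rightarrow> 'g) \<Rightarrow> 'g ell2 \<Rightarrow> 'g ell2" where
  "free_hamiltonian h Q = (\<lambda>f. (neg_laplacian h \<otimes>\<^sub>o id) f + (id \<otimes>\<^sub>o Q) f)"

definition threshold_set :: "real \<Rightarrow> ('g::complex_inner_space \<Rightarrow> 'g) \<Rightarrow> complex set" where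
  "threshold_set h Q =
     (if Q = (\<lambda>_. 0) then {0, complex_of_real (4 / h\<^sup>2)}
      else (\<Union>\<mu>\<in>eigenvalues Q. {\<mu>, \<mu> + complex_of_real (4 / h\<^sup>2)}))"


section \<open>Pointwise description of the operators\<close>

lemma ell2_sum_at: "ell2_at (\<Sum>i\<in>F. f i) n = (\<Sum>i\<in>F. ell2_at (f i) n)"
  for f :: "'i \<Rightarrow> 'g::complex_inner_space ell2"
  by (induction F rule: infinite_finite_induct) (simp_all add: zero_ell2.rep_eq plus_ell2.rep_eq)

lift_definition ell2_delta :: "int \<Rightarrow> complex ell2" is "\<lambda>k n. if n = k then 1 else 0"
  subgoal for k by (rule finite_nonzero_values_imp_summable_on) (rule finite_subset[of _ "{k}"], auto)
  done

lemma ell2_has_sum_delta: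
  fixes f :: "'g::complex_inner_space ell2"
  shows "((\<lambda>n. ell2_delta n \<otimes>\<^sub>v ell2_at f n) has_sum f) UNIV"
  unfolding has_sum_def tendsto_iff
proof (intro allI impI)
  fix e :: real assume "e > 0"
  let ?q = "\<lambda>n. (norm (ell2_at f n))\<^sup>2"
  have q: "?q summable_on UNIV" using ell2_at[of f] by simp
  then have "(?q has_sum (norm f)\<^sup>2) UNIV" by (simp add: ell2_norm_sq)
  then have "\<forall>\<^sub>F F in finite_subsets_at_top UNIV. dist (sum ?q F) ((norm f)\<^sup>2) < e\<^sup>2"
    using \<open>e > 0\<close> unfolding has_sum_def tendsto_iff by simp
  moreover have "\<forall>\<^sub>F F in finite_subsets_at_top (UNIV :: int set). finite F"
    by (rule eventually_finite_subsets_at_top_weakI) simp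
  ultimately show "\<forall>\<^sub>F F in finite_subsets_at_top UNIV.
      dist (\<Sum>n\<in>F. ell2_delta n \<otimes>\<^sub>v ell2_at f n) f < e"
  proof eventually_elim
    case (elim F)
    have at: "ell2_at (\<Sum>n\<in>F. ell2_delta n \<otimes>\<^sub>v ell2_at f n) m = (if m \<in> F then ell2_at f m else 0)" for m
    proof -
      have "ell2_at (\<Sum>n\<in>F. ell2_delta n \<otimes>\<^sub>v ell2_at f n) m = (\<Sum>n\<in>F. if m = n then ell2_at f m else 0)"
        unfolding ell2_sum_at by (intro sum.cong refl) (simp add: ell2_tensor.rep_eq ell2_delta.rep_eq)
      then show ?thesis using elim(2) by simp
    qed
    have "(norm ((\<Sum>n\<in>F. ell2_delta n \<otimes>\<^sub>v ell2_at f n) - f))\<^sup>2 = infsum ?q (- F)"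
      unfolding ell2_norm_sq minus_ell2.rep_eq at by (rule infsum_cong_neutral) auto
    also have "\<dots> = (norm f)\<^sup>2 - sum ?q F"
      using infsum_Un_disjoint[of ?q F "- F"] q elim(2)
      by (simp add: ell2_norm_sq summable_on_subset)
    also have "\<dots> < e\<^sup>2" using elim(1) by (simp add: dist_real_def)
    finally show ?case
      using \<open>e > 0\<close> by (simp add: dist_norm power2_less_imp_less)
  qed
qed

lemma tensor_op_eqI:
  assumes "bounded_clinear T" and "\<And>\<phi> x. T (\<phi> \<otimes>\<^sub>v x) = A \<phi> \<otimes>\<^sub>v B x"
  shows "A \<otimes>\<^sub>o B = T"
  unfolding tensor_op_def
proof (rule the_equality)
  fix S assume S: "bounded_clinear S \<and> (\<forall>\<phi> x. S (\<phi> \<otimes>\<^sub>v x) = A \<phi> \<otimes>\<^sub>v B x)"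
  have lin: "bounded_linear S" "bounded_linear T"
    using S assms(1) by (auto simp: bounded_clinear_def)
  show "S = T"
  proof
    fix f
    have "((\<lambda>n. S (ell2_delta n \<otimes>\<^sub>v ell2_at f n)) has_sum S f) UNIV"
      "((\<lambda>n. T (ell2_delta n \<otimes>\<^sub>v ell2_at f n)) has_sum T f) UNIV"
      by (intro has_sum_bounded_linear[OF _ ell2_has_sum_delta] lin)+
    then show "S f = T f" using S assms(2) by (simp add: has_sum_unique)
  qed
qed (use assms in auto)

lemma ell2_bounded_clinearI:
  fixes T :: "'g::complex_inner_space ell2 \<Rightarrow> 'g ell2"
  assumes add: "\<And>f g n. F (f + g) n = F f n + F g n"
    and scale: "\<And>a f n. F (a *\<^sub>C f) n = a *\<^sub>C F f n"
    and bound: "\<And>f G. finite G \<Longrightarrow> (\<Sum>n\<in>G. (norm (F f n))\<^sup>2) \<le> (C * norm f)\<^sup>2"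
    and C: "C \<ge> 0" and T: "T = (\<lambda>f. Abs_ell2 (F f))"
  shows "bounded_clinear T" and "ell2_at (T f) n = F f n"
proof -
  have summ: "(\<lambda>n. (norm (F f n))\<^sup>2) summable_on UNIV" for f
    by (rule nonneg_bdd_above_summable_on)
      (use bound[of _ f] in \<open>auto intro!: bdd_aboveI[of _ "(C * norm f)\<^sup>2"]\<close>)
  have at: "ell2_at (T f) = F f" for f
    using summ by (simp add: T Abs_ell2_inverse)
  then show "ell2_at (T f) n = F f n" by simp
  have scaleC: "T (a *\<^sub>C f) = a *\<^sub>C T f" for a f
    by (subst ell2_at_inject[symmetric]) (simp add: at scaleC_ell2.rep_eq scale fun_eq_iff)
  have "bounded_linear T"
  proof (rule bounded_linear_intro)
    show "T (f + g) = T f + T g" for f g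
      by (subst ell2_at_inject[symmetric]) (simp add: at plus_ell2.rep_eq add fun_eq_iff)
    show "T (r *\<^sub>R f) = r *\<^sub>R T f" for r f
      by (simp flip: scaleC_of_real add: scaleC)
    show "norm (T f) \<le> norm f * C" for f
    proof (rule power2_le_imp_le)
      show "(norm (T f))\<^sup>2 \<le> (norm f * C)\<^sup>2"
        unfolding ell2_norm_sq[of "T f"] at
        by (rule infsum_le_finite_sums) (use summ bound[of _ f] in \<open>auto simp: mult.commute\<close>)
    qed (use C in simp)
  qed
  then show "bounded_clinear T" using scaleC by (simp add: bounded_clinear_def)
qed


lemma ell2_mult_clinear:
  fixes B :: "'g::complex_inner_space \<Rightarrow> 'g"
  assumes c: "\<And>n. norm (c n) \<le> b" and B: "bounded_clinear B"
    and T: "T = (\<lambda>f. Abs_ell2 (\<lambda>n. c n *\<^sub>C B (ell2_at f n)))"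
  shows "bounded_clinear T" and "ell2_at (T f) n = c n *\<^sub>C B (ell2_at f n)"
proof -
  from B interpret B: bounded_linear B by (simp add: bounded_clinear_def)
  obtain K where K: "K \<ge> 0" "\<And>x. norm (B x) \<le> norm x * K"
    using B.nonneg_bounded by blast
  have b: "b \<ge> 0" using c[of 0] norm_ge_zero order_trans by blast
  have bound: "(\<Sum>n\<in>G. (norm (c n *\<^sub>C B (ell2_at f n)))\<^sup>2) \<le> (b * K * norm f)\<^sup>2"
    if "finite G" for G and f :: "'g ell2"
  proof -
    have "(norm (c n *\<^sub>C B (ell2_at f n)))\<^sup>2 \<le> (b * K)\<^sup>2 * (norm (ell2_at f n))\<^sup>2" for n
    proof -
      have "norm (c n *\<^sub>C B (ell2_at f n)) \<le> b * (norm (ell2_at f n) * K)"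
        unfolding norm_scaleC by (intro mult_mono c K b) auto
      then have "(norm (c n *\<^sub>C B (ell2_at f n)))\<^sup>2 \<le> (b * (norm (ell2_at f n) * K))\<^sup>2"
        by (rule power_mono) simp
      then show ?thesis by (simp add: power_mult_distrib ac_simps)
    qed
    then have "(\<Sum>n\<in>G. (norm (c n *\<^sub>C B (ell2_at f n)))\<^sup>2)
        \<le> (b * K)\<^sup>2 * (\<Sum>n\<in>G. (norm (ell2_at f n))\<^sup>2)"
      unfolding sum_distrib_left by (rule sum_mono)
    also have "\<dots> \<le> (b * K)\<^sup>2 * (norm f)\<^sup>2"
      by (intro mult_left_mono ell2_finite_sum_le that) simp
    finally show ?thesis by (simp add: power_mult_distrib)
  qed
  have BC: "B (a *\<^sub>C x) = a *\<^sub>C B x" for a x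
    using B by (simp add: bounded_clinear_def)
  show "bounded_clinear T" "ell2_at (T f) n = c n *\<^sub>C B (ell2_at f n)"
    using ell2_bounded_clinearI[of "\<lambda>f n. c n *\<^sub>C B (ell2_at f n)" "b * K" T] bound T b K(1)
    by (simp_all add: plus_ell2.rep_eq scaleC_ell2.rep_eq B.add BC scaleC_add_right scaleC_scaleC
        mult.commute)
qed

lemma ell2_laplacian:
  fixes T :: "'g::complex_inner_space ell2 \<Rightarrow> 'g ell2"
  assumes T: "T = (\<lambda>f. Abs_ell2 (\<lambda>n. c *\<^sub>C
      (2 *\<^sub>C ell2_at f n - ell2_at f (n + 1) - ell2_at f (n - 1))))"
  shows "bounded_clinear T"
    and "ell2_at (T f) n = c *\<^sub>C (2 *\<^sub>C ell2_at f n - ell2_at f (n + 1) - ell2_at f (n - 1))"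
proof -
  let ?F = "\<lambda>(f::'g ell2) n. c *\<^sub>C (2 *\<^sub>C ell2_at f n - ell2_at f (n + 1) - ell2_at f (n - 1))"
  have bound: "(\<Sum>n\<in>G. (norm (?F f n))\<^sup>2) \<le> (5 * norm c * norm f)\<^sup>2"
    if G: "finite G" for G and f :: "'g ell2"
  proof -
    let ?a = "\<lambda>n. norm (ell2_at f n)"
    have 1: "(norm (?F f n))\<^sup>2 \<le> (norm c)\<^sup>2 * (6 * (?a n)\<^sup>2 + 6 * (?a (n + 1))\<^sup>2 + 6 * (?a (n - 1))\<^sup>2)" for n
    proof -
      have "norm (2 *\<^sub>C ell2_at f n - ell2_at f (n + 1) - ell2_at f (n - 1))
          \<le> 2 * ?a n + ?a (n + 1) + ?a (n - 1)"
        using norm_triangle_ineq4[of "2 *\<^sub>C ell2_at f n - ell2_at f (n + 1)" "ell2_at f (n - 1)"]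
          norm_triangle_ineq4[of "2 *\<^sub>C ell2_at f n" "ell2_at f (n + 1)"]
        by (simp add: norm_scaleC)
      then have "(norm (2 *\<^sub>C ell2_at f n - ell2_at f (n + 1) - ell2_at f (n - 1)))\<^sup>2
          \<le> (2 * ?a n + ?a (n + 1) + ?a (n - 1))\<^sup>2"
        by (rule power_mono) simp
      also have "\<dots> \<le> 6 * (?a n)\<^sup>2 + 6 * (?a (n + 1))\<^sup>2 + 6 * (?a (n - 1))\<^sup>2"
        using zero_le_power2[of "?a n - 2 * ?a (n + 1)"] zero_le_power2[of "?a n - 2 * ?a (n - 1)"]
          zero_le_power2[of "?a (n + 1) - ?a (n - 1)"]
        by (simp add: power2_eq_square algebra_simps)
      finally show ?thesis
        by (simp add: norm_scaleC power_mult_distrib mult_left_mono)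
    qed
    have shift: "(\<Sum>n\<in>G. (?a (n + k))\<^sup>2) \<le> (norm f)\<^sup>2" for k
      using ell2_finite_sum_le[of "(\<lambda>n. n + k) ` G" f] G by (simp add: sum.reindex inj_on_def)
    have "(\<Sum>n\<in>G. (norm (?F f n))\<^sup>2)
        \<le> (\<Sum>n\<in>G. (norm c)\<^sup>2 * (6 * (?a n)\<^sup>2 + 6 * (?a (n + 1))\<^sup>2 + 6 * (?a (n - 1))\<^sup>2))"
      by (intro sum_mono 1)
    also have "\<dots> = (norm c)\<^sup>2 * (6 * (\<Sum>n\<in>G. (?a n)\<^sup>2) + 6 * (\<Sum>n\<in>G. (?a (n + 1))\<^sup>2) + 6 * (\<Sum>n\<in>G. (?a (n - 1))\<^sup>2))"
      by (simp only: sum.distrib flip: sum_distrib_left)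
    also have "\<dots> \<le> (norm c)\<^sup>2 * (25 * (norm f)\<^sup>2)"
    proof (rule mult_left_mono)
      show "6 * (\<Sum>n\<in>G. (?a n)\<^sup>2) + 6 * (\<Sum>n\<in>G. (?a (n + 1))\<^sup>2) + 6 * (\<Sum>n\<in>G. (?a (n - 1))\<^sup>2)
          \<le> 25 * (norm f)\<^sup>2"
        using shift[of 0, unfolded add_0_right] shift[of 1]
          shift[of "-1", unfolded add_uminus_conv_diff] zero_le_power2[of "norm f"] by linarith
    qed simp
    finally show ?thesis by (simp add: power_mult_distrib ac_simps)
  qed
  have scale: "?F (a *\<^sub>C f) n = a *\<^sub>C ?F f n" for a f n
    by (simp add: scaleC_ell2.rep_eq scaleC_scaleC ac_simps
        complex_vec.scale_right_diff_distrib)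
  have add: "?F (f + g) n = ?F f n + ?F g n" for f g n
    by (simp add: plus_ell2.rep_eq scaleC_add_right complex_vec.scale_right_diff_distrib)
  show "bounded_clinear T" "ell2_at (T f) n = ?F f n"
    using ell2_bounded_clinearI[of ?F "5 * norm c" T, OF add scale bound _ T] by simp_all
qed

lemma cadjoint_eqI:
  assumes "\<And>x y. cinner (S y) x = cinner y (T x)"
  shows "cadjoint T = S"
  unfolding cadjoint_def
proof (rule the_equality)
  fix S' assume S': "\<forall>x y. cinner (S' y) x = cinner y (T x)"
  show "S' = S"
  proof
    fix y
    have "cinner (S' y - S y) x = 0" for x
      using S' assms cinner_commute[of "S' y - S y" x] cinner_commute[of "S' y" x]
        cinner_commute[of "S y" x] cinner_add_right[of x "S' y - S y" "S y"] by simp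
    from this[of "S' y - S y"] have "(norm (S' y - S y))\<^sup>2 = 0"
      by (simp add: norm_sq_eq_cinner)
    then show "S' y = S y" by simp
  qed
qed (use assms in auto)

lemma bounded_clinear_id: "bounded_clinear id"
  by (simp add: bounded_clinear_def id_def bounded_linear_ident)

lemma ell2_at_neg_laplacian:
  "ell2_at (neg_laplacian h \<phi>) n =
     (2 * ell2_at \<phi> n - ell2_at \<phi> (n + 1) - ell2_at \<phi> (n - 1)) / complex_of_real (h\<^sup>2)"
proof -
  have "neg_laplacian h = (\<lambda>f. Abs_ell2 (\<lambda>n. (1 / complex_of_real (h\<^sup>2)) *\<^sub>C
      (2 *\<^sub>C ell2_at f n - ell2_at f (n + 1) - ell2_at f (n - 1))))"
    by (simp add: neg_laplacian_def fun_eq_iff)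
  from ell2_laplacian(2)[OF this, of \<phi> n] show ?thesis by simp
qed

lemma ell2_at_mult_op:
  assumes "\<And>n. norm (c n) \<le> b"
  shows "ell2_at (mult_op c \<phi>) n = c n * ell2_at \<phi> n"
  using ell2_mult_clinear(2)[OF assms bounded_clinear_id, of "mult_op c"]
  by (simp add: mult_op_def fun_eq_iff)

lemma neg_laplacian_tensor_id:
  fixes f :: "'a::complex_inner_space ell2"
  shows "bounded_clinear (neg_laplacian h \<otimes>\<^sub>o (id :: 'a \<Rightarrow> 'a))"
    and "ell2_at ((neg_laplacian h \<otimes>\<^sub>o id) f) n = (1 / complex_of_real (h\<^sup>2)) *\<^sub>C
     (2 *\<^sub>C ell2_at f n - ell2_at f (n + 1) - ell2_at f (n - 1))"
proof -
  define T :: "'a ell2 \<Rightarrow> 'a ell2" where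
    "T = (\<lambda>f. Abs_ell2 (\<lambda>n. (1 / complex_of_real (h\<^sup>2)) *\<^sub>C
      (2 *\<^sub>C ell2_at f n - ell2_at f (n + 1) - ell2_at f (n - 1))))"
  note T = ell2_laplacian[OF T_def]
  have "neg_laplacian h \<otimes>\<^sub>o id = T"
  proof (rule tensor_op_eqI[OF T(1)])
    fix \<phi> and x :: 'a
    show "T (\<phi> \<otimes>\<^sub>v x) = neg_laplacian h \<phi> \<otimes>\<^sub>v id x"
      by (subst ell2_at_inject[symmetric])
        (simp add: fun_eq_iff T(2) ell2_tensor.rep_eq ell2_at_neg_laplacian scaleC_scaleC
          flip: complex_vec.scale_left_diff_distrib)
  qed
  with T show "bounded_clinear (neg_laplacian h \<otimes>\<^sub>o (id :: 'a \<Rightarrow> 'a))"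
    "ell2_at ((neg_laplacian h \<otimes>\<^sub>o id) f) n = (1 / complex_of_real (h\<^sup>2)) *\<^sub>C
     (2 *\<^sub>C ell2_at f n - ell2_at f (n + 1) - ell2_at f (n - 1))" by simp_all
qed

lemma mult_op_tensor:
  fixes B :: "'g::complex_inner_space \<Rightarrow> 'g"
  assumes c: "\<And>n. norm (c n) \<le> b" and B: "bounded_clinear B"
  shows "bounded_clinear (mult_op c \<otimes>\<^sub>o B)"
    and "ell2_at ((mult_op c \<otimes>\<^sub>o B) f) n = c n *\<^sub>C B (ell2_at f n)"
proof -
  define T where "T = (\<lambda>f. Abs_ell2 (\<lambda>n. c n *\<^sub>C B (ell2_at f n)))"
  note T = ell2_mult_clinear[OF c B T_def]
  have "mult_op c \<otimes>\<^sub>o B = T"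
  proof (rule tensor_op_eqI[OF T(1)])
    fix \<phi> x
    show "T (\<phi> \<otimes>\<^sub>v x) = mult_op c \<phi> \<otimes>\<^sub>v B x"
      using B by (subst ell2_at_inject[symmetric])
        (simp add: fun_eq_iff T(2) ell2_tensor.rep_eq ell2_at_mult_op[OF c] scaleC_scaleC
          bounded_clinear_def)
  qed
  with T show "bounded_clinear (mult_op c \<otimes>\<^sub>o B)"
    "ell2_at ((mult_op c \<otimes>\<^sub>o B) f) n = c n *\<^sub>C B (ell2_at f n)" by simp_all
qed

lemma id_tensor:
  fixes B :: "'g::complex_inner_space \<Rightarrow> 'g"
  assumes B: "bounded_clinear B"
  shows "bounded_clinear (id \<otimes>\<^sub>o B)" and "ell2_at ((id \<otimes>\<^sub>o B) f) n = B (ell2_at f n)"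
proof -
  have "id = mult_op (\<lambda>_. 1)" by (simp add: mult_op_def fun_eq_iff ell2_at_inverse)
  moreover have "1 *\<^sub>C x = x" for x :: 'g by simp
  ultimately show "bounded_clinear (id \<otimes>\<^sub>o B)" "ell2_at ((id \<otimes>\<^sub>o B) f) n = B (ell2_at f n)"
    using mult_op_tensor[of "\<lambda>_. 1" 1, OF _ B] by simp_all
qed

lemma norm_weight_le:
  assumes "\<nu> \<ge> 0"
  shows "norm (weight \<nu> n) \<le> 1"
proof -
  have "sqrt (1 + (real_of_int n)\<^sup>2) powr (- \<nu> / 2) \<le> 1 powr (- \<nu> / 2)"
    using assms by (intro powr_mono2') auto
  then show ?thesis by (simp add: weight_def)
qed

end

theory Submission
  imports Defs
begin

text \<open>
  Let \<open>(a, b)\<close> be a gap of \<open>[0, 4/h\<^sup>2] + \<sigma>(Q)\<close> and \<open>H = H\<^sub>Q \<plusminus> V\<close>. After diagonalising \<open>Q\<close>, the form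
  \<open>\<langle>(H\<^sub>Q - a) f, (H\<^sub>Q - b) f\<rangle>\<close> splits into channels, and in the channel of an eigenvalue \<open>\<mu>\<close> it dominates
  a multiple of \<open>\<Sum> |f(n+1) - f(n)|\<^sup>2\<close> (if \<open>b \<le> \<mu>\<close>) or \<open>\<Sum> |f(n+1) + f(n)|\<^sup>2\<close> (if \<open>\<mu> + 4/h\<^sup>2 \<le> a\<close>).
  A Hardy type estimate \<open>|f(n)|\<^sup>2 \<le> |n| \<Sum> |f(k+1) \<plusminus> f(k)|\<^sup>2\<close> for \<open>f(0) = 0\<close> shows that these sums control
  the weighted norm of \<open>f\<close>, with a constant that is arbitrarily small if \<open>f\<close> vanishes on a large finite set.
  As \<open>V\<close> is bounded by the weighted norm on both sides, \<open>\<langle>(H - a) f, (H - b) f\<rangle> \<ge> 0\<close> on a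
  subspace of finite codimension. The form is negative definite on the span of the eigenvectors
  with eigenvalues in \<open>(a, b)\<close>, so this span has finite dimension; and \<open>H - z\<close> is bounded below on a
  subspace of finite codimension for \<open>z\<close> in a gap, so every spectral point in a gap is an eigenvalue. There are finitely
  many gaps, hence the discrete spectrum is finite. Truncated plane waves far from the origin show that the
  bands belong to the spectrum, and they have no isolated points.
\<close>

section \<open>Bounded operators and their adjoints\<close>

lemma cinner_add_left: "cinner (x + y) z = cinner x z + cinner (y::'a::complex_inner_space) z"
  using cinner_commute[of "x + y" z] cinner_commute[of x z] cinner_commute[of y z]
  by (simp add: cinner_add_right)

lemma cinner_scaleC_left: "cinner (a *\<^sub>C x) y = cnj a * cinner (x::'a::complex_inner_space) y"
  using cinner_commute[of "a *\<^sub>C x" y] cinner_commute[of x y] by (simp add: cinner_scaleC_right)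

lemma cinner_zero_right [simp]: "cinner x (0::'a::complex_inner_space) = 0"
  using cinner_add_right[of x 0 0] by simp

lemma cinner_zero_left [simp]: "cinner (0::'a::complex_inner_space) x = 0"
  using cinner_add_left[of 0 0 x] by simp

lemma cinner_diff_right: "cinner x (y - z) = cinner x y - cinner x (z::'a::complex_inner_space)"
  using cinner_add_right[of x "y - z" z] by simp

lemma cinner_diff_left: "cinner (x - y) z = cinner x z - cinner (y::'a::complex_inner_space) z"
  using cinner_add_left[of "x - y" y z] by simp

lemma cinner_minus_left: "cinner (- x) y = - cinner x (y::'a::complex_inner_space)"
  using cinner_diff_left[of 0 x y] by simp

lemma cinner_minus_right: "cinner x (- y) = - cinner x (y::'a::complex_inner_space)"
  using cinner_diff_right[of x 0 y] by simp

lemma norm_diff_scaleR_sq: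
  "(norm (x - r *\<^sub>R y))\<^sup>2 = (norm x)\<^sup>2 - 2 * r * inner x y + r\<^sup>2 * (norm (y::'a::real_inner))\<^sup>2"
  unfolding power2_norm_eq_inner
  by (simp add: inner_diff_left inner_diff_right inner_commute[of y x] power2_eq_square algebra_simps)

lemma cinner_sum_right:
  "cinner (x::'a::complex_inner_space) (\<Sum>i\<in>I. f i) = (\<Sum>i\<in>I. cinner x (f i))"
  by (induction I rule: infinite_finite_induct) (simp_all add: cinner_add_right)

lemma cinner_sum_left:
  "cinner (\<Sum>i\<in>I. f i) (x::'a::complex_inner_space) = (\<Sum>i\<in>I. cinner (f i) x)"
  by (induction I rule: infinite_finite_induct) (simp_all add: cinner_add_left)

lemma cinner_self: "cinner x x = of_real ((norm (x::'a::complex_inner_space))\<^sup>2)"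
proof (rule complex_eqI)
  have "Im (cinner x x) = - Im (cinner x x)"
    by (subst cinner_commute) simp
  then show "Im (cinner x x) = Im (of_real ((norm x)\<^sup>2))" by simp
qed (simp add: norm_sq_eq_cinner)

lemma bounded_clinear_bounded_linear: "bounded_clinear T \<Longrightarrow> bounded_linear T"
  by (simp add: bounded_clinear_def)

lemma bounded_clinear_scaleC: "bounded_clinear T \<Longrightarrow> T (a *\<^sub>C x) = a *\<^sub>C T x"
  by (simp add: bounded_clinear_def)

lemma bounded_clinear_scale: "bounded_clinear (\<lambda>x::'a::complex_inner_space. a *\<^sub>C x)"
proof -
  have "bounded_linear (\<lambda>x::'a. a *\<^sub>C x)"
    by (rule bounded_linear_intro[where K = "norm a"])
      (simp_all add: scaleC_add_right norm_scaleC scaleC_scaleC mult.commute flip: scaleC_of_real)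
  then show ?thesis by (simp add: bounded_clinear_def scaleC_scaleC mult.commute)
qed

lemma bounded_clinear_compose:
  "bounded_clinear S \<Longrightarrow> bounded_clinear T \<Longrightarrow> bounded_clinear (\<lambda>x. S (T x))"
  by (simp add: bounded_clinear_def bounded_linear_compose)

lemma bounded_clinear_add:
  "bounded_clinear S \<Longrightarrow> bounded_clinear T \<Longrightarrow> bounded_clinear (\<lambda>x. S x + T x)"
  by (simp add: bounded_clinear_def bounded_linear_add scaleC_add_right)

lemma bounded_clinear_diff:
  "bounded_clinear S \<Longrightarrow> bounded_clinear T \<Longrightarrow> bounded_clinear (\<lambda>x. S x - T x)"
  by (simp add: bounded_clinear_def bounded_linear_sub complex_vec.scale_right_diff_distrib)

lemma bounded_clinear_ident: "bounded_clinear (\<lambda>x. x)"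
  using bounded_clinear_id by (simp add: id_def)

lemma bounded_clinear_rank_one:
  "bounded_clinear (\<lambda>y. cinner v y *\<^sub>C (e::'a::complex_inner_space))"
proof -
  have "bounded_linear (\<lambda>y. cinner v y *\<^sub>C e)"
  proof (rule bounded_linear_intro[where K = "norm v * norm e"])
    show "cinner v (r *\<^sub>R x) *\<^sub>C e = r *\<^sub>R cinner v x *\<^sub>C e" for r x
      by (simp add: cinner_scaleC_right scaleC_scaleC flip: scaleC_of_real)
    show "norm (cinner v x *\<^sub>C e) \<le> norm x * (norm v * norm e)" for x
      using mult_right_mono[OF norm_cinner_le[of v x], of "norm e"] by (simp add: norm_scaleC ac_simps)
  qed (simp add: cinner_add_right scaleC_add_left)
  then show ?thesis by (simp add: bounded_clinear_def cinner_scaleC_right scaleC_scaleC)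
qed

section \<open>Self-adjoint operators: invertibility, resolvent set, eigenvalues\<close>

lemma selfadjointD:
  assumes "selfadjoint T"
  shows "bounded_clinear T" "cinner (T x) y = cinner x (T y)" "inner (T x) y = inner x (T y)"
  using assms by (simp_all add: selfadjoint_def inner_eq_Re_cinner)

lemma selfadjoint_add: "selfadjoint S \<Longrightarrow> selfadjoint T \<Longrightarrow> selfadjoint (\<lambda>x. S x + T x)"
  by (simp add: selfadjoint_def bounded_clinear_add cinner_add_left cinner_add_right)

lemma selfadjoint_minus: "selfadjoint T \<Longrightarrow> selfadjoint (\<lambda>x. - T x)"
  using bounded_clinear_compose[OF bounded_clinear_scale[of "-1"], of T]
  by (simp add: selfadjoint_def cinner_minus_left cinner_minus_right)

text \<open>Polarization. The form is real at \<open>x + y\<close> and at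
  \<open>x + \<i> *\<^sub>C y\<close>; the first fact compares the imaginary parts of
  \<open>cinner x (W y)\<close> and \<open>cinner y (W x)\<close>, the second their real
  parts.\<close>

lemma nonneg_operator_selfadjoint:
  fixes W :: "'a::complex_inner_space \<Rightarrow> 'a"
  assumes W: "bounded_clinear W" and pos: "nonneg_operator W"
  shows "selfadjoint W"
proof -
  interpret W: bounded_linear W using W by (rule bounded_clinear_bounded_linear)
  have real: "Im (cinner x (W x)) = 0" for x
    using pos by (simp add: nonneg_operator_def complex_nonneg_Reals_iff)
  have "cinner (W x) y = cinner x (W y)" for x y
  proof -
    let ?p = "cinner x (W y)" and ?q = "cinner y (W x)"
    have "Im ?p + Im ?q = 0"
      using real[of "x + y"] real[of x] real[of y]
      by (simp add: W.add cinner_add_left cinner_add_right)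
    moreover have "Re ?p - Re ?q = 0"
      using real[of "x + \<i> *\<^sub>C y"] real[of x] real[of y]
      by (simp add: W.add bounded_clinear_scaleC[OF W] cinner_add_left cinner_add_right
          cinner_scaleC_left cinner_scaleC_right)
    ultimately have "?p = cnj ?q" by (simp add: complex_eq_iff)
    then show ?thesis using cinner_commute[of "W x" y] by simp
  qed
  then show ?thesis using W by (simp add: selfadjoint_def)
qed

text \<open>For small \<open>\<tau>\<close> the map \<open>x \<mapsto> x - \<tau> A A' x + \<tau> y\<close> is a contraction, and \<open>A\<close> maps \<open>A'\<close> of its
  fixed point to \<open>y\<close>.\<close>

lemma bounded_below_invertible:
  fixes A A' :: "'a::complex_hilbert_space \<Rightarrow> 'a"
  assumes A: "bounded_clinear A" and A': "bounded_clinear A'"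
    and adj: "\<And>x y. cinner (A x) y = cinner x (A' y)"
    and c: "c > 0" and below: "\<And>x. c * norm x \<le> norm (A x)" "\<And>x. c * norm x \<le> norm (A' x)"
  shows "\<exists>R. bounded_clinear R \<and> (\<forall>x. R (A x) = x) \<and> (\<forall>x. A (R x) = x)"
proof -
  interpret A: bounded_linear A using A by (rule bounded_clinear_bounded_linear)
  interpret A': bounded_linear A' using A' by (rule bounded_clinear_bounded_linear)
  obtain K where K: "K > 0" "\<And>x. norm (A x) \<le> norm x * K" using A.pos_bounded by blast
  \<comment> \<open>With this step size the quadratic term of
    \<open>(norm (w - \<tau> *\<^sub>R A (A' w)))\<^sup>2\<close> cancels at most half of the linear
    one, which leaves a gain of \<tau> times the square of \<open>norm (A' w)\<close>.\<close>
  define \<tau> where "\<tau> = 1 / K\<^sup>2"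
  \<comment> \<open>The truncation at 0 covers the trivial space, where \<open>c\<close> may exceed
    \<open>K\<close>.\<close>
  define q where "q = sqrt (max 0 (1 - \<tau> * c\<^sup>2))"
  have \<tau>: "\<tau> > 0" "\<tau> * K\<^sup>2 = 1" using K(1) by (simp_all add: \<tau>_def)
  have q: "0 \<le> q" "q < 1" using \<tau> c by (auto simp: q_def max_def)
  have contr: "norm (w - \<tau> *\<^sub>R A (A' w)) \<le> q * norm w" for w
  proof (rule power2_le_imp_le)
    have 1: "(norm (A (A' w)))\<^sup>2 \<le> K\<^sup>2 * (norm (A' w))\<^sup>2"
      using power_mono[OF K(2)[of "A' w"] norm_ge_zero, of 2] by (simp add: power_mult_distrib mult.commute)
    have "inner w (A (A' w)) = (norm (A' w))\<^sup>2"
      by (metis adj inner_commute inner_eq_Re_cinner norm_sq_eq_cinner)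
    then have "(norm (w - \<tau> *\<^sub>R A (A' w)))\<^sup>2
        = (norm w)\<^sup>2 - 2 * \<tau> * (norm (A' w))\<^sup>2 + \<tau>\<^sup>2 * (norm (A (A' w)))\<^sup>2"
      unfolding power2_norm_eq_inner
      by (simp add: inner_diff_left inner_diff_right inner_commute power2_eq_square algebra_simps)
    also have "\<dots> \<le> (norm w)\<^sup>2 - 2 * \<tau> * (norm (A' w))\<^sup>2 + \<tau>\<^sup>2 * (K\<^sup>2 * (norm (A' w))\<^sup>2)"
      using mult_left_mono[OF 1, of "\<tau>\<^sup>2"] by simp
    also have "\<tau>\<^sup>2 * (K\<^sup>2 * (norm (A' w))\<^sup>2) = \<tau> * (\<tau> * K\<^sup>2) * (norm (A' w))\<^sup>2"
      by (simp add: power2_eq_square)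
    also have "(norm w)\<^sup>2 - 2 * \<tau> * (norm (A' w))\<^sup>2 + \<dots> = (norm w)\<^sup>2 - \<tau> * (norm (A' w))\<^sup>2"
      unfolding \<tau>(2) by simp
    also have "\<dots> \<le> (norm w)\<^sup>2 - \<tau> * (c * norm w)\<^sup>2"
      using power_mono[OF below(2)[of w], of 2] c \<tau>(1) by simp
    also have "\<dots> = (1 - \<tau> * c\<^sup>2) * (norm w)\<^sup>2" by (simp add: algebra_simps power_mult_distrib)
    also have "\<dots> \<le> (max 0 (1 - \<tau> * c\<^sup>2)) * (norm w)\<^sup>2" by (intro mult_right_mono) auto
    also have "\<dots> = (q * norm w)\<^sup>2" by (simp add: q_def power_mult_distrib)
    finally show "(norm (w - \<tau> *\<^sub>R A (A' w)))\<^sup>2 \<le> (q * norm w)\<^sup>2" .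
  qed (use q in simp)
  have surj: "\<exists>x. A x = y" for y
  proof -
    have "\<exists>!x. x - \<tau> *\<^sub>R A (A' x) + \<tau> *\<^sub>R y = x"
    proof (rule banach_fix_type[OF q], intro allI)
      fix u v
      have "u - \<tau> *\<^sub>R A (A' u) + \<tau> *\<^sub>R y - (v - \<tau> *\<^sub>R A (A' v) + \<tau> *\<^sub>R y)
          = (u - v) - \<tau> *\<^sub>R A (A' (u - v))"
        by (simp add: A.diff A'.diff scaleR_right_diff_distrib)
      then show "dist (u - \<tau> *\<^sub>R A (A' u) + \<tau> *\<^sub>R y) (v - \<tau> *\<^sub>R A (A' v) + \<tau> *\<^sub>R y) \<le> q * dist u v"
        using contr[of "u - v"] unfolding dist_norm by (simp only:)
    qed
    then obtain x where "\<tau> *\<^sub>R y = \<tau> *\<^sub>R A (A' x)" by (auto simp: algebra_simps)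
    then show ?thesis using \<tau>(1) by auto
  qed
  have inj: "x = y" if "A x = A y" for x y
    using below(1)[of "x - y"] that c by (simp add: A.diff mult_le_0_iff)
  define R where "R = inv A"
  have R: "A (R x) = x" "R (A x) = x" for x
  proof -
    show R1: "A (R x) = x" for x unfolding R_def by (rule f_inv_into_f) (use surj[of x] in auto)
    show "R (A x) = x" by (rule inj) (rule R1)
  qed
  have "bounded_linear R"
  proof (rule bounded_linear_intro[where K = "1 / c"])
    show "R (x + y) = R x + R y" for x y by (rule inj) (simp add: R A.add)
    show "R (r *\<^sub>R x) = r *\<^sub>R R x" for r x by (rule inj) (simp add: R A.scaleR)
    show "norm (R x) \<le> norm x * (1 / c)" for x
      using below(1)[of "R x"] c by (simp add: R field_simps)
  qed
  moreover have "R (a *\<^sub>C x) = a *\<^sub>C R x" for a x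
    by (rule inj) (simp add: R bounded_clinear_scaleC[OF A])
  ultimately show ?thesis using R by (auto simp: bounded_clinear_def)
qed

text \<open>Pythagoras: symmetry makes \<open>cinner y x\<close> real for
  \<open>y = T x - of_real (Re z) *\<^sub>C x\<close>, so \<open>y\<close> and the purely imaginary
  multiple of \<open>x\<close> are orthogonal in the real scalar product.\<close>

lemma norm_selfadjoint_shift:
  assumes "selfadjoint T"
  shows "(norm (T x - z *\<^sub>C x))\<^sup>2 = (norm (T x - of_real (Re z) *\<^sub>C x))\<^sup>2 + (Im z)\<^sup>2 * (norm x)\<^sup>2"
proof -
  define y where "y = T x - of_real (Re z) *\<^sub>C x"
  have "cinner y x = cnj (cinner y x)"
    using cinner_commute[of x "T x"] selfadjointD(2)[OF assms, of x x]
    by (simp add: y_def cinner_diff_left cinner_scaleC_left cinner_self)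
  then have "Im (cinner y x) = 0" by (simp add: complex_eq_iff)
  have "z *\<^sub>C x = of_real (Re z) *\<^sub>C x + (\<i> * of_real (Im z)) *\<^sub>C x"
    unfolding scaleC_add_left[symmetric] by (simp add: complex_eq)
  then have eq: "T x - z *\<^sub>C x = y - (\<i> * of_real (Im z)) *\<^sub>C x" by (simp add: y_def)
  have "inner y ((\<i> * of_real (Im z)) *\<^sub>C x) = 0"
    using \<open>Im (cinner y x) = 0\<close> by (simp add: inner_eq_Re_cinner cinner_scaleC_right)
  then have "(norm (T x - z *\<^sub>C x))\<^sup>2 = (norm y)\<^sup>2 + (norm ((\<i> * of_real (Im z)) *\<^sub>C x))\<^sup>2"
    unfolding eq power2_norm_eq_inner by (simp add: inner_diff_left inner_diff_right inner_commute)
  then show ?thesis by (simp add: norm_scaleC norm_mult power_mult_distrib y_def)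
qed

text \<open>The adjoint of \<open>T - z\<close> is \<open>T - cnj z\<close>. By the previous
  identity both have the same norm on every vector, so a single lower bound serves for the operator
  and for its adjoint.\<close>

lemma bounded_below_resolvent_set:
  fixes T :: "'a::complex_hilbert_space \<Rightarrow> 'a"
  assumes T: "selfadjoint T" and c: "c > 0" and below: "\<And>x. c * norm x \<le> norm (T x - z *\<^sub>C x)"
  shows "z \<in> resolvent_set T"
  unfolding resolvent_set_def mem_Collect_eq
proof (rule bounded_below_invertible[OF _ _ _ c below])
  show lin: "bounded_clinear (\<lambda>x. T x - z *\<^sub>C x)" for z
    by (intro bounded_clinear_diff bounded_clinear_scale selfadjointD(1)[OF T])
  show "bounded_clinear (\<lambda>x. T x - cnj z *\<^sub>C x)" by (rule lin)
  show "cinner (T x - z *\<^sub>C x) y = cinner x (T y - cnj z *\<^sub>C y)" for x y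
    by (simp add: cinner_diff_left cinner_diff_right selfadjointD(2)[OF T] cinner_scaleC_left
        cinner_scaleC_right)
  have "norm (T x - cnj z *\<^sub>C x) = norm (T x - z *\<^sub>C x)" for x
    by (rule power2_eq_imp_eq)
      (use norm_selfadjoint_shift[OF T, of x z] norm_selfadjoint_shift[OF T, of x "cnj z"] in simp_all)
  then show "c * norm x \<le> norm (T x - cnj z *\<^sub>C x)" for x using below by simp
qed

lemma nonreal_resolvent_set:
  fixes T :: "'a::complex_hilbert_space \<Rightarrow> 'a"
  assumes T: "selfadjoint T" and "Im z \<noteq> 0"
  shows "z \<in> resolvent_set T"
proof (rule bounded_below_resolvent_set[OF T, of "\<bar>Im z\<bar>"])
  show "\<bar>Im z\<bar> * norm x \<le> norm (T x - z *\<^sub>C x)" for x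
  proof (rule power2_le_imp_le)
    show "(\<bar>Im z\<bar> * norm x)\<^sup>2 \<le> (norm (T x - z *\<^sub>C x))\<^sup>2"
      unfolding norm_selfadjoint_shift[OF T, of x z] by (simp add: power_mult_distrib)
  qed simp
qed (use assms in auto)

lemma eigenvalue_spectrum: "eigenvalues T \<subseteq> spectrum T"
proof
  fix z assume "z \<in> eigenvalues T"
  then obtain x where x: "x \<noteq> 0" "T x = z *\<^sub>C x" by (auto simp: eigenvalues_def)
  have False if R: "bounded_clinear R" "\<forall>x. R (T x - z *\<^sub>C x) = x" for R
  proof -
    have "R (T x - z *\<^sub>C x) = 0"
      using linear_0[OF bounded_linear.linear[OF bounded_clinear_bounded_linear[OF R(1)]]] x(2) by simp
    then show False using R(2) x(1) by simp
  qed
  then show "z \<in> spectrum T" unfolding spectrum_def resolvent_set_def by blast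
qed

lemma eigenvalue_real:
  fixes T :: "'a::complex_hilbert_space \<Rightarrow> 'a"
  shows "selfadjoint T \<Longrightarrow> z \<in> eigenvalues T \<Longrightarrow> z = of_real (Re z)"
  using nonreal_resolvent_set[of T z] subsetD[OF eigenvalue_spectrum, of z T]
  unfolding spectrum_def complex_eq_iff by auto

lemma eigenvectors_orthogonal:
  assumes T: "selfadjoint T" and "T x = of_real l *\<^sub>C x" "T y = of_real m *\<^sub>C y" "l \<noteq> m"
  shows "cinner x y = 0"
  using selfadjointD(2)[OF T, of x y] assms(4)
  unfolding assms(2,3) cinner_scaleC_left cinner_scaleC_right by simp

section \<open>Operators bounded below on a subspace of finite codimension\<close>

lemma Cauchy_diff:
  fixes X Y :: "nat \<Rightarrow> 'a::real_normed_vector"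
  assumes "Cauchy X" "Cauchy Y"
  shows "Cauchy (\<lambda>n. X n - Y n)"
proof (rule CauchyI)
  fix e :: real assume "e > 0"
  then have "e / 2 > 0" by simp
  then obtain M N where *: "\<forall>m\<ge>M. \<forall>n\<ge>M. norm (X m - X n) < e / 2" "\<forall>m\<ge>N. \<forall>n\<ge>N. norm (Y m - Y n) < e / 2"
    using CauchyD[OF assms(1)] CauchyD[OF assms(2)] by metis
  have "norm (X m - Y m - (X n - Y n)) < e" if "m \<ge> max M N" "n \<ge> max M N" for m n
  proof -
    have "norm (X m - Y m - (X n - Y n)) = norm ((X m - X n) - (Y m - Y n))" by (simp add: algebra_simps)
    also have "\<dots> \<le> norm (X m - X n) + norm (Y m - Y n)" by (rule norm_triangle_ineq4)
    also have "\<dots> < e / 2 + e / 2" using * that by (intro add_strict_mono) auto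
    finally show ?thesis by simp
  qed
  then show "\<exists>M. \<forall>m\<ge>M. \<forall>n\<ge>M. norm (X m - Y m - (X n - Y n)) < e" by blast
qed

text \<open>A lower bound on a complete subspace makes its image complete, hence closed, so
  \<open>v\<close> has a positive distance to the image; homogeneity turns this distance into
  control of the coefficient \<open>a\<close>.\<close>

lemma bounded_below_extend_aux:
  fixes T :: "'a::complex_inner_space \<Rightarrow> 'b::complex_inner_space"
  assumes T: "bounded_clinear T" and M: "complex_vec.subspace M" "complete M"
    and c: "c > 0" "\<And>x. x \<in> M \<Longrightarrow> c * norm x \<le> norm (T x)" and v: "v \<notin> T ` M"
  obtains d where "d > 0" "\<And>x a. x \<in> M \<Longrightarrow> d * norm a \<le> norm (T x + a *\<^sub>C v)"
proof -
  interpret T: bounded_linear T using T by (rule bounded_clinear_bounded_linear)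
  have "subspace M" using M(1) unfolding complex_vec.subspace_def subspace_def
    by (simp flip: scaleC_of_real)
  then have "complete (T ` M)"
    by (intro complete_isometric_image[OF c(1)] M T.bounded_linear_axioms)
      (use c in \<open>auto simp: mult.commute\<close>)
  then have "open (- (T ` M))" by (simp add: complete_imp_closed open_Compl)
  then obtain d where d: "d > 0" "ball v d \<subseteq> - (T ` M)" using v unfolding open_contains_ball by blast
  show ?thesis
  proof
    show "d > 0" by fact
    fix x a assume x: "x \<in> M"
    show "d * norm a \<le> norm (T x + a *\<^sub>C v)"
    proof (cases "a = 0")
      case False
      have "- inverse a *\<^sub>C x \<in> M" using M(1) x complex_vec.subspace_scale by blast
      then have "T (- inverse a *\<^sub>C x) \<notin> ball v d" using d(2) by blast
      then have "d \<le> norm (v + inverse a *\<^sub>C T x)"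
        by (simp add: dist_norm T.neg bounded_clinear_scaleC[OF T])
      then have "norm a * d \<le> norm (a *\<^sub>C (v + inverse a *\<^sub>C T x))"
        by (simp add: norm_scaleC mult_left_mono)
      also have "a *\<^sub>C (v + inverse a *\<^sub>C T x) = T x + a *\<^sub>C v"
        using False by (simp add: scaleC_add_right scaleC_scaleC)
      finally show ?thesis by (simp add: mult.commute)
    qed simp
  qed
qed

text \<open>One more dimension. The distance of \<open>e\<close> from \<open>M\<close> controls the
  coefficient of \<open>e\<close> by the norm of the vector (for completeness), and the distance of
  \<open>T e\<close> from the image of \<open>M\<close> controls it by the norm of the image (for
  the lower bound).\<close>

lemma bounded_below_extend:
  fixes T :: "'a::complex_inner_space \<Rightarrow> 'b::complex_inner_space"
  assumes T: "bounded_clinear T" and M: "complex_vec.subspace M" "complete M"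
    and c: "c > 0" "\<And>x. x \<in> M \<Longrightarrow> c * norm x \<le> norm (T x)" and e: "e \<notin> M"
    and inj: "\<And>x a. x \<in> M \<Longrightarrow> T (x + a *\<^sub>C e) = 0 \<Longrightarrow> x + a *\<^sub>C e = 0"
    and M': "M' = {x + a *\<^sub>C e | x a. x \<in> M}"
  shows "complete M'" "\<exists>c'>0. \<forall>x\<in>M'. c' * norm x \<le> norm (T x)"
proof -
  interpret T: bounded_linear T using T by (rule bounded_clinear_bounded_linear)
  obtain d0 where d0: "d0 > 0" "\<And>x a. x \<in> M \<Longrightarrow> d0 * norm a \<le> norm (x + a *\<^sub>C e)"
    using bounded_below_extend_aux[OF bounded_clinear_ident M, of 1 e] e by auto
  show "complete M'"
    unfolding complete_def
  proof (intro allI impI)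
    fix s assume s: "(\<forall>n. s n \<in> M') \<and> Cauchy s"
    then have "\<exists>p. fst p \<in> M \<and> s n = fst p + snd p *\<^sub>C e" for n unfolding M' by fastforce
    then obtain p where p: "\<And>n. fst (p n) \<in> M" "\<And>n. s n = fst (p n) + snd (p n) *\<^sub>C e" by metis
    define x a where "x = fst \<circ> p" and "a = snd \<circ> p"
    with p have xa: "\<And>n. x n \<in> M" "\<And>n. s n = x n + a n *\<^sub>C e" by simp_all
    have "Cauchy a"
      unfolding Cauchy_def dist_norm
    proof (intro allI impI)
      fix r :: real assume "r > 0"
      then obtain N where N: "\<forall>m\<ge>N. \<forall>n\<ge>N. norm (s m - s n) < d0 * r"
        using s mult_pos_pos[OF d0(1) \<open>r > 0\<close>] unfolding Cauchy_def dist_norm by blast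
      have "norm (a m - a n) < r" if "m \<ge> N" "n \<ge> N" for m n
      proof -
        have "d0 * norm (a m - a n) \<le> norm ((x m - x n) + (a m - a n) *\<^sub>C e)"
          by (intro d0(2) complex_vec.subspace_diff M xa)
        also have "(x m - x n) + (a m - a n) *\<^sub>C e = s m - s n"
          by (simp add: xa complex_vec.scale_left_diff_distrib)
        also have "norm \<dots> < d0 * r" using N that by blast
        finally show ?thesis using d0(1) by simp
      qed
      then show "\<exists>M. \<forall>m\<ge>M. \<forall>n\<ge>M. norm (a m - a n) < r" by blast
    qed
    then obtain a0 where a0: "a \<longlonglongrightarrow> a0" by (auto simp: Cauchy_convergent_iff convergent_def)
    have "bounded_linear (\<lambda>t. t *\<^sub>C e)"
      by (rule bounded_linear_intro[where K = "norm e"])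
        (simp_all add: scaleC_add_left norm_scaleC scaleC_scaleC scaleR_conv_of_real flip: scaleC_of_real)
    then have ae: "(\<lambda>n. a n *\<^sub>C e) \<longlonglongrightarrow> a0 *\<^sub>C e" by (rule bounded_linear.tendsto[OF _ a0])
    have "Cauchy (\<lambda>n. s n - a n *\<^sub>C e)"
      using Cauchy_diff[OF _ LIMSEQ_imp_Cauchy[OF ae]] s by blast
    then have "Cauchy x" by (simp add: xa)
    then obtain x0 where x0: "x0 \<in> M" "x \<longlonglongrightarrow> x0" using M(2) xa(1) unfolding complete_def by blast
    have "s \<longlonglongrightarrow> x0 + a0 *\<^sub>C e" using tendsto_add[OF x0(2) ae] by (simp flip: xa(2))
    then show "\<exists>l\<in>M'. s \<longlonglongrightarrow> l" using x0(1) by (auto simp: M')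
  qed
  \<comment> \<open>Otherwise \<open>e - x\<close> with \<open>x\<close> in \<open>M\<close> would
    be a nonzero element of the kernel in the extended space.\<close>
  have "T e \<notin> T ` M"
  proof
    assume "T e \<in> T ` M"
    then obtain x where x: "x \<in> M" "T e = T x" by auto
    have "- x \<in> M" using x M(1) complex_vec.subspace_neg by blast
    then have "- x + 1 *\<^sub>C e = 0" by (rule inj) (use x in \<open>simp add: T.add T.neg T.diff\<close>)
    then show False using e x by simp
  qed
  then obtain d where d: "d > 0" "\<And>x a. x \<in> M \<Longrightarrow> d * norm a \<le> norm (T x + a *\<^sub>C T e)"
    using bounded_below_extend_aux[OF T M c] by auto
  \<comment> \<open>With \<open>r = norm (T y)\<close>, the coefficient of \<open>e\<close> is at
    most \<open>r / d\<close>; the first summand bounds the part of \<open>y\<close> in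
    \<open>M\<close>, the second the part along \<open>e\<close>.\<close>
  define C where "C = (1 + norm (T e) / d) / c + norm e / d"
  have C: "C > 0" unfolding C_def using c d
    by (intro add_pos_nonneg divide_pos_pos) auto
  show "\<exists>c'>0. \<forall>x\<in>M'. c' * norm x \<le> norm (T x)"
  proof (intro exI[of _ "1 / C"] conjI ballI)
    fix y assume "y \<in> M'"
    then obtain x a where y: "x \<in> M" "y = x + a *\<^sub>C e" by (auto simp: M')
    define r where "r = norm (T y)"
    have Ty: "T y = T x + a *\<^sub>C T e" by (simp add: y T.add bounded_clinear_scaleC[OF T])
    have a: "norm a \<le> r / d" using d(2)[OF y(1), of a] d(1) by (simp add: Ty r_def field_simps)
    have "c * norm x \<le> norm (T x)" by (rule c(2)[OF y(1)])
    also have "\<dots> \<le> r + norm a * norm (T e)"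
      using norm_triangle_ineq4[of "T y" "a *\<^sub>C T e"] by (simp add: Ty r_def norm_scaleC)
    also have "\<dots> \<le> r + r / d * norm (T e)" using a by (intro add_left_mono mult_right_mono) auto
    also have "\<dots> = r * (1 + norm (T e) / d)" by (simp add: algebra_simps)
    finally have x: "norm x \<le> r * ((1 + norm (T e) / d) / c)" using c(1) by (simp add: field_simps)
    have "norm y \<le> norm x + norm a * norm e" using norm_triangle_ineq[of x "a *\<^sub>C e"] by (simp add: y norm_scaleC)
    also have "\<dots> \<le> r * ((1 + norm (T e) / d) / c) + r / d * norm e"
      using x a by (intro add_mono mult_right_mono) auto
    also have "\<dots> = r * C" by (simp add: C_def algebra_simps)
    finally show "1 / C * norm y \<le> norm (T y)" using C by (simp add: r_def field_simps)
  qed (use C in simp)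
qed

text \<open>Adds the vectors of \<open>B\<close> one at a time. This is how an operator that is
  bounded below on a closed subspace of finite codimension and injective is seen to be bounded below
  everywhere.\<close>

lemma bounded_below_finite_extension:
  fixes T :: "'a::complex_inner_space \<Rightarrow> 'b::complex_inner_space"
  assumes T: "bounded_clinear T" and M: "complex_vec.subspace M" "complete M"
    and c: "c > 0" "\<And>x. x \<in> M \<Longrightarrow> c * norm x \<le> norm (T x)" and B: "finite B"
    and inj: "\<And>x. x \<in> cspan (M \<union> B) \<Longrightarrow> T x = 0 \<Longrightarrow> x = 0"
  shows "complete (cspan (M \<union> B)) \<and> (\<exists>c'>0. \<forall>x\<in>cspan (M \<union> B). c' * norm x \<le> norm (T x))"
  using B inj
proof (induction B rule: finite_induct)
  case empty
  have "cspan M = M" using M(1) by (simp add: complex_vec.span_eq_iff)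
  then show ?case unfolding Un_empty_right by (simp only:) (use M c in blast)
next
  case (insert e B)
  have sub: "cspan (M \<union> B) \<subseteq> cspan (M \<union> insert e B)" by (rule complex_vec.span_mono) auto
  then obtain c' where c': "c' > 0" "\<And>x. x \<in> cspan (M \<union> B) \<Longrightarrow> c' * norm x \<le> norm (T x)"
    and compl: "complete (cspan (M \<union> B))" using insert by blast
  have eq: "cspan (M \<union> insert e B) = {x + a *\<^sub>C e | x a. x \<in> cspan (M \<union> B)}"
  proof (intro equalityI subsetI)
    fix x assume "x \<in> cspan (M \<union> insert e B)"
    then obtain k where "x - k *\<^sub>C e \<in> cspan (M \<union> B)"
      using complex_vec.span_insert[of e "M \<union> B"] by auto
    then show "x \<in> {x + a *\<^sub>C e | x a. x \<in> cspan (M \<union> B)}"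
      by (auto intro!: exI[of _ "x - k *\<^sub>C e"] exI[of _ k])
  next
    fix x assume "x \<in> {x + a *\<^sub>C e | x a. x \<in> cspan (M \<union> B)}"
    then obtain y a where "y \<in> cspan (M \<union> B)" "x = y + a *\<^sub>C e" by blast
    then have "x - a *\<^sub>C e \<in> cspan (M \<union> B)" by simp
    then show "x \<in> cspan (M \<union> insert e B)"
      using complex_vec.span_insert[of e "M \<union> B"] by auto
  qed
  show ?case
  proof (cases "e \<in> cspan (M \<union> B)")
    case True
    then have "cspan (M \<union> insert e B) = cspan (M \<union> B)"
      by (simp add: complex_vec.span_redundant)
    then show ?thesis using c' compl by auto
  next
    case False
    have "x + a *\<^sub>C e = 0" if "x \<in> cspan (M \<union> B)" "T (x + a *\<^sub>C e) = 0" for x a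
      using insert.prems[of "x + a *\<^sub>C e"] that unfolding eq by blast
    from bounded_below_extend[OF T complex_vec.subspace_span compl c' False this eq]
    show ?thesis by blast
  qed
qed

section \<open>Self-adjoint operators in finite dimension\<close>

definition orthonormal :: "'a::complex_inner_space set \<Rightarrow> bool" where
  "orthonormal E \<longleftrightarrow> (\<forall>e\<in>E. \<forall>f\<in>E. cinner e f = (if e = f then 1 else 0))"

lemma orthonormal_independent:
  assumes "orthonormal E"
  shows "complex_vec.independent E"
  unfolding complex_vec.independent_explicit_module
proof (intro allI impI)
  fix t u v
  assume t: "finite t" "t \<subseteq> E" "(\<Sum>v\<in>t. u v *\<^sub>C v) = 0" "v \<in> t"
  have "0 = cinner v (\<Sum>w\<in>t. u w *\<^sub>C w)" unfolding t(3) by simp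
  also have "\<dots> = (\<Sum>w\<in>t. if v = w then u w else 0)"
    unfolding cinner_sum_right cinner_scaleC_right
    using assms subsetD[OF t(2)] t(4) by (intro sum.cong) (auto simp: orthonormal_def split: if_splits)
  also have "\<dots> = u v" using t(1,4) by simp
  finally show "u v = 0" by simp
qed

lemma orthonormal_card_le:
  assumes "orthonormal E" "finite B" "E \<subseteq> cspan B"
  shows "finite E \<and> card E \<le> card B"
  using complex_vec.independent_span_bound[OF assms(2) orthonormal_independent[OF assms(1)] assms(3)] .

text \<open>The preceding extension started from the zero subspace; it takes the place of a
  compactness argument on the unit sphere.\<close>

lemma finite_dim_injective_bounded_below:
  fixes T :: "'a::complex_inner_space \<Rightarrow> 'b::complex_inner_space"
  assumes T: "bounded_clinear T" and B: "finite B"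
    and inj: "\<And>x. x \<in> cspan B \<Longrightarrow> T x = 0 \<Longrightarrow> x = 0"
  obtains c where "c > 0" "\<And>x. x \<in> cspan B \<Longrightarrow> c * norm x \<le> norm (T x)"
proof -
  have eq: "cspan ({0} \<union> B) = cspan B" by (simp add: complex_vec.span_insert_0)
  have "\<exists>c'>0. \<forall>x\<in>cspan ({0} \<union> B). c' * norm x \<le> norm (T x)"
    by (rule conjunct2[OF bounded_below_finite_extension[OF T complex_vec.subspace_single_0 _ zero_less_one _ B]])
      (use inj in \<open>unfold eq, auto simp: compact_imp_complete\<close>)
  then show ?thesis using that unfolding eq by blast
qed

lemma finite_dim_basis:
  assumes "complex_vec.subspace S" "S \<subseteq> cspan B" "finite B"
  obtains B' where "finite B'" "cspan B' = S" "B' \<subseteq> S"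
proof -
  obtain B' where B': "B' \<subseteq> S" "complex_vec.independent B'" "S \<subseteq> cspan B'"
    by (rule complex_vec.maximal_independent_subset)
  then have "finite B'"
    using complex_vec.independent_span_bound[OF assms(3) B'(2)] assms(2) by blast
  moreover have "cspan B' = S"
    using B' complex_vec.span_minimal[OF B'(1) assms(1)] by blast
  ultimately show ?thesis using that B'(1) by blast
qed

text \<open>With \<open>c\<close> the norm of \<open>T\<close> on \<open>S\<close>, the operator \<open>T\<^sup>2 - c\<^sup>2 = (T - c) (T + c)\<close> is not bounded
  below on \<open>S\<close>, hence not injective there.\<close>

lemma selfadjoint_finite_dim_eigenvector:
  fixes T :: "'a::complex_inner_space \<Rightarrow> 'a"
  assumes T: "selfadjoint T" and S: "complex_vec.subspace S" "S \<subseteq> cspan B" "finite B"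
    and inv: "\<And>x. x \<in> S \<Longrightarrow> T x \<in> S" and nz: "y \<in> S" "y \<noteq> 0"
  shows "\<exists>x\<in>S. x \<noteq> 0 \<and> (\<exists>l. T x = complex_of_real l *\<^sub>C x)"
proof (rule ccontr)
  assume no: "\<not> ?thesis"
  interpret T: bounded_linear T using selfadjointD(1)[OF T] by (rule bounded_clinear_bounded_linear)
  obtain K where K: "K > 0" "\<And>x. norm (T x) \<le> norm x * K" using T.pos_bounded by blast
  obtain B' where B': "finite B'" "cspan B' = S" using finite_dim_basis[OF S] by metis
  define N where "N = {norm (T x) | x. x \<in> S \<and> norm x = 1}"
  define c where "c = Sup N"
  have scaleR: "r *\<^sub>R x \<in> S" if "x \<in> S" for r x
    using complex_vec.subspace_scale[OF S(1) that, of "of_real r"] by (simp add: scaleC_of_real)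
  have Sadd: "x + y \<in> S" if "x \<in> S" "y \<in> S" for x y
    using complex_vec.subspace_add[OF S(1) that] .
  have bdd: "bdd_above N"
  proof (rule bdd_aboveI[of _ K])
    fix t assume "t \<in> N"
    then obtain x where "norm x = 1" "t = norm (T x)" by (auto simp: N_def)
    then show "t \<le> K" using K(2)[of x] by simp
  qed
  have le1: "norm (T x) \<le> c" if "x \<in> S" "norm x = 1" for x
    unfolding c_def by (rule cSup_upper[OF _ bdd]) (use that in \<open>auto simp: N_def\<close>)
  define y1 where "y1 = (1 / norm y) *\<^sub>R y"
  have y1: "y1 \<in> S" "norm y1 = 1" using nz scaleR by (auto simp: y1_def)
  have c0: "c \<ge> 0" using le1[OF y1] norm_ge_zero order_trans by blast
  have le: "norm (T x) \<le> c * norm x" if "x \<in> S" for x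
  proof (cases "x = 0")
    case False
    then have "norm (T ((1 / norm x) *\<^sub>R x)) \<le> c" using that scaleR by (intro le1) auto
    then show ?thesis using False by (simp add: T.scaleR field_simps)
  qed (simp add: T.zero)
  let ?A = "\<lambda>x. T (T x) - of_real (c\<^sup>2) *\<^sub>C x"
  \<comment> \<open>If \<open>(T - c) (T + c) x = 0\<close>, then \<open>T x + c x\<close> is killed
    by \<open>T - c\<close> and must vanish, as there are no eigenvectors; then \<open>x\<close>
    itself belongs to \<open>- c\<close>.\<close>
  have "x = 0" if x: "x \<in> S" "?A x = 0" for x
  proof -
    have "T x + c *\<^sub>R x \<in> S" using x inv scaleR Sadd by blast
    moreover have "T (T x + c *\<^sub>R x) = c *\<^sub>R (T x + c *\<^sub>R x)"
      using x(2) unfolding scaleC_of_real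
      by (simp add: T.add T.scaleR scaleR_add_right power2_eq_square)
    ultimately have "T x + c *\<^sub>R x = 0" using no unfolding scaleC_of_real by blast
    then have "T x = complex_of_real (- c) *\<^sub>C x"
      unfolding scaleC_of_real by (simp add: eq_neg_iff_add_eq_0)
    then show "x = 0" using no x(1) by blast
  qed
  moreover have "bounded_clinear ?A"
    by (intro bounded_clinear_diff bounded_clinear_scale bounded_clinear_compose[OF selfadjointD(1)[OF T]] selfadjointD(1)[OF T])
  ultimately obtain d where d: "d > 0" "\<And>x. x \<in> S \<Longrightarrow> d * norm x \<le> norm (?A x)"
    using finite_dim_injective_bounded_below[of ?A B'] B' by metis
  \<comment> \<open>Expanding the square and using that \<open>T (T x)\<close> has norm at most the
    square of \<open>c\<close> bounds the distance of \<open>T (T x)\<close> from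
    \<open>c\<^sup>2 *\<^sub>R x\<close>. The constant \<open>d\<close> therefore keeps
    \<open>norm (T x)\<close> uniformly below \<open>c\<close> on the unit sphere, against the
    choice of \<open>c\<close> as a supremum.\<close>
  have key: "d\<^sup>2 \<le> 2 * c\<^sup>2 * (c\<^sup>2 - (norm (T x))\<^sup>2)" if x: "x \<in> S" "norm x = 1" for x
  proof -
    have "d\<^sup>2 \<le> (norm (T (T x) - c\<^sup>2 *\<^sub>R x))\<^sup>2"
      using power_mono[OF d(2)[OF x(1)], of 2] d(1) x(2) unfolding scaleC_of_real by simp
    also have "inner (T (T x)) x = (norm (T x))\<^sup>2"
      using selfadjointD(3)[OF T, of "T x" x] by (simp only: power2_norm_eq_inner)
    then have "(norm (T (T x) - c\<^sup>2 *\<^sub>R x))\<^sup>2 = (norm (T (T x)))\<^sup>2 - 2 * c\<^sup>2 * (norm (T x))\<^sup>2 + c\<^sup>2 * c\<^sup>2 * (norm x)\<^sup>2"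
      by (simp only: norm_diff_scaleR_sq) (simp add: power2_eq_square)
    also have "norm (T (T x)) \<le> c * c"
      using le[OF inv[OF x(1)]] mult_left_mono[OF le[OF x(1)] c0] x(2) by simp
    then have "(norm (T (T x)))\<^sup>2 \<le> c\<^sup>2 * c\<^sup>2"
      using power_mono[of "norm (T (T x))" "c * c" 2] by (simp add: power_mult_distrib)
    finally show ?thesis using x(2) by (simp add: algebra_simps)
  qed
  have "c > 0" using key[OF y1] d(1) c0 by (cases "c = 0") auto
  define q where "q = c\<^sup>2 - d\<^sup>2 / (2 * c\<^sup>2)"
  have q: "(norm (T x))\<^sup>2 \<le> q" if "x \<in> S" "norm x = 1" for x
    using key[OF that] \<open>c > 0\<close> by (simp add: q_def field_simps)
  have "c \<le> sqrt q"
    unfolding c_def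
  proof (rule cSup_least)
    show "N \<noteq> {}" using y1 by (auto simp: N_def)
    show "\<And>t. t \<in> N \<Longrightarrow> t \<le> sqrt q" using q by (auto simp: N_def intro: real_le_rsqrt)
  qed
  moreover have "sqrt q < sqrt (c\<^sup>2)" using d(1) \<open>c > 0\<close> by (intro real_sqrt_less_mono) (simp add: q_def)
  ultimately show False using c0 by simp
qed

text \<open>Data of the spectral theorem for \<open>Q\<close>. The function \<mu> may repeat values,
  so multiplicities are carried by \<open>E\<close>.\<close>

locale eigenbasis =
  fixes Q :: "'g::complex_hilbert_space \<Rightarrow> 'g" and E :: "'g set" and \<mu> :: "'g \<Rightarrow> real"
  assumes selfadjoint: "selfadjoint Q" and finite: "finite E" and orthonormal: "orthonormal E"
    and eigen: "\<And>e. e \<in> E \<Longrightarrow> Q e = complex_of_real (\<mu> e) *\<^sub>C e"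
    and expand: "\<And>x. (\<Sum>e\<in>E. cinner e x *\<^sub>C e) = x"

text \<open>Orthonormal sets of eigenvectors have bounded cardinality, so a largest one exists. Its
  orthogonal complement \<open>S\<close> is invariant; a nonzero vector there would produce one more
  eigenvector orthogonal to all others. Hence \<open>S\<close> is trivial, and the remainder of
  every expansion vanishes.\<close>

lemma selfadjoint_eigenbasis:
  fixes T :: "'a::complex_hilbert_space \<Rightarrow> 'a"
  assumes T: "selfadjoint T" and "cfinite_dim (UNIV :: 'a set)"
  shows "\<exists>E \<mu>. eigenbasis T E \<mu>"
proof -
  obtain B :: "'a set" where B: "finite B" "cspan B = UNIV"
    using assms(2) by (auto simp: cfinite_dim_def)
  let ?P = "\<lambda>E. orthonormal E \<and> (\<forall>e\<in>E. \<exists>l. T e = complex_of_real l *\<^sub>C e)"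
  have fin: "finite E \<and> card E \<le> card B" if "?P E" for E
    using orthonormal_card_le[of E B] B that by simp
  have "\<exists>E. ?P E \<and> (\<forall>E'. ?P E' \<longrightarrow> card E' \<le> card E)"
    by (rule ex_has_greatest_nat[where k = "{}" and b = "Suc (card B)"]) (use fin in \<open>auto simp: orthonormal_def less_Suc_eq_le\<close>)
  then obtain E where E: "?P E" "\<And>E'. ?P E' \<Longrightarrow> card E' \<le> card E" by blast
  then obtain \<mu> where \<mu>: "\<And>e. e \<in> E \<Longrightarrow> T e = complex_of_real (\<mu> e) *\<^sub>C e" by metis
  have finE: "finite E" using fin[OF E(1)] by simp
  define S where "S = {x. \<forall>e\<in>E. cinner e x = 0}"
  have S: "complex_vec.subspace S"
    by (rule complex_vec.subspaceI) (simp_all add: S_def cinner_add_right cinner_scaleC_right)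
  have S0: "x = 0" if "x \<in> S" for x
  proof (rule ccontr)
    assume "x \<noteq> 0"
    have "T z \<in> S" if "z \<in> S" for z
      using that \<mu> by (simp add: S_def cinner_scaleC_left flip: selfadjointD(2)[OF T])
    then obtain w l where w: "w \<in> S" "w \<noteq> 0" "T w = complex_of_real l *\<^sub>C w"
      using selfadjoint_finite_dim_eigenvector[OF T S _ B(1) _ \<open>x \<in> S\<close> \<open>x \<noteq> 0\<close>] B(2) by auto
    define v where "v = complex_of_real (1 / norm w) *\<^sub>C w"
    have v: "v \<in> S" unfolding v_def by (rule complex_vec.subspace_scale[OF S w(1)])
    have v1: "cinner v v = 1" using w(2) by (simp add: v_def cinner_self norm_scaleC norm_divide)
    then have "v \<notin> E" using v by (auto simp: S_def)
    moreover have "cinner v e = 0" if "e \<in> E" for e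
      using v that by (subst cinner_commute) (simp add: S_def)
    moreover have "T v = complex_of_real l *\<^sub>C v"
      unfolding v_def bounded_clinear_scaleC[OF selfadjointD(1)[OF T]] w(3) by (simp add: scaleC_scaleC)
    moreover have "cinner e v = 0" if "e \<in> E" for e using v that by (simp add: S_def)
    ultimately have "orthonormal (insert v E)"
      using E(1) v1 unfolding orthonormal_def by (metis insert_iff)
    moreover have "\<forall>e\<in>insert v E. \<exists>l. T e = complex_of_real l *\<^sub>C e"
      using E(1) \<open>T v = complex_of_real l *\<^sub>C v\<close> by blast
    ultimately have "?P (insert v E)" by blast
    from E(2)[OF this] show False using \<open>v \<notin> E\<close> finE by simp
  qed
  have "(\<Sum>e\<in>E. cinner e x *\<^sub>C e) = x" for x
  proof -
    have "cinner f (x - (\<Sum>e\<in>E. cinner e x *\<^sub>C e)) = 0" if "f \<in> E" for f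
    proof -
      have "(\<Sum>e\<in>E. cinner e x * cinner f e) = (\<Sum>e\<in>E. if f = e then cinner e x else 0)"
        using E(1) that by (intro sum.cong) (auto simp: orthonormal_def)
      then show ?thesis using that finE by (simp add: cinner_diff_right cinner_sum_right cinner_scaleC_right)
    qed
    then show ?thesis using S0[of "x - (\<Sum>e\<in>E. cinner e x *\<^sub>C e)"] by (simp add: S_def)
  qed
  with T finE conjunct1[OF E(1)] \<mu> have "eigenbasis T E \<mu>" by unfold_locales
  then show ?thesis by blast
qed

lemma finite_dim_spectrum_eq_eigenvalues:
  fixes T :: "'a::complex_hilbert_space \<Rightarrow> 'a"
  assumes T: "selfadjoint T" and "cfinite_dim (UNIV :: 'a set)"
  shows "spectrum T = eigenvalues T"
proof (intro equalityI eigenvalue_spectrum subsetI)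
  fix z assume z: "z \<in> spectrum T"
  obtain B :: "'a set" where B: "finite B" "cspan B = UNIV"
    using assms(2) by (auto simp: cfinite_dim_def)
  show "z \<in> eigenvalues T"
  proof (rule ccontr)
    assume "z \<notin> eigenvalues T"
    then have "x = 0" if "T x - z *\<^sub>C x = 0" for x using that by (auto simp: eigenvalues_def)
    moreover have "bounded_clinear (\<lambda>x. T x - z *\<^sub>C x)"
      by (intro bounded_clinear_diff bounded_clinear_scale selfadjointD(1)[OF T])
    ultimately obtain c where "c > 0" "\<And>x. c * norm x \<le> norm (T x - z *\<^sub>C x)"
      using finite_dim_injective_bounded_below[of "\<lambda>x. T x - z *\<^sub>C x" B] B by auto
    then have "z \<in> resolvent_set T" by (rule bounded_below_resolvent_set[OF T])
    then show False using z by (simp add: spectrum_def)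
  qed
qed

text \<open>An eigenvector has a nonzero coefficient along some \<open>e\<close>, and moving the
  operator across the scalar product with this \<open>e\<close> forces its eigenvalue to be
  \<open>\<mu> e\<close>.\<close>

lemma eigenvalues_eigenbasis:
  fixes T :: "'a::complex_hilbert_space \<Rightarrow> 'a"
  assumes T: "selfadjoint T" and E: "orthonormal E" "\<And>e. e \<in> E \<Longrightarrow> T e = complex_of_real (\<mu> e) *\<^sub>C e"
    "\<And>x. (\<Sum>e\<in>E. cinner e x *\<^sub>C e) = x"
  shows "eigenvalues T = (\<lambda>e. complex_of_real (\<mu> e)) ` E"
proof (intro equalityI subsetI)
  fix z assume "z \<in> eigenvalues T"
  then obtain x where x: "x \<noteq> 0" "T x = z *\<^sub>C x" by (auto simp: eigenvalues_def)
  have "\<exists>e\<in>E. cinner e x \<noteq> 0"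
  proof (rule ccontr)
    assume "\<not> ?thesis"
    then have "(\<Sum>e\<in>E. cinner e x *\<^sub>C e) = 0" by (intro sum.neutral) simp
    then show False using x(1) E(3)[of x] by simp
  qed
  then obtain e where e: "e \<in> E" "cinner e x \<noteq> 0" by blast
  have "z * cinner e x = of_real (\<mu> e) * cinner e x"
    using selfadjointD(2)[OF T, of e x] E(2)[OF e(1)] x(2)
    by (auto simp: cinner_scaleC_left cinner_scaleC_right)
  then have "z = of_real (\<mu> e)" using e(2) by auto
  then show "z \<in> (\<lambda>e. complex_of_real (\<mu> e)) ` E" using e(1) by blast
next
  fix z assume "z \<in> (\<lambda>e. complex_of_real (\<mu> e)) ` E"
  then obtain e where e: "e \<in> E" "z = complex_of_real (\<mu> e)" by blast
  have "e \<noteq> 0"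
  proof
    assume "e = 0"
    then show False using E(1) e(1) unfolding orthonormal_def by force
  qed
  then show "z \<in> eigenvalues T" using E(2)[OF e(1)] e(2) by (auto simp: eigenvalues_def)
qed

text \<open>As \<open>cadjoint\<close> is a definite description, an adjoint has to be exhibited;
  expanding \<open>x\<close> in \<open>E\<close> inside \<open>cinner y (K x)\<close> yields the
  formula \<open>S\<close>.\<close>

lemma finite_dim_cadjoint:
  fixes K :: "'a::complex_inner_space \<Rightarrow> 'a" and E :: "'a set"
  assumes K: "bounded_clinear K" and E: "finite E" "\<And>x. (\<Sum>e\<in>E. cinner e x *\<^sub>C e) = x"
  shows "bounded_clinear (cadjoint K)" "cinner (cadjoint K y) x = cinner y (K x)"
proof -
  interpret K: bounded_linear K using K by (rule bounded_clinear_bounded_linear)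
  define S where "S = (\<lambda>y. \<Sum>e\<in>E. cinner (K e) y *\<^sub>C e)"
  have S: "cinner (S y) x = cinner y (K x)" for x y
  proof -
    have "cinner y (K x) = cinner y (\<Sum>e\<in>E. K (cinner e x *\<^sub>C e))"
      by (simp add: E(2) flip: K.sum)
    also have "\<dots> = (\<Sum>e\<in>E. cinner e x * cinner y (K e))"
      by (simp add: bounded_clinear_scaleC[OF K] cinner_sum_right cinner_scaleC_right)
    also have "\<dots> = cinner (S y) x"
      unfolding S_def cinner_sum_left cinner_scaleC_left
      by (intro sum.cong refl) (subst cinner_commute[of y], simp)
    finally show ?thesis by simp
  qed
  have eq: "cadjoint K = S" by (rule cadjoint_eqI) (rule S)
  show "cinner (cadjoint K y) x = cinner y (K x)" by (simp add: eq S)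
  have lin: "bounded_clinear (\<lambda>y. cinner v y *\<^sub>C e)" for v e :: 'a
    by (rule bounded_clinear_rank_one)
  have "bounded_clinear (\<lambda>y. \<Sum>e\<in>F. cinner (K e) y *\<^sub>C e)" if "finite F" for F
    using that
  proof (induction F rule: finite_induct)
    case empty
    then show ?case using bounded_clinear_scale[of 0] by simp
  next
    case (insert e F)
    then show ?case using bounded_clinear_add[OF lin[of "K e" e]] by simp
  qed
  then show "bounded_clinear (cadjoint K)" using E(1) by (simp add: eq S_def)
qed

section \<open>Shifts, the lattice Laplacian and the weight\<close>

lemma ell2_cinner: "cinner f g = (\<Sum>\<^sub>\<infinity>n. cinner (ell2_at f n) (ell2_at g n))"
  by (rule cinner_ell2.rep_eq)

lemma ell2_eqI: "(\<And>n. ell2_at f n = ell2_at g n) \<Longrightarrow> f = g"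
  by (simp add: ext flip: ell2_at_inject)

lemma ell2_norm_leI:
  fixes f :: "'g::complex_inner_space ell2" and g :: "'h::complex_inner_space ell2"
  assumes le: "\<And>n. norm (ell2_at f n) \<le> C * norm (ell2_at g n)" and C: "C \<ge> 0"
  shows "norm f \<le> C * norm g"
proof (rule power2_le_imp_le)
  have "(\<Sum>n\<in>F. (norm (ell2_at f n))\<^sup>2) \<le> (C * norm g)\<^sup>2" if "finite F" for F
  proof -
    have "(norm (ell2_at f n))\<^sup>2 \<le> C\<^sup>2 * (norm (ell2_at g n))\<^sup>2" for n
      using power_mono[OF le[of n] norm_ge_zero, of 2] by (simp add: power_mult_distrib)
    then have "(\<Sum>n\<in>F. (norm (ell2_at f n))\<^sup>2) \<le> C\<^sup>2 * (\<Sum>n\<in>F. (norm (ell2_at g n))\<^sup>2)"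
      unfolding sum_distrib_left by (rule sum_mono)
    also have "\<dots> \<le> C\<^sup>2 * (norm g)\<^sup>2" by (intro mult_left_mono ell2_finite_sum_le that) simp
    finally show ?thesis by (simp add: power_mult_distrib)
  qed
  then show "(norm f)\<^sup>2 \<le> (C * norm g)\<^sup>2"
    unfolding ell2_norm_sq[of f] by (intro infsum_le_finite_sums) (use ell2_at[of f] in auto)
qed (use C in simp)

lift_definition shift :: "int \<Rightarrow> 'g::complex_inner_space ell2 \<Rightarrow> 'g ell2" is "\<lambda>k f n. f (n + k)"
  subgoal for k f
    using summable_on_reindex_bij_betw[of "\<lambda>n. n + k" UNIV UNIV "\<lambda>n. (norm (f n))\<^sup>2"]
    by (simp add: bij_plus_right)
  done

lemma cinner_shift_shift: "cinner (shift k f) (shift k g) = cinner f g"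
  unfolding ell2_cinner shift.rep_eq
  using infsum_reindex_bij_betw[of "\<lambda>n. n + k" UNIV UNIV "\<lambda>n. cinner (ell2_at f n) (ell2_at g n)"]
  by (simp add: bij_plus_right)

lemma shift_shift: "shift k (shift l f) = shift (k + l) f"
  by (rule ell2_eqI) (simp add: shift.rep_eq add.assoc)

lemma shift_0 [simp]: "shift 0 f = f"
  by (rule ell2_eqI) (simp add: shift.rep_eq)

lemma cinner_shift_left: "cinner (shift k f) g = cinner f (shift (- k) g)"
  using cinner_shift_shift[of "- k" "shift k f" g] by (simp add: shift_shift)

lemma norm_shift [simp]: "norm (shift k f) = norm f"
  unfolding norm_eq_sqrt_inner inner_eq_Re_cinner cinner_shift_shift ..

section \<open>The Laplacian and the free Hamiltonian in terms of shifts, and their quadratic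
  forms\<close>

abbreviation lap :: "real \<Rightarrow> 'g::complex_inner_space ell2 \<Rightarrow> 'g ell2" where
  "lap h \<equiv> neg_laplacian h \<otimes>\<^sub>o id"

lemma lap_eq_shift: "lap h f = (1 / h\<^sup>2) *\<^sub>R (2 *\<^sub>R f - shift 1 f - shift (-1) f)"
  by (rule ell2_eqI)
    (simp add: neg_laplacian_tensor_id(2) shift.rep_eq scaleR_ell2.rep_eq scaleC_ell2.rep_eq
      minus_ell2.rep_eq flip: scaleC_of_real)

lemma selfadjoint_lap: "selfadjoint (lap h)"
proof -
  have "cinner (lap h f) g = cinner f (lap h g)" for f g :: "'a ell2"
    unfolding lap_eq_shift
    by (simp add: cinner_scaleC_left cinner_scaleC_right cinner_diff_left cinner_diff_right
        cinner_shift_left flip: scaleC_of_real)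
  then show ?thesis by (simp add: selfadjoint_def neg_laplacian_tensor_id(1))
qed

lemma cinner_id_tensor:
  assumes "bounded_clinear A" "bounded_clinear B" "\<And>x y. cinner (A x) y = cinner x (B y)"
  shows "cinner ((id \<otimes>\<^sub>o A) f) g = cinner f ((id \<otimes>\<^sub>o B) g)"
  unfolding ell2_cinner by (simp add: id_tensor(2) assms)

lemma selfadjoint_id_tensor: "selfadjoint Q \<Longrightarrow> selfadjoint (id \<otimes>\<^sub>o Q)"
  using cinner_id_tensor[of Q Q] by (simp add: selfadjoint_def id_tensor(1))

lemma selfadjoint_free_hamiltonian: "selfadjoint Q \<Longrightarrow> selfadjoint (free_hamiltonian h Q)"
  unfolding free_hamiltonian_def by (intro selfadjoint_add selfadjoint_lap selfadjoint_id_tensor)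

text \<open>Summation by parts: up to the factor \<open>1 / h\<^sup>2\<close> the Laplacian is the
  product of the adjoint of the difference operator with that operator.\<close>

lemma inner_lap: "inner f (lap h f) = (norm (shift 1 f - f))\<^sup>2 / h\<^sup>2"
proof -
  have "inner f (shift (-1) f) = inner f (shift 1 f)"
    using cinner_shift_left[of 1 f f] inner_commute[of f "shift 1 f"]
    by (simp add: inner_eq_Re_cinner)
  then show ?thesis
    using norm_diff_scaleR_sq[of "shift 1 f" 1 f]
    by (simp add: lap_eq_shift inner_diff_right inner_commute[of _ "shift 1 f"] power2_norm_eq_inner[of f]
        diff_divide_distrib)
qed

text \<open>The upper band edge mirrors the lower one: by the parallelogram law the squared norms of
  \<open>shift 1 f + f\<close> and \<open>shift 1 f - f\<close> add up to four times that of
  \<open>f\<close>.\<close>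

lemma inner_lap_top:
  assumes "h > 0"
  shows "inner f ((4 / h\<^sup>2) *\<^sub>R f - lap h f) = (norm (shift 1 f + f))\<^sup>2 / h\<^sup>2"
proof -
  have "inner f (shift (-1) f) = inner f (shift 1 f)"
    using cinner_shift_left[of 1 f f] inner_commute[of f "shift 1 f"]
    by (simp add: inner_eq_Re_cinner)
  then show ?thesis
    using norm_diff_scaleR_sq[of "shift 1 f" "-1" f] assms
    by (simp add: lap_eq_shift inner_diff_right inner_commute[of _ "shift 1 f"] power2_norm_eq_inner[of f]
        diff_divide_distrib add_divide_distrib)
qed

text \<open>Meant for \<open>y = A x\<close> with a nonnegative operator \<open>A\<close>. In the
  expansion the mixed term has coefficient \<open>\<alpha> + \<beta>\<close>, which is at least
  \<open>\<beta> - \<alpha>\<close>, and the remaining terms are nonnegative.\<close>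

lemma inner_shifted_form:
  fixes x :: "'a::real_inner"
  assumes "inner x y \<ge> 0" "0 \<le> \<alpha>" "\<alpha> \<le> \<beta>"
  shows "(\<beta> - \<alpha>) * inner x y \<le> inner (y + \<beta> *\<^sub>R x) (y + \<alpha> *\<^sub>R x)"
proof -
  have "inner (y + \<beta> *\<^sub>R x) (y + \<alpha> *\<^sub>R x)
      = inner y y + (\<alpha> + \<beta>) * inner x y + \<alpha> * \<beta> * inner x x"
    by (simp add: inner_add_left inner_add_right inner_commute[of y x] algebra_simps)
  moreover have "(\<beta> - \<alpha>) * inner x y \<le> (\<alpha> + \<beta>) * inner x y"
    using assms by (intro mult_right_mono) auto
  moreover have "0 \<le> \<alpha> * \<beta> * inner x x" using assms by simp
  ultimately show ?thesis using inner_ge_zero[of y] by linarith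
qed

text \<open>For a band above the interval the sign \<sigma> is 1 and the form of
  \<open>lap h\<close> is used; for a band below it \<sigma> is -1 and the form is that of
  \<open>4 / h\<^sup>2 - lap h\<close>.\<close>

lemma channel_gap_form:
  assumes h: "h > 0" and ab: "a \<le> b" "b \<le> \<mu> \<or> \<mu> + 4 / h\<^sup>2 \<le> a"
  shows "\<exists>\<sigma>::real. \<bar>\<sigma>\<bar> = 1 \<and> (\<forall>g. (b - a) / h\<^sup>2 * (norm (shift 1 g - \<sigma> *\<^sub>R g))\<^sup>2
    \<le> inner (lap h g + (\<mu> - a) *\<^sub>R g) (lap h g + (\<mu> - b) *\<^sub>R g))"
  using ab(2)
proof
  assume b: "b \<le> \<mu>"
  have "(b - a) / h\<^sup>2 * (norm (shift 1 g - 1 *\<^sub>R g))\<^sup>2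
    \<le> inner (lap h g + (\<mu> - a) *\<^sub>R g) (lap h g + (\<mu> - b) *\<^sub>R g)" for g
    using inner_shifted_form[of g "lap h g" "\<mu> - b" "\<mu> - a"] b ab(1) by (simp add: inner_lap)
  then show ?thesis by (intro exI[of _ 1] conjI allI) simp_all
next
  assume a: "\<mu> + 4 / h\<^sup>2 \<le> a"
  have "(b - a) / h\<^sup>2 * (norm (shift 1 g - (-1) *\<^sub>R g))\<^sup>2
    \<le> inner (lap h g + (\<mu> - a) *\<^sub>R g) (lap h g + (\<mu> - b) *\<^sub>R g)" for g
  proof -
    let ?y = "(4 / h\<^sup>2) *\<^sub>R g - lap h g"
    \<comment> \<open>Both factors change sign, so their product does not; the new parameters are
      the distances of \<open>a\<close> and \<open>b\<close> from the upper band edge, and the two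
      end points exchange their roles.\<close>
    have "lap h g + (\<mu> - t) *\<^sub>R g = - (?y + (t - \<mu> - 4 / h\<^sup>2) *\<^sub>R g)" for t
      by (simp add: algebra_simps)
    then have "inner (lap h g + (\<mu> - a) *\<^sub>R g) (lap h g + (\<mu> - b) *\<^sub>R g)
        = inner (?y + (b - \<mu> - 4 / h\<^sup>2) *\<^sub>R g) (?y + (a - \<mu> - 4 / h\<^sup>2) *\<^sub>R g)"
      by (simp only: inner_minus_left inner_minus_right minus_minus inner_commute)
    then show ?thesis
      using inner_shifted_form[of g ?y "a - \<mu> - 4 / h\<^sup>2" "b - \<mu> - 4 / h\<^sup>2"] a ab(1)
      by (simp add: inner_lap_top[OF h])
  qed
  then show ?thesis by (intro exI[of _ "-1"] conjI allI) simp_all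
qed

section \<open>A Hardy type estimate on the lattice\<close>

lemma norm_le_path_sum:
  fixes g :: "nat \<Rightarrow> 'a::real_normed_vector"
  assumes "g 0 = 0" "\<And>k. norm (g (Suc k)) \<le> norm (g k) + d k"
  shows "norm (g m) \<le> (\<Sum>k<m. d k)"
proof (induction m)
  case (Suc m)
  then show ?case using assms(2)[of m] by simp
qed (simp add: assms(1))

text \<open>Walk from 0 to \<open>n\<close>. Since \<sigma> has modulus 1, each step raises the norm
  by at most the norm of \<open>D\<close> at one site. Cauchy-Schwarz over the steps gives the
  factor \<open>\<bar>n\<bar>\<close>, and the sites being distinct, the squares sum to at most
  \<open>(norm D)\<^sup>2\<close>.\<close>

lemma hardy_pointwise:
  fixes g :: "'g::complex_inner_space ell2"
  assumes g0: "ell2_at g 0 = 0" and \<sigma>: "\<bar>\<sigma>\<bar> = 1"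
  shows "(norm (ell2_at g n))\<^sup>2 \<le> \<bar>real_of_int n\<bar> * (norm (shift 1 g - \<sigma> *\<^sub>R g))\<^sup>2"
proof -
  define D where "D = shift 1 g - \<sigma> *\<^sub>R g"
  have D: "ell2_at D k = ell2_at g (k + 1) - \<sigma> *\<^sub>R ell2_at g k" for k
    by (simp add: D_def minus_ell2.rep_eq shift.rep_eq scaleR_ell2.rep_eq)
  have key: "(norm (ell2_at g n))\<^sup>2 \<le> real m * (norm D)\<^sup>2"
    if "inj p" "norm (ell2_at g n) \<le> (\<Sum>k<m. norm (ell2_at D (p k)))" for p :: "nat \<Rightarrow> int" and m
  proof -
    have "(norm (ell2_at g n))\<^sup>2 \<le> (\<Sum>k<m. norm (ell2_at D (p k)))\<^sup>2"
      using that(2) by (rule power_mono) simp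
    also have "\<dots> \<le> (\<Sum>k<m. (norm (ell2_at D (p k)))\<^sup>2) * real m"
      using sum_squared_le_sum_of_squares[of "\<lambda>k. norm (ell2_at D (p k))" "{..<m}"] by simp
    also have "(\<Sum>k<m. (norm (ell2_at D (p k)))\<^sup>2) \<le> (norm D)\<^sup>2"
      using ell2_finite_sum_le[of "p ` {..<m}" D] that(1)
      by (simp add: sum.reindex inj_on_subset)
    finally show ?thesis by (simp add: mult.commute mult_right_mono)
  qed
  show ?thesis
  proof (cases "n \<ge> 0")
    case True
    have "norm (ell2_at g (int m)) \<le> (\<Sum>k<m. norm (ell2_at D (int k)))" for m
    proof (rule norm_le_path_sum)
      fix k
      have "ell2_at g (int (Suc k)) = \<sigma> *\<^sub>R ell2_at g (int k) + ell2_at D (int k)"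
        by (simp add: D add.commute)
      then show "norm (ell2_at g (int (Suc k))) \<le> norm (ell2_at g (int k)) + norm (ell2_at D (int k))"
        using norm_triangle_ineq[of "\<sigma> *\<^sub>R ell2_at g (int k)" "ell2_at D (int k)"] \<sigma> by simp
    qed (simp add: g0)
    from this[of "nat n"] show ?thesis using key[of int "nat n"] True by (simp add: D_def)
  next
    case False
    \<comment> \<open>To the left, the step from \<open>- k\<close> to \<open>- k - 1\<close> is
      recorded by the difference at the left site \<open>- 1 - k\<close>.\<close>
    have "norm (ell2_at g (- int m)) \<le> (\<Sum>k<m. norm (ell2_at D (- 1 - int k)))" for m
    proof (rule norm_le_path_sum)
      fix k
      have "\<sigma> *\<^sub>R ell2_at g (- int (Suc k)) = ell2_at g (- int k) - ell2_at D (- 1 - int k)"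
        by (simp add: D)
      then show "norm (ell2_at g (- int (Suc k))) \<le> norm (ell2_at g (- int k)) + norm (ell2_at D (- 1 - int k))"
        using norm_triangle_ineq4[of "ell2_at g (- int k)" "ell2_at D (- 1 - int k)"] \<sigma>
          norm_scaleR[of \<sigma> "ell2_at g (- int (Suc k))"] by simp
    qed (simp add: g0)
    from this[of "nat (- n)"] show ?thesis
      using key[of "\<lambda>k. - 1 - int k" "nat (- n)"] False by (simp add: D_def inj_def)
  qed
qed

section \<open>The decay weight and the weighted tail estimate\<close>

lemma summable_on_int_inverse_square: "(\<lambda>n::int. 1 / (1 + (real_of_int n)\<^sup>2)) summable_on UNIV"
proof -
  let ?u = "\<lambda>n::int. 1 / (1 + (real_of_int n)\<^sup>2)"
  have "summable (\<lambda>n. 1 / (1 + (real n)\<^sup>2))"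
  proof (rule summable_comparison_test')
    show "summable (\<lambda>n. inverse ((real n)\<^sup>2))" by (rule inverse_power_summable) simp
    show "norm (1 / (1 + (real n)\<^sup>2)) \<le> inverse ((real n)\<^sup>2)" if "n \<ge> 1" for n
      using that unfolding real_norm_def inverse_eq_divide
      by (subst abs_of_nonneg) (auto intro!: divide_left_mono mult_pos_pos add_pos_nonneg)
  qed
  then have nat: "(\<lambda>n. 1 / (1 + (real n)\<^sup>2)) summable_on UNIV"
    by (subst summable_on_UNIV_nonneg_real_iff) auto
  have "?u summable_on range int"
    by (subst summable_on_reindex) (use nat in \<open>auto simp: o_def\<close>)
  moreover have "?u summable_on range (\<lambda>n. - int n)"
    by (subst summable_on_reindex) (use nat in \<open>auto simp: o_def inj_on_def\<close>)
  ultimately have "?u summable_on (range int \<union> range (\<lambda>n. - int n))"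
    by (rule summable_on_union)
  also have "range int \<union> range (\<lambda>n. - int n) = UNIV"
  proof (intro equalityI subsetI)
    fix n :: int
    show "n \<in> range int \<union> range (\<lambda>n. - int n)" by (cases n rule: int_cases2) auto
  qed simp
  finally show ?thesis .
qed

text \<open>Having 0 in \<open>F\<close> makes functions that vanish on \<open>F\<close> satisfy the
  hypothesis of \<open>hardy_pointwise\<close>.\<close>

lemma inverse_square_tail:
  assumes "\<epsilon> > 0"
  obtains F :: "int set" where "finite F" "0 \<in> F"
    "\<And>G. finite G \<Longrightarrow> G \<inter> F = {} \<Longrightarrow> (\<Sum>n\<in>G. 1 / (1 + (real_of_int n)\<^sup>2)) \<le> \<epsilon>"
proof -
  let ?u = "\<lambda>n::int. 1 / (1 + (real_of_int n)\<^sup>2)"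
  obtain F0 where F0: "finite F0" "dist (sum ?u F0) (infsum ?u UNIV) \<le> \<epsilon>"
    using infsum_finite_approximation[OF summable_on_int_inverse_square assms] by auto
  show ?thesis
  proof
    show "finite (insert 0 F0)" "0 \<in> insert 0 F0" using F0 by auto
    fix G :: "int set" assume G: "finite G" "G \<inter> insert 0 F0 = {}"
    have "sum ?u G + sum ?u F0 = sum ?u (G \<union> F0)"
      using G F0 by (subst sum.union_disjoint) auto
    also have "\<dots> \<le> infsum ?u UNIV"
      using G F0 by (intro finite_sum_le_infsum summable_on_int_inverse_square) auto
    finally show "sum ?u G \<le> \<epsilon>" using F0(2) by (simp add: dist_real_def)
  qed
qed

abbreviation decay :: "real \<Rightarrow> 'g::complex_inner_space ell2 \<Rightarrow> 'g ell2" where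
  "decay \<nu> \<equiv> mult_op (weight \<nu>) \<otimes>\<^sub>o id"

lemma decay:
  assumes "\<nu> \<ge> 0"
  shows "bounded_clinear (decay \<nu>)" "ell2_at (decay \<nu> f) n = weight \<nu> n *\<^sub>C ell2_at f n"
  using mult_op_tensor[OF norm_weight_le[OF assms] bounded_clinear_id] by simp_all

lemma norm_decay_le: "\<nu> \<ge> 0 \<Longrightarrow> norm (decay \<nu> f) \<le> norm f"
  using ell2_norm_leI[of "decay \<nu> f" 1 f] norm_weight_le[of \<nu>]
  by (simp add: decay norm_scaleC mult_left_le_one_le)

lemma norm_weight: "norm (weight \<nu> n) = sqrt (1 + (real_of_int n)\<^sup>2) powr (- \<nu> / 2)"
  by (simp add: weight_def)

lemma norm_weight_sq: "(norm (weight \<nu> n))\<^sup>2 = sqrt (1 + (real_of_int n)\<^sup>2) powr (- \<nu>)"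
  unfolding norm_weight by (simp add: power2_eq_square flip: powr_add)

text \<open>The decay exponent enters here: the squared weight has exponent \<open>- \<nu>\<close>,
  the Hardy factor costs one power, and what is left decays at least like an inverse square, which
  is summable.\<close>

lemma norm_weight_sq_le:
  assumes "\<nu> \<ge> 3"
  shows "(norm (weight \<nu> n))\<^sup>2 * \<bar>real_of_int n\<bar> \<le> 1 / (1 + (real_of_int n)\<^sup>2)"
proof -
  define s where "s = sqrt (1 + (real_of_int n)\<^sup>2)"
  have s: "s \<ge> 1" "s\<^sup>2 = 1 + (real_of_int n)\<^sup>2" by (simp_all add: s_def)
  have "\<bar>real_of_int n\<bar> \<le> s" unfolding s_def by (rule real_le_rsqrt) simp
  then have "(norm (weight \<nu> n))\<^sup>2 * \<bar>real_of_int n\<bar> \<le> s powr (- \<nu>) * s"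
    unfolding norm_weight_sq s_def by (intro mult_left_mono) auto
  also have "\<dots> = s powr (- \<nu> + 1)" using s(1) powr_add[of s "- \<nu>" 1] by simp
  also have "\<dots> \<le> s powr (-2)" using s(1) assms by (intro powr_mono) auto
  also have "\<dots> = 1 / s\<^sup>2" using s(1) by (simp add: powr_minus divide_inverse)
  finally show ?thesis by (simp add: s(2))
qed

text \<open>The pointwise Hardy bound is multiplied by the squared weight and summed over the sites
  outside \<open>F\<close>. The set \<open>F\<close> is fixed before \<open>g\<close> and \<sigma>,
  so one \<open>F\<close> serves all channels and both signs.\<close>

lemma decay_tail:
  assumes \<nu>: "\<nu> \<ge> 3" and "\<epsilon> > 0"
  obtains F :: "int set" where "finite F"
    "\<And>(g::'g::complex_inner_space ell2) \<sigma>::real. (\<And>n. n \<in> F \<Longrightarrow> ell2_at g n = 0) \<Longrightarrow> \<bar>\<sigma>\<bar> = 1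
      \<Longrightarrow> (norm (decay \<nu> g))\<^sup>2 \<le> \<epsilon> * (norm (shift 1 g - \<sigma> *\<^sub>R g))\<^sup>2"
proof -
  let ?u = "\<lambda>n::int. 1 / (1 + (real_of_int n)\<^sup>2)"
  obtain F :: "int set" where F: "finite F" "0 \<in> F"
    "\<And>G. finite G \<Longrightarrow> G \<inter> F = {} \<Longrightarrow> (\<Sum>n\<in>G. ?u n) \<le> \<epsilon>"
    using inverse_square_tail[OF assms(2)] by metis
  have "(norm (decay \<nu> g))\<^sup>2 \<le> \<epsilon> * (norm (shift 1 g - \<sigma> *\<^sub>R g))\<^sup>2"
    if g: "\<And>n. n \<in> F \<Longrightarrow> ell2_at g n = 0" and \<sigma>: "\<bar>\<sigma>\<bar> = 1" for g :: "'g ell2" and \<sigma> :: real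
  proof -
    define D where "D = (norm (shift 1 g - \<sigma> *\<^sub>R g))\<^sup>2"
    have D: "D \<ge> 0" by (simp add: D_def)
    have at: "(norm (ell2_at (decay \<nu> g) n))\<^sup>2 \<le> ?u n * D" for n
    proof -
      have "(norm (ell2_at (decay \<nu> g) n))\<^sup>2 = (norm (weight \<nu> n))\<^sup>2 * (norm (ell2_at g n))\<^sup>2"
        using \<nu> by (simp add: decay norm_scaleC power_mult_distrib)
      also have "\<dots> \<le> (norm (weight \<nu> n))\<^sup>2 * (\<bar>real_of_int n\<bar> * D)"
        unfolding D_def by (intro mult_left_mono hardy_pointwise g F(2) \<sigma>) simp
      also have "\<dots> \<le> ?u n * D"
        unfolding mult.assoc[symmetric] by (intro mult_right_mono norm_weight_sq_le \<nu> D)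
      finally show ?thesis .
    qed
    have "(\<Sum>n\<in>G. (norm (ell2_at (decay \<nu> g) n))\<^sup>2) \<le> \<epsilon> * D" if "finite G" for G
    proof -
      have "(\<Sum>n\<in>G. (norm (ell2_at (decay \<nu> g) n))\<^sup>2) = (\<Sum>n\<in>G - F. (norm (ell2_at (decay \<nu> g) n))\<^sup>2)"
        using that g \<nu> by (intro sum.mono_neutral_right) (auto simp: decay)
      also have "\<dots> \<le> (\<Sum>n\<in>G - F. ?u n * D)" by (intro sum_mono at)
      also have "\<dots> \<le> \<epsilon> * D"
        unfolding sum_distrib_right[symmetric] using that by (intro mult_right_mono F(3) D) auto
      finally show ?thesis .
    qed
    then show ?thesis
      unfolding ell2_norm_sq[of "decay \<nu> g"] D_def
      by (intro infsum_le_finite_sums) (use ell2_at[of "decay \<nu> g"] in auto)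
  qed
  then show ?thesis using that F(1) by blast
qed

text \<open>The weights at neighbouring sites are comparable, because the square root in the weight
  at most doubles from one site to the next.\<close>

lemma norm_decay_shift:
  assumes \<nu>: "\<nu> \<ge> 0" and k: "\<bar>k\<bar> \<le> 1"
  shows "norm (decay \<nu> (shift k f)) \<le> 2 powr (\<nu> / 2) * norm (decay \<nu> f)"
proof -
  have w: "norm (weight \<nu> n) \<le> 2 powr (\<nu> / 2) * norm (weight \<nu> (n + k))" for n
  proof -
    let ?s = "\<lambda>n. sqrt (1 + (real_of_int n)\<^sup>2)"
    let ?x = "real_of_int n" and ?y = "real_of_int k"
    have "\<bar>?y\<bar> \<le> 1" using k by linarith
    then have "?y\<^sup>2 \<le> 1" by (simp add: abs_square_le_1)
    \<comment> \<open>Written as a sum of terms that are nonnegative once the square of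
      \<open>?y\<close> is at most 1.\<close>
    moreover have "4 * (1 + ?x\<^sup>2) - (1 + (?x + ?y)\<^sup>2) = (?x - ?y)\<^sup>2 + 2 * ?x\<^sup>2 + (3 - 2 * ?y\<^sup>2)"
      by (simp add: power2_eq_square algebra_simps)
    ultimately have "1 + (?x + ?y)\<^sup>2 \<le> 4 * (1 + ?x\<^sup>2)"
      using zero_le_power2[of "?x - ?y"] zero_le_power2[of ?x] by linarith
    then have "(?s (n + k))\<^sup>2 \<le> (2 * ?s n)\<^sup>2" by (simp add: power_mult_distrib)
    then have le: "?s (n + k) \<le> 2 * ?s n" by (rule power2_le_imp_le) simp
    have pos: "?s m > 0" for m by (simp add: add_pos_nonneg)
    have "2 powr (- \<nu> / 2) * ?s n powr (- \<nu> / 2) \<le> ?s (n + k) powr (- \<nu> / 2)"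
      unfolding powr_mult[symmetric] using le \<nu> pos[of "n + k"] by (intro powr_mono2') auto
    then have "2 powr (\<nu> / 2) * (2 powr (- \<nu> / 2) * ?s n powr (- \<nu> / 2))
        \<le> 2 powr (\<nu> / 2) * ?s (n + k) powr (- \<nu> / 2)" by (rule mult_left_mono) simp
    then show ?thesis unfolding norm_weight mult.assoc[symmetric] powr_add[symmetric] by simp
  qed
  have "norm (decay \<nu> (shift k f)) \<le> 2 powr (\<nu> / 2) * norm (shift k (decay \<nu> f))"
  proof (rule ell2_norm_leI)
    fix n
    show "norm (ell2_at (decay \<nu> (shift k f)) n) \<le> 2 powr (\<nu> / 2) * norm (ell2_at (shift k (decay \<nu> f)) n)"
      using mult_right_mono[OF w[of n], of "norm (ell2_at f (n + k))"]
      by (simp add: decay \<nu> shift.rep_eq norm_scaleC mult.assoc)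
  qed simp
  then show ?thesis by simp
qed

text \<open>Boundedness in the weighted norm: \<open>Q\<close> commutes with the weight and a shift
  distorts it by the factor \<open>c\<close>. This is needed for the cross terms between
  \<open>free_hamiltonian\<close> and the perturbation, which are controlled by weighted norms of
  both arguments.\<close>

lemma norm_decay_free_hamiltonian:
  fixes Q :: "'g::complex_inner_space \<Rightarrow> 'g"
  assumes \<nu>: "\<nu> \<ge> 0" and Q: "bounded_clinear Q"
  obtains C where "C \<ge> 0" "\<And>f. norm (decay \<nu> (free_hamiltonian h Q f)) \<le> C * norm (decay \<nu> f)"
proof -
  interpret \<Psi>: bounded_linear "decay \<nu> :: 'g ell2 \<Rightarrow> 'g ell2"
    using decay(1)[OF \<nu>] by (rule bounded_clinear_bounded_linear)
  interpret IQ: bounded_linear "id \<otimes>\<^sub>o Q"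
    using id_tensor(1)[OF Q] by (rule bounded_clinear_bounded_linear)
  obtain K where K: "K \<ge> 0" "\<And>f. norm ((id \<otimes>\<^sub>o Q) f) \<le> norm f * K" using IQ.nonneg_bounded by blast
  have comm: "decay \<nu> ((id \<otimes>\<^sub>o Q) f) = (id \<otimes>\<^sub>o Q) (decay \<nu> f)" for f
    by (rule ell2_eqI) (simp add: decay[OF \<nu>] id_tensor(2)[OF Q] bounded_clinear_scaleC[OF Q])
  define c :: real where "c = 2 powr (\<nu> / 2)"
  show ?thesis
  proof
    show "(1 / h\<^sup>2) * (2 + c + c) + K \<ge> 0" using K by (simp add: c_def)
    fix f :: "'g ell2"
    define N where "N = norm (decay \<nu> f)"
    have sh: "norm (decay \<nu> (shift 1 f)) \<le> c * N" "norm (decay \<nu> (shift (-1) f)) \<le> c * N"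
      unfolding c_def N_def by (intro norm_decay_shift \<nu>; simp)+
    have "decay \<nu> (free_hamiltonian h Q f) = (1 / h\<^sup>2) *\<^sub>R
        (2 *\<^sub>R decay \<nu> f - decay \<nu> (shift 1 f) - decay \<nu> (shift (-1) f)) + (id \<otimes>\<^sub>o Q) (decay \<nu> f)"
      unfolding free_hamiltonian_def lap_eq_shift \<Psi>.add \<Psi>.scaleR \<Psi>.diff comm ..
    also have "norm \<dots> \<le> (1 / h\<^sup>2) *
        norm (2 *\<^sub>R decay \<nu> f - decay \<nu> (shift 1 f) - decay \<nu> (shift (-1) f)) + N * K"
      using K(2)[of "decay \<nu> f", folded N_def]
      by (intro order_trans[OF norm_triangle_ineq] add_mono) simp_all
    also have "norm (2 *\<^sub>R decay \<nu> f - decay \<nu> (shift 1 f) - decay \<nu> (shift (-1) f))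
        \<le> 2 * N + c * N + c * N"
      using sh N_def norm_triangle_ineq4[of "2 *\<^sub>R decay \<nu> f - decay \<nu> (shift 1 f)" "decay \<nu> (shift (-1) f)"]
        norm_triangle_ineq4[of "2 *\<^sub>R decay \<nu> f" "decay \<nu> (shift 1 f)"] by simp
    finally show "norm (decay \<nu> (free_hamiltonian h Q f)) \<le> ((1 / h\<^sup>2) * (2 + c + c) + K) * norm (decay \<nu> f)"
      unfolding N_def[symmetric] by (simp add: algebra_simps mult_left_mono divide_right_mono)
  qed
qed

section \<open>Positivity of the gap form\<close>

text \<open>For a unit vector \<open>e\<close> this is the orthogonal projection of all values onto
  the line spanned by \<open>e\<close>.\<close>

abbreviation channel :: "'g::complex_inner_space \<Rightarrow> 'g ell2 \<Rightarrow> 'g ell2" where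
  "channel e \<equiv> id \<otimes>\<^sub>o (\<lambda>x. cinner e x *\<^sub>C e)"

lemma channel:
  "bounded_clinear (channel e)" "ell2_at (channel e f) n = cinner e (ell2_at f n) *\<^sub>C e"
  using id_tensor[OF bounded_clinear_rank_one, of e e] by simp_all

lemma lap_channel: "lap h (channel e f) = channel e (lap h f)"
proof -
  interpret bounded_linear "channel e" by (rule bounded_clinear_bounded_linear[OF channel(1)])
  have "shift k (channel e f) = channel e (shift k f)" for k
    by (rule ell2_eqI) (simp add: shift.rep_eq channel(2))
  then show ?thesis unfolding lap_eq_shift diff scaleR by simp
qed

context eigenbasis
begin

lemma sum_channel: "(\<Sum>e\<in>E. channel e f) = f"
  by (rule ell2_eqI) (simp add: ell2_sum_at channel(2) expand)

lemma id_tensor_channel: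
  assumes "e \<in> E"
  shows "(id \<otimes>\<^sub>o Q) (channel e f) = channel e (\<mu> e *\<^sub>R f)"
  by (rule ell2_eqI)
    (simp add: id_tensor(2)[OF selfadjointD(1)[OF selfadjoint]] channel(2) eigen[OF assms]
      bounded_clinear_scaleC[OF selfadjointD(1)[OF selfadjoint]] scaleC_ell2.rep_eq cinner_scaleC_right
      scaleC_scaleC mult.commute flip: scaleC_of_real)

lemma inner_channel:
  assumes "e \<in> E" "e' \<in> E" "e \<noteq> e'"
  shows "inner (channel e f) (channel e' g) = 0"
  using orthonormal assms
  by (simp add: inner_eq_Re_cinner ell2_cinner channel(2) cinner_scaleC_left cinner_scaleC_right
      orthonormal_def)

lemma inner_sum_channel:
  "inner (\<Sum>e\<in>E. channel e (u e)) (\<Sum>e\<in>E. channel e (v e)) = (\<Sum>e\<in>E. inner (channel e (u e)) (channel e (v e)))"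
proof -
  have "inner (channel e (u e)) (\<Sum>e'\<in>E. channel e' (v e')) = inner (channel e (u e)) (channel e (v e))"
    if "e \<in> E" for e
  proof -
    have "inner (channel e (u e)) (\<Sum>e'\<in>E. channel e' (v e'))
        = (\<Sum>e'\<in>E. if e' = e then inner (channel e (u e)) (channel e (v e)) else 0)"
      unfolding inner_sum_right by (intro sum.cong refl) (use inner_channel[OF that] in auto)
    then show ?thesis using finite that by simp
  qed
  then show ?thesis unfolding inner_sum_left by (intro sum.cong refl)
qed

text \<open>Diagonalization: in the channel of \<open>e\<close> the operator \<open>Q\<close> acts
  as the number \<open>\<mu> e\<close>, and the Laplacian commutes with the channel
  projections.\<close>

lemma free_hamiltonian_channels:
  "free_hamiltonian h Q f - t *\<^sub>R f = (\<Sum>e\<in>E. channel e (lap h f + (\<mu> e - t) *\<^sub>R f))"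
proof -
  interpret L: bounded_linear "lap h :: 'g ell2 \<Rightarrow> _"
    by (rule bounded_clinear_bounded_linear[OF neg_laplacian_tensor_id(1)])
  interpret IQ: bounded_linear "id \<otimes>\<^sub>o Q"
    by (rule bounded_clinear_bounded_linear[OF id_tensor(1)[OF selfadjointD(1)[OF selfadjoint]]])
  have lin: "bounded_linear (channel e)" for e :: 'g
    by (rule bounded_clinear_bounded_linear[OF channel(1)])
  have "free_hamiltonian h Q (\<Sum>e\<in>E. channel e f) - t *\<^sub>R (\<Sum>e\<in>E. channel e f)
      = (\<Sum>e\<in>E. lap h (channel e f) + (id \<otimes>\<^sub>o Q) (channel e f) - t *\<^sub>R channel e f)"
    unfolding free_hamiltonian_def L.sum IQ.sum scaleR_sum_right sum.distrib sum_subtractf ..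
  also have "\<dots> = (\<Sum>e\<in>E. channel e (lap h f + (\<mu> e - t) *\<^sub>R f))"
  proof (rule sum.cong[OF refl])
    fix e assume e: "e \<in> E"
    interpret C: bounded_linear "channel e" by (rule lin)
    show "lap h (channel e f) + (id \<otimes>\<^sub>o Q) (channel e f) - t *\<^sub>R channel e f
        = channel e (lap h f + (\<mu> e - t) *\<^sub>R f)"
      unfolding lap_channel id_tensor_channel[OF e] C.add C.scaleR by (simp add: algebra_simps)
  qed
  finally show ?thesis by (simp only: sum_channel)
qed

text \<open>Orthogonality of the channels splits the form into single-channel forms, each estimated
  by \<open>channel_gap_form\<close>; the sign \<open>\<sigma> e\<close> records on which side of
  the interval the band of \<open>e\<close> lies.\<close>

lemma free_hamiltonian_gap_form:
  assumes h: "h > 0" and ab: "a \<le> b" and gap: "\<And>e. e \<in> E \<Longrightarrow> b \<le> \<mu> e \<or> \<mu> e + 4 / h\<^sup>2 \<le> a"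
  shows "\<exists>\<sigma>::'g \<Rightarrow> real. (\<forall>e\<in>E. \<bar>\<sigma> e\<bar> = 1) \<and>
    (\<forall>f. (b - a) / h\<^sup>2 * (\<Sum>e\<in>E. (norm (shift 1 (channel e f) - \<sigma> e *\<^sub>R channel e f))\<^sup>2)
      \<le> inner (free_hamiltonian h Q f - a *\<^sub>R f) (free_hamiltonian h Q f - b *\<^sub>R f))"
proof -
  have "\<forall>e\<in>E. \<exists>\<sigma>::real. \<bar>\<sigma>\<bar> = 1 \<and> (\<forall>g::'g ell2. (b - a) / h\<^sup>2 * (norm (shift 1 g - \<sigma> *\<^sub>R g))\<^sup>2
      \<le> inner (lap h g + (\<mu> e - a) *\<^sub>R g) (lap h g + (\<mu> e - b) *\<^sub>R g))"
    using channel_gap_form[OF h ab] gap by blast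
  then obtain \<sigma> :: "'g \<Rightarrow> real" where \<sigma>: "\<And>e. e \<in> E \<Longrightarrow> \<bar>\<sigma> e\<bar> = 1"
    "\<And>e (g::'g ell2). e \<in> E \<Longrightarrow> (b - a) / h\<^sup>2 * (norm (shift 1 g - \<sigma> e *\<^sub>R g))\<^sup>2
      \<le> inner (lap h g + (\<mu> e - a) *\<^sub>R g) (lap h g + (\<mu> e - b) *\<^sub>R g)" by metis
  have lin: "channel e (lap h f + t *\<^sub>R f) = lap h (channel e f) + t *\<^sub>R channel e f" for e :: 'g and f t
    using bounded_clinear_bounded_linear[OF channel(1), of e]
    by (simp add: lap_channel linear_add linear_scale bounded_linear.linear)
  show ?thesis
  proof (intro exI[of _ \<sigma>] conjI ballI allI \<sigma>(1))
    fix f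
    have "(b - a) / h\<^sup>2 * (\<Sum>e\<in>E. (norm (shift 1 (channel e f) - \<sigma> e *\<^sub>R channel e f))\<^sup>2)
      \<le> (\<Sum>e\<in>E. inner (channel e (lap h f + (\<mu> e - a) *\<^sub>R f)) (channel e (lap h f + (\<mu> e - b) *\<^sub>R f)))"
      unfolding sum_distrib_left lin by (intro sum_mono \<sigma>(2))
    then show "(b - a) / h\<^sup>2 * (\<Sum>e\<in>E. (norm (shift 1 (channel e f) - \<sigma> e *\<^sub>R channel e f))\<^sup>2)
      \<le> inner (free_hamiltonian h Q f - a *\<^sub>R f) (free_hamiltonian h Q f - b *\<^sub>R f)"
      by (simp only: free_hamiltonian_channels inner_sum_channel)
  qed
qed

text \<open>The core estimate. When the form is expanded, the term quadratic in \<open>U f\<close>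
  is nonnegative and the two cross terms are at most \<open>M\<close> times the squared weighted
  norm of \<open>f\<close>. If \<open>f\<close> vanishes on a large enough \<open>F\<close>, the
  free form dominates this amount.\<close>

lemma gap_form_nonneg:
  assumes h: "h > 0" and ab: "a < b" and gap: "\<And>e. e \<in> E \<Longrightarrow> b \<le> \<mu> e \<or> \<mu> e + 4 / h\<^sup>2 \<le> a"
    and \<nu>: "\<nu> \<ge> 3" and C: "C \<ge> 0" and U: "\<And>f g. \<bar>inner g (U f)\<bar> \<le> C * norm (decay \<nu> g) * norm (decay \<nu> f)"
  obtains F :: "int set" where "finite F"
    "\<And>f. (\<And>n. n \<in> F \<Longrightarrow> ell2_at f n = 0) \<Longrightarrow>
      0 \<le> inner (free_hamiltonian h Q f + U f - a *\<^sub>R f) (free_hamiltonian h Q f + U f - b *\<^sub>R f)"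
proof -
  have \<nu>0: "\<nu> \<ge> 0" using \<nu> by simp
  interpret \<Psi>: bounded_linear "decay \<nu> :: 'g ell2 \<Rightarrow> 'g ell2"
    using decay(1)[OF \<nu>0] by (rule bounded_clinear_bounded_linear)
  obtain C0 where C0: "C0 \<ge> 0" "\<And>f. norm (decay \<nu> (free_hamiltonian h Q f)) \<le> C0 * norm (decay \<nu> f)"
    by (rule norm_decay_free_hamiltonian[OF \<nu>0 selfadjointD(1)[OF selfadjoint]]) blast
  obtain \<sigma> :: "'g \<Rightarrow> real" where \<sigma>: "\<And>e. e \<in> E \<Longrightarrow> \<bar>\<sigma> e\<bar> = 1"
    "\<And>f. (b - a) / h\<^sup>2 * (\<Sum>e\<in>E. (norm (shift 1 (channel e f) - \<sigma> e *\<^sub>R channel e f))\<^sup>2)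
      \<le> inner (free_hamiltonian h Q f - a *\<^sub>R f) (free_hamiltonian h Q f - b *\<^sub>R f)"
    using free_hamiltonian_gap_form[OF h less_imp_le[OF ab] gap] by blast
  \<comment> \<open>One summand for each cross term: \<open>C0 + \<bar>t\<bar>\<close> bounds the
    weighted norm of \<open>free_hamiltonian h Q f - t *\<^sub>R f\<close> relative to that of
    \<open>f\<close>.\<close>
  define M where "M = C * (C0 + \<bar>a\<bar>) + C * (C0 + \<bar>b\<bar>)"
  \<comment> \<open>The factor \<open>card E\<close> comes from Cauchy-Schwarz over the channels;
    adding 1 keeps the denominator positive when \<open>M\<close> is 0.\<close>
  define \<epsilon> where "\<epsilon> = (b - a) / h\<^sup>2 / (M * real (card E) + 1)"
  have M: "M \<ge> 0" using C C0(1) by (simp add: M_def)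
  then have M1: "M * real (card E) + 1 > 0" by (simp add: add_nonneg_pos)
  have \<epsilon>: "\<epsilon> > 0" using ab h M1 by (simp add: \<epsilon>_def)
  have M\<epsilon>: "M * real (card E) * \<epsilon> \<le> (b - a) / h\<^sup>2"
  proof -
    have "M * real (card E) * \<epsilon> \<le> (M * real (card E) + 1) * \<epsilon>" using \<epsilon> by (intro mult_right_mono) auto
    also have "\<dots> = (b - a) / h\<^sup>2" using M1 by (simp add: \<epsilon>_def)
    finally show ?thesis .
  qed
  obtain F :: "int set" where F: "finite F"
    "\<And>(g::'g ell2) \<sigma>::real. (\<And>n. n \<in> F \<Longrightarrow> ell2_at g n = 0) \<Longrightarrow> \<bar>\<sigma>\<bar> = 1
      \<Longrightarrow> (norm (decay \<nu> g))\<^sup>2 \<le> \<epsilon> * (norm (shift 1 g - \<sigma> *\<^sub>R g))\<^sup>2"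
    by (rule decay_tail[OF \<nu> \<epsilon>]) blast
  show ?thesis
  proof (rule that[OF F(1)])
    fix f :: "'g ell2" assume f: "\<And>n. n \<in> F \<Longrightarrow> ell2_at f n = 0"
    define S where "S = (\<Sum>e\<in>E. (norm (shift 1 (channel e f) - \<sigma> e *\<^sub>R channel e f))\<^sup>2)"
    define x where "x t = free_hamiltonian h Q f - t *\<^sub>R f" for t
    define N where "N = norm (decay \<nu> f)"
    have "N = norm (\<Sum>e\<in>E. decay \<nu> (channel e f))"
      by (simp only: N_def sum_channel flip: \<Psi>.sum)
    also have "\<dots> \<le> (\<Sum>e\<in>E. norm (decay \<nu> (channel e f)))" by (rule norm_sum)
    finally have "N\<^sup>2 \<le> (\<Sum>e\<in>E. norm (decay \<nu> (channel e f)))\<^sup>2" by (rule power_mono) (simp add: N_def)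
    also have "\<dots> \<le> (\<Sum>e\<in>E. (norm (decay \<nu> (channel e f)))\<^sup>2) * real (card E)"
      by (rule sum_squared_le_sum_of_squares)
    also have "(\<Sum>e\<in>E. (norm (decay \<nu> (channel e f)))\<^sup>2) \<le> \<epsilon> * S"
      unfolding S_def sum_distrib_left
      by (intro sum_mono F(2) \<sigma>(1)) (simp_all add: channel(2) f)
    finally have N2: "N\<^sup>2 \<le> real (card E) * \<epsilon> * S" by (simp add: mult.commute mult_right_mono ac_simps)
    have cross: "\<bar>inner (x t) (U f)\<bar> \<le> C * (C0 + \<bar>t\<bar>) * N\<^sup>2" for t
    proof -
      have "norm (decay \<nu> (x t)) \<le> (C0 + \<bar>t\<bar>) * N"
        using norm_triangle_ineq4[of "decay \<nu> (free_hamiltonian h Q f)" "t *\<^sub>R decay \<nu> f"] C0(2)[of f]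
        unfolding x_def \<Psi>.diff \<Psi>.scaleR N_def by (simp add: algebra_simps)
      then have "C * norm (decay \<nu> (x t)) * N \<le> C * ((C0 + \<bar>t\<bar>) * N) * N"
        using C by (intro mult_right_mono mult_left_mono) (auto simp: N_def)
      then show ?thesis using U[of "x t" f] by (simp add: N_def power2_eq_square mult.assoc)
    qed
    have "M * N\<^sup>2 \<le> M * (real (card E) * \<epsilon> * S)" using N2 M by (rule mult_left_mono)
    also have "\<dots> \<le> (b - a) / h\<^sup>2 * S"
      using mult_right_mono[OF M\<epsilon>, of S] by (simp add: S_def sum_nonneg mult.assoc)
    also have "\<dots> \<le> inner (x a) (x b)" unfolding x_def S_def by (rule \<sigma>(2))
    finally have "M * N\<^sup>2 \<le> inner (x a) (x b)" .
    moreover have "inner (x a + U f) (x b + U f)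
        = inner (x a) (x b) + inner (x a) (U f) + inner (x b) (U f) + inner (U f) (U f)"
      by (simp add: inner_add_left inner_add_right inner_commute[of "U f" "x b"])
    moreover have "M * N\<^sup>2 = C * (C0 + \<bar>a\<bar>) * N\<^sup>2 + C * (C0 + \<bar>b\<bar>) * N\<^sup>2"
      by (simp add: M_def algebra_simps)
    ultimately have "0 \<le> inner (x a + U f) (x b + U f)"
      using cross[of a] cross[of b] inner_ge_zero[of "U f"] by linarith
    then show "0 \<le> inner (free_hamiltonian h Q f + U f - a *\<^sub>R f) (free_hamiltonian h Q f + U f - b *\<^sub>R f)"
      by (simp only: x_def add_diff_eq diff_add_eq)
  qed
qed

end

section \<open>Spectrum of the perturbed operator\<close>

text \<open>Induction on the functionals: on the kernel \<open>L0\<close> of one of them the others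
  still separate points, and a single vector \<open>u\<close> outside \<open>L0\<close> spans
  \<open>L\<close> together with \<open>L0\<close>.\<close>

lemma cfinite_dim_separating_functionals:
  fixes \<phi> :: "'i \<Rightarrow> 'a::complex_inner_space \<Rightarrow> complex"
  assumes "finite I" and "complex_vec.subspace L"
    and "\<And>i x y. i \<in> I \<Longrightarrow> \<phi> i (x + y) = \<phi> i x + \<phi> i y"
    and "\<And>i a x. i \<in> I \<Longrightarrow> \<phi> i (a *\<^sub>C x) = a * \<phi> i x"
    and "\<And>x. x \<in> L \<Longrightarrow> (\<And>i. i \<in> I \<Longrightarrow> \<phi> i x = 0) \<Longrightarrow> x = 0"
  shows "cfinite_dim L"
  using assms
proof (induction I arbitrary: L rule: finite_induct)
  case empty
  then have "L \<subseteq> cspan {}" by auto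
  then show ?case unfolding cfinite_dim_def by blast
next
  case (insert i I)
  have add: "\<phi> i (x + y) = \<phi> i x + \<phi> i y" and scale: "\<phi> i (a *\<^sub>C x) = a * \<phi> i x" for x y a
    using insert.prems(2,3)[of i] by auto
  have diff: "\<phi> i (x - y) = \<phi> i x - \<phi> i y" for x y using add[of "x - y" y] by simp
  define L0 where "L0 = {x \<in> L. \<phi> i x = 0}"
  have L0: "complex_vec.subspace L0"
    using insert.prems(1) scale[of 0 0]
    by (auto simp: L0_def complex_vec.subspace_def add scale)
  have "cfinite_dim L0"
  proof (rule insert.IH[OF L0])
    show "x = 0" if "x \<in> L0" "\<And>j. j \<in> I \<Longrightarrow> \<phi> j x = 0" for x
      using insert.prems(4)[of x] that by (auto simp: L0_def)
  qed (use insert.prems(2,3) in auto)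
  then obtain B where B: "finite B" "L0 \<subseteq> cspan B" by (auto simp: cfinite_dim_def)
  show ?case
  proof (cases "L = L0")
    case True
    then show ?thesis using B by (auto simp: cfinite_dim_def)
  next
    case False
    then obtain u where u: "u \<in> L" "\<phi> i u \<noteq> 0" by (auto simp: L0_def)
    have "x \<in> cspan (insert u B)" if x: "x \<in> L" for x
    proof -
      have "x - (\<phi> i x / \<phi> i u) *\<^sub>C u \<in> L0"
        using u x insert.prems(1)
        by (auto simp: L0_def diff scale intro!: complex_vec.subspace_diff complex_vec.subspace_scale)
      then show ?thesis using B(2) unfolding complex_vec.span_insert by blast
    qed
    then show ?thesis unfolding cfinite_dim_def using B(1) by (meson finite_insert subsetI)
  qed
qed

text \<open>Covers \<open>V\<close>, \<open>- V\<close> and, for the free operator, the zero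
  perturbation at once: all are self-adjoint with a form controlled by the weighted norm in both
  arguments.\<close>

locale perturbed_hamiltonian = eigenbasis Q E \<mu>
  for Q :: "'g::complex_hilbert_space \<Rightarrow> 'g" and E \<mu> +
  fixes h \<nu> C :: real and U :: "'g ell2 \<Rightarrow> 'g ell2"
  assumes h: "h > 0" and \<nu>: "\<nu> \<ge> 3" and C: "C \<ge> 0" and U: "selfadjoint U"
    and U_bound: "\<And>f g. \<bar>inner g (U f)\<bar> \<le> C * norm (decay \<nu> g) * norm (decay \<nu> f)"
begin

definition H :: "'g ell2 \<Rightarrow> 'g ell2" where
  "H f = free_hamiltonian h Q f + U f"

definition bands :: "real set" where
  "bands = (\<Union>e\<in>E. {\<mu> e .. \<mu> e + 4 / h\<^sup>2})"

text \<open>For \<open>a < b\<close> this says that the open interval between them misses every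
  band. The end points may themselves be band edges, which is what makes the estimates reach the
  thresholds.\<close>

definition gap :: "real \<Rightarrow> real \<Rightarrow> bool" where
  "gap a b \<longleftrightarrow> (\<forall>e\<in>E. b \<le> \<mu> e \<or> \<mu> e + 4 / h\<^sup>2 \<le> a)"

section \<open>Eigenvalues and resolvent set inside a gap\<close>

lemma selfadjoint_H: "selfadjoint H"
  unfolding H_def[abs_def] by (intro selfadjoint_add selfadjoint_free_hamiltonian selfadjoint U)

lemma bounded_linear_H: "bounded_linear H"
  by (rule bounded_clinear_bounded_linear[OF selfadjointD(1)[OF selfadjoint_H]])

lemma gap_form_nonneg_H:
  assumes "a < b" "gap a b"
  obtains F :: "int set" where "finite F"
    "\<And>f. (\<And>n. n \<in> F \<Longrightarrow> ell2_at f n = 0) \<Longrightarrow> 0 \<le> inner (H f - a *\<^sub>R f) (H f - b *\<^sub>R f)"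
  using gap_form_nonneg[OF h assms(1) _ \<nu> C U_bound] assms(2) unfolding H_def gap_def by blast

text \<open>The form is negative definite on the span \<open>L\<close> of the eigenvectors belonging
  to the gap, but nonnegative on functions vanishing on \<open>F\<close>. So the values on
  \<open>F\<close> separate the points of \<open>L\<close>. The same \<open>B\<close> works for all
  \<open>l\<close>, arbitrarily close to the end points.\<close>

lemma gap_finite_dim:
  assumes ab: "a < b" "gap a b"
  obtains B where "finite B" "\<And>l. a < l \<Longrightarrow> l < b \<Longrightarrow> eigenspace H (of_real l) \<subseteq> cspan B"
proof -
  interpret H: bounded_linear H by (rule bounded_linear_H)
  obtain F :: "int set" where F: "finite F"
    "\<And>f. (\<And>n. n \<in> F \<Longrightarrow> ell2_at f n = 0) \<Longrightarrow> 0 \<le> inner (H f - a *\<^sub>R f) (H f - b *\<^sub>R f)"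
    using gap_form_nonneg_H[OF ab] by blast
  \<comment> \<open>Sums with one eigenvector, possibly 0, per eigenvalue; vanishing outside
    \<Lambda> lets two such families be added over the union of their index sets.\<close>
  define L where "L = {(\<Sum>l\<in>\<Lambda>. u l) | \<Lambda> u. finite \<Lambda> \<and> \<Lambda> \<subseteq> {a<..<b} \<and>
    (\<forall>l. H (u l) = l *\<^sub>R u l) \<and> (\<forall>l. l \<notin> \<Lambda> \<longrightarrow> u l = 0)}"
  have L: "complex_vec.subspace L"
  proof (rule complex_vec.subspaceI)
    show "0 \<in> L" unfolding L_def
      by (rule CollectI, intro exI[of _ "{}"] exI[of _ "\<lambda>_. 0"]) (simp add: H.zero)
  next
    fix x y assume "x \<in> L" "y \<in> L"
    then obtain \<Lambda> u \<Lambda>' u' where x: "x = (\<Sum>l\<in>\<Lambda>. u l)" "finite \<Lambda>" "\<Lambda> \<subseteq> {a<..<b}"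
        "\<forall>l. H (u l) = l *\<^sub>R u l" "\<forall>l. l \<notin> \<Lambda> \<longrightarrow> u l = 0"
      and y: "y = (\<Sum>l\<in>\<Lambda>'. u' l)" "finite \<Lambda>'" "\<Lambda>' \<subseteq> {a<..<b}"
        "\<forall>l. H (u' l) = l *\<^sub>R u' l" "\<forall>l. l \<notin> \<Lambda>' \<longrightarrow> u' l = 0" unfolding L_def by blast
    have "x = (\<Sum>l\<in>\<Lambda> \<union> \<Lambda>'. u l)" unfolding x(1)
      by (rule sum.mono_neutral_left) (use x y in auto)
    moreover have "y = (\<Sum>l\<in>\<Lambda> \<union> \<Lambda>'. u' l)" unfolding y(1)
      by (rule sum.mono_neutral_left) (use x y in auto)
    ultimately have "x + y = (\<Sum>l\<in>\<Lambda> \<union> \<Lambda>'. u l + u' l)" by (simp add: sum.distrib)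
    then show "x + y \<in> L" unfolding L_def
      by (intro CollectI exI[of _ "\<Lambda> \<union> \<Lambda>'"] exI[of _ "\<lambda>l. u l + u' l"])
        (use x y in \<open>auto simp: H.add scaleR_add_right\<close>)
  next
    fix c x assume "x \<in> L"
    then obtain \<Lambda> u where x: "x = (\<Sum>l\<in>\<Lambda>. u l)" "finite \<Lambda>" "\<Lambda> \<subseteq> {a<..<b}"
        "\<forall>l. H (u l) = l *\<^sub>R u l" "\<forall>l. l \<notin> \<Lambda> \<longrightarrow> u l = 0" unfolding L_def by blast
    have "H (c *\<^sub>C u l) = l *\<^sub>R c *\<^sub>C u l" for l
      using x(4) bounded_clinear_scaleC[OF selfadjointD(1)[OF selfadjoint_H], of c "u l"]
      by (simp add: scaleC_scaleC mult.commute flip: scaleC_of_real)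
    then show "c *\<^sub>C x \<in> L" unfolding L_def
      by (intro CollectI exI[of _ \<Lambda>] exI[of _ "\<lambda>l. c *\<^sub>C u l"])
        (use x in \<open>auto simp: complex_vec.scale_sum_right\<close>)
  qed
  have "x = 0" if "x \<in> L" and form: "0 \<le> inner (H x - a *\<^sub>R x) (H x - b *\<^sub>R x)" for x
  proof -
    obtain \<Lambda> u where x: "x = (\<Sum>l\<in>\<Lambda>. u l)" "finite \<Lambda>" "\<Lambda> \<subseteq> {a<..<b}"
        "\<And>l. H (u l) = l *\<^sub>R u l" using \<open>x \<in> L\<close> unfolding L_def by blast
    have shifted: "H x - c *\<^sub>R x = (\<Sum>l\<in>\<Lambda>. (l - c) *\<^sub>R u l)" for c
      unfolding x(1) H.sum scaleR_sum_right sum_subtractf[symmetric] x(4) by (simp add: algebra_simps)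
    have orth: "inner (u l) (u m) = 0" if "l \<noteq> m" for l m
      using eigenvectors_orthogonal[OF selfadjoint_H, of "u l" l "u m" m] x(4) that
      by (simp add: inner_eq_Re_cinner scaleC_of_real)
    \<comment> \<open>Only the diagonal term survives by orthogonality, with the negative
      coefficient \<open>(l - a) * (l - b)\<close>.\<close>
    have row: "inner ((l - a) *\<^sub>R u l) (\<Sum>m\<in>\<Lambda>. (m - b) *\<^sub>R u m) = - ((l - a) * (b - l) * inner (u l) (u l))"
      if "l \<in> \<Lambda>" for l
    proof -
      have "inner ((l - a) *\<^sub>R u l) (\<Sum>m\<in>\<Lambda>. (m - b) *\<^sub>R u m)
          = (\<Sum>m\<in>\<Lambda>. if m = l then - ((l - a) * (b - l) * inner (u l) (u l)) else 0)"
        unfolding inner_sum_right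
        by (intro sum.cong refl) (auto simp: orth algebra_simps)
      then show ?thesis using that x(2) by simp
    qed
    have "inner (H x - a *\<^sub>R x) (H x - b *\<^sub>R x) = (\<Sum>l\<in>\<Lambda>. - ((l - a) * (b - l) * inner (u l) (u l)))"
      unfolding shifted inner_sum_left[of _ \<Lambda>] by (intro sum.cong refl row)
    also have "\<dots> = - (\<Sum>l\<in>\<Lambda>. (l - a) * (b - l) * inner (u l) (u l))"
      by (rule sum_negf)
    finally have "(\<Sum>l\<in>\<Lambda>. (l - a) * (b - l) * inner (u l) (u l)) \<le> 0" using form by simp
    moreover have nonneg: "0 \<le> (l - a) * (b - l) * inner (u l) (u l)" if "l \<in> \<Lambda>" for l
      using subsetD[OF x(3) that] by simp
    ultimately have "(\<Sum>l\<in>\<Lambda>. (l - a) * (b - l) * inner (u l) (u l)) = 0"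
      by (intro antisym sum_nonneg) auto
    then have "\<forall>l\<in>\<Lambda>. (l - a) * (b - l) * inner (u l) (u l) = 0"
      using sum_nonneg_eq_0_iff[OF x(2), of "\<lambda>l. (l - a) * (b - l) * inner (u l) (u l)"] nonneg by blast
    then have "\<forall>l\<in>\<Lambda>. u l = 0" using x(3) by fastforce
    then show "x = 0" unfolding x(1) by (intro sum.neutral)
  qed
  note L_form = this
  have "cfinite_dim L"
  proof (rule cfinite_dim_separating_functionals[of "F \<times> E" L "\<lambda>(n, e) f. cinner e (ell2_at f n)"])
    show "finite (F \<times> E)" using F(1) finite by simp
    fix x assume x: "x \<in> L" "\<And>i. i \<in> F \<times> E \<Longrightarrow> (case i of (n, e) \<Rightarrow> \<lambda>f. cinner e (ell2_at f n)) x = 0"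
    have "ell2_at x n = 0" if "n \<in> F" for n
    proof -
      have "(\<Sum>e\<in>E. cinner e (ell2_at x n) *\<^sub>C e) = 0"
        using x(2)[of "(n, _)"] that by (intro sum.neutral) auto
      then show ?thesis by (simp only: expand)
    qed
    then show "x = 0" using L_form[OF x(1) F(2)] by blast
  qed (use L in \<open>auto simp: plus_ell2.rep_eq scaleC_ell2.rep_eq cinner_add_right cinner_scaleC_right\<close>)
  then obtain B where B: "finite B" "L \<subseteq> cspan B" by (auto simp: cfinite_dim_def)
  have "eigenspace H (of_real l) \<subseteq> L" if "a < l" "l < b" for l
  proof
    fix x assume "x \<in> eigenspace H (of_real l)"
    then have "H x = l *\<^sub>R x" by (simp add: eigenspace_def scaleC_of_real)
    then show "x \<in> L" unfolding L_def
      by (intro CollectI exI[of _ "{l}"] exI[of _ "\<lambda>m. if m = l then x else 0"])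
        (use that in \<open>auto simp: H.zero\<close>)
  qed
  then show ?thesis using that B by blast
qed

text \<open>Unit eigenvectors chosen for distinct eigenvalues are orthonormal, and all of them lie
  in one space of finite dimension.\<close>

lemma gap_finite_eigenvalues:
  assumes ab: "a < b" "gap a b"
  shows "finite {l. a < l \<and> l < b \<and> complex_of_real l \<in> eigenvalues H}" (is "finite ?S")
proof -
  obtain B where B: "finite B" "\<And>l. a < l \<Longrightarrow> l < b \<Longrightarrow> eigenspace H (of_real l) \<subseteq> cspan B"
    using gap_finite_dim[OF ab] by blast
  have ev: "\<exists>v. norm v = 1 \<and> H v = of_real l *\<^sub>C v" if l: "l \<in> ?S" for l
  proof -
    obtain w where w: "w \<noteq> 0" "H w = of_real l *\<^sub>C w" using l by (auto simp: eigenvalues_def)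
    let ?c = "complex_of_real (1 / norm w)"
    have "H (?c *\<^sub>C w) = of_real l *\<^sub>C (?c *\<^sub>C w)"
      unfolding bounded_clinear_scaleC[OF selfadjointD(1)[OF selfadjoint_H]] w(2)
      by (simp only: scaleC_scaleC mult.commute)
    moreover have "norm (?c *\<^sub>C w) = 1" using w(1) by (simp add: norm_scaleC norm_divide)
    ultimately show ?thesis by blast
  qed
  define v where "v l = (SOME v. norm v = 1 \<and> H v = of_real l *\<^sub>C v)" for l
  have v: "norm (v l) = 1" "H (v l) = of_real l *\<^sub>C v l" if "l \<in> ?S" for l
    using someI_ex[OF ev[OF that]] unfolding v_def by blast+
  have c: "cinner (v l) (v m) = (if l = m then 1 else 0)" if "l \<in> ?S" "m \<in> ?S" for l m
    using v(1)[OF that(1)] eigenvectors_orthogonal[OF selfadjoint_H v(2)[OF that(1)] v(2)[OF that(2)]]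
    by (auto simp: cinner_self)
  have inj: "inj_on v ?S"
  proof (rule inj_onI)
    fix l m assume lm: "l \<in> ?S" "m \<in> ?S" "v l = v m"
    have "cinner (v l) (v m) = 1" using c[OF lm(1) lm(1)] unfolding lm(3) by simp
    then show "l = m" unfolding c[OF lm(1,2)] by (simp split: if_splits)
  qed
  have "orthonormal (v ` ?S)"
    unfolding orthonormal_def
  proof (intro ballI)
    fix e f assume "e \<in> v ` ?S" "f \<in> v ` ?S"
    then obtain l m where lm: "l \<in> ?S" "m \<in> ?S" "e = v l" "f = v m" by blast
    then show "cinner e f = (if e = f then 1 else 0)" using c[OF lm(1,2)] inj_onD[OF inj] by auto
  qed
  moreover have "v ` ?S \<subseteq> cspan B"
  proof
    fix x assume "x \<in> v ` ?S"
    then obtain l where "l \<in> ?S" "x = v l" by blast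
    then show "x \<in> cspan B" using B(2)[of l] v(2)[of l] by (auto simp: eigenspace_def)
  qed
  ultimately have "finite (v ` ?S)" using orthonormal_card_le[OF _ B(1)] by blast
  then show ?thesis using inj by (rule finite_imageD)
qed

text \<open>For end points \<open>z - r\<close> and \<open>z + r\<close> the gap form equals the
  squared norm of \<open>H f - z *\<^sub>R f\<close> minus that of \<open>r *\<^sub>R f\<close>. Its
  positivity is thus a lower bound for \<open>H - z\<close> on the functions vanishing on
  \<open>F\<close>, and injectivity extends the bound to the whole space.\<close>

lemma gap_resolvent_set:
  assumes ab: "a < z" "z < b" "gap a b" and z: "complex_of_real z \<notin> eigenvalues H"
  shows "complex_of_real z \<in> resolvent_set H"
proof -
  define r where "r = min (z - a) (b - z)"
  have r: "r > 0" using ab by (simp add: r_def)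
  have "gap (z - r) (z + r)" using ab(3) unfolding gap_def r_def by fastforce
  then obtain F :: "int set" where F: "finite F" "\<And>f. (\<And>n. n \<in> F \<Longrightarrow> ell2_at f n = 0) \<Longrightarrow>
      0 \<le> inner (H f - (z - r) *\<^sub>R f) (H f - (z + r) *\<^sub>R f)"
    using gap_form_nonneg_H[of "z - r" "z + r"] r by auto
  let ?A = "\<lambda>f. H f - of_real z *\<^sub>C f"
  define M where "M = {f :: 'g ell2. \<forall>n\<in>F. ell2_at f n = 0}"
  have A: "bounded_clinear ?A"
    by (intro bounded_clinear_diff bounded_clinear_scale selfadjointD(1)[OF selfadjoint_H])
  have M: "complex_vec.subspace M"
    by (auto simp: complex_vec.subspace_def M_def zero_ell2.rep_eq plus_ell2.rep_eq scaleC_ell2.rep_eq)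
  have at: "bounded_linear (\<lambda>f :: 'g ell2. ell2_at f n)" for n
    by (rule bounded_linear_intro[where K = 1])
      (simp_all add: plus_ell2.rep_eq scaleR_ell2.rep_eq ell2_at_le)
  have "M = (\<Inter>n\<in>F. {f. ell2_at f n = 0})" by (auto simp: M_def)
  moreover have "closed {f :: 'g ell2. ell2_at f n = 0}" for n
    by (intro closed_Collect_eq linear_continuous_on at continuous_on_const)
  ultimately have "closed M" by (auto intro: closed_INT)
  then have "complete M" by (simp add: complete_eq_closed)
  have below: "r * norm f \<le> norm (?A f)" if "f \<in> M" for f
  proof (rule power2_le_imp_le)
    let ?y = "H f - z *\<^sub>R f"
    have "0 \<le> inner (H f - (z - r) *\<^sub>R f) (H f - (z + r) *\<^sub>R f)"
      using that by (intro F(2)) (simp add: M_def)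
    also have "H f - (z - r) *\<^sub>R f = ?y + r *\<^sub>R f" by (simp add: algebra_simps)
    also have "H f - (z + r) *\<^sub>R f = ?y - r *\<^sub>R f" by (simp add: algebra_simps)
    also have "inner (?y + r *\<^sub>R f) (?y - r *\<^sub>R f) = inner ?y ?y - r\<^sup>2 * inner f f"
      unfolding inner_add_left inner_diff_right[of _ ?y] inner_scaleR_left inner_scaleR_right
        inner_commute[of f ?y] by (simp add: power2_eq_square algebra_simps)
    finally show "(r * norm f)\<^sup>2 \<le> (norm (?A f))\<^sup>2"
      by (simp add: power_mult_distrib power2_norm_eq_inner scaleC_of_real)
  qed simp
  \<comment> \<open>These vectors span the functions supported on \<open>F\<close>, a complement of
    \<open>M\<close>.\<close>
  define B where "B = (\<lambda>(n, e). ell2_delta n \<otimes>\<^sub>v e) ` (F \<times> E)"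
  have "finite B" using F(1) finite by (simp add: B_def)
  have UNIV: "f \<in> cspan (M \<union> B)" for f
  proof -
    define g where "g = (\<Sum>n\<in>F. \<Sum>e\<in>E. cinner e (ell2_at f n) *\<^sub>C (ell2_delta n \<otimes>\<^sub>v e))"
    have "g \<in> cspan (M \<union> B)" unfolding g_def
      by (intro complex_vec.span_sum complex_vec.span_scale complex_vec.span_base) (auto simp: B_def)
    moreover have "f - g \<in> M"
    proof -
      have "ell2_at g m = ell2_at f m" if "m \<in> F" for m
      proof -
        have "ell2_at g m = (\<Sum>n\<in>F. if n = m then (\<Sum>e\<in>E. cinner e (ell2_at f m) *\<^sub>C e) else 0)"
          unfolding g_def ell2_sum_at
          by (intro sum.cong refl) (simp add: scaleC_ell2.rep_eq ell2_tensor.rep_eq ell2_delta.rep_eq)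
        then show ?thesis using that F(1) by (simp add: expand)
      qed
      then show ?thesis by (simp add: M_def minus_ell2.rep_eq)
    qed
    then have "f - g \<in> cspan (M \<union> B)" by (intro complex_vec.span_base) simp
    ultimately have "(f - g) + g \<in> cspan (M \<union> B)" by (rule complex_vec.span_add[rotated])
    then show ?thesis by simp
  qed
  have "x = 0" if "?A x = 0" for x using z that by (auto simp: eigenvalues_def)
  then have "\<exists>c'>0. \<forall>x\<in>cspan (M \<union> B). c' * norm x \<le> norm (?A x)"
    by (intro conjunct2[OF bounded_below_finite_extension[OF A M \<open>complete M\<close> r below \<open>finite B\<close>]])
  then obtain c where c: "c > 0" "\<And>x. c * norm x \<le> norm (?A x)" using UNIV by blast
  show ?thesis by (rule bounded_below_resolvent_set[OF selfadjoint_H c])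
qed

text \<open>A plane wave of frequency \<theta> solves the eigenvalue equation of the Laplacian at
  \<open>t\<close>. Cut off to \<open>L\<close> sites it has an error located at the two ends and
  bounded independently of \<open>L\<close>; starting at site \<open>N\<close> makes its weighted
  norm small.\<close>

lemma truncated_plane_wave:
  assumes e: "e \<in> E" and t: "0 \<le> t" "t \<le> 4 / h\<^sup>2" and N: "N > 0"
  obtains f where "(norm f)\<^sup>2 = real L"
    "norm (free_hamiltonian h Q f - (t + \<mu> e) *\<^sub>R f) \<le> 16 / h\<^sup>2"
    "norm (decay \<nu> f) \<le> norm f / sqrt (real N)"
proof -
  \<comment> \<open>The frequency with dispersion relation
    \<open>2 - 2 * cos \<theta> = h\<^sup>2 * t\<close>; the bounds on \<open>t\<close> put the
    argument of \<open>arccos\<close> between -1 and 1.\<close>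
  define \<theta> where "\<theta> = arccos (1 - h\<^sup>2 * t / 2)"
  have "h\<^sup>2 * t \<le> 4" "0 \<le> h\<^sup>2 * t" using t h by (simp_all add: field_simps)
  then have cos: "2 - 2 * cos \<theta> = h\<^sup>2 * t" by (simp add: \<theta>_def cos_arccos)
  define I where "I = {int N..<int N + int L}"
  define p where "p n = (if n \<in> I then cis (\<theta> * real_of_int n) *\<^sub>C e else 0)" for n
  define f where "f = Abs_ell2 p"
  have fin: "finite I" and card: "card I = L" by (simp_all add: I_def)
  have "(\<lambda>n. (norm (p n))\<^sup>2) summable_on UNIV"
    by (rule finite_nonzero_values_imp_summable_on, rule finite_subset[OF _ fin]) (auto simp: p_def)
  then have f: "ell2_at f = p" by (simp add: f_def Abs_ell2_inverse)
  have "complex_of_real ((norm e)\<^sup>2) = 1"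
    unfolding cinner_self[symmetric] using orthonormal e by (simp add: orthonormal_def)
  then have "(norm e)\<^sup>2 = 1\<^sup>2" by (simp only: of_real_eq_1_iff) simp
  then have "norm e = 1" by (rule power2_eq_imp_eq) simp_all
  then have p: "norm (p n) = (if n \<in> I then 1 else 0)" for n by (simp add: p_def norm_scaleC)
  show ?thesis
  proof
    have "(norm f)\<^sup>2 = infsum (\<lambda>n. 1) I"
      unfolding ell2_norm_sq f p by (rule infsum_cong_neutral) auto
    then show "(norm f)\<^sup>2 = real L" using fin card by simp
    have "norm (decay \<nu> f) \<le> (1 / sqrt (real N)) * norm f"
    proof (rule ell2_norm_leI)
      fix n
      show "norm (ell2_at (decay \<nu> f) n) \<le> 1 / sqrt (real N) * norm (ell2_at f n)"
      proof (cases "n \<in> I")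
        case True
        then have n: "real N \<le> real_of_int n" by (simp add: I_def)
        have "(norm (weight \<nu> n))\<^sup>2 * real N \<le> (norm (weight \<nu> n))\<^sup>2 * \<bar>real_of_int n\<bar>"
          using n by (intro mult_left_mono) auto
        also have "\<dots> \<le> 1 / (1 + (real_of_int n)\<^sup>2)" by (rule norm_weight_sq_le[OF \<nu>])
        also have "\<dots> \<le> 1" by (simp add: divide_le_eq_1 add_pos_nonneg)
        finally have "(norm (weight \<nu> n))\<^sup>2 \<le> (1 / sqrt (real N))\<^sup>2" using N by (simp add: field_simps)
        then have "norm (weight \<nu> n) \<le> 1 / sqrt (real N)" by (rule power2_le_imp_le) simp
        then show ?thesis
          using decay(2)[of \<nu> f n] \<nu> by (simp add: norm_scaleC f p True)
      next
        case False
        then have "ell2_at f n = 0" by (simp add: f p_def)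
        then show ?thesis using decay(2)[of \<nu> f n] \<nu> by simp
      qed
    qed simp
    then show "norm (decay \<nu> f) \<le> norm f / sqrt (real N)" by simp
    define g where "g = free_hamiltonian h Q f - (t + \<mu> e) *\<^sub>R f"
    have Qf: "Q (p n) = \<mu> e *\<^sub>R p n" for n
      by (simp add: p_def linear_0[OF bounded_linear.linear[OF bounded_clinear_bounded_linear]]
          selfadjointD(1)[OF selfadjoint] bounded_clinear_scaleC[OF selfadjointD(1)[OF selfadjoint]] eigen[OF e]
          scaleC_scaleC mult.commute flip: scaleC_of_real)
    have g: "ell2_at g n = (1 / h\<^sup>2) *\<^sub>R (2 *\<^sub>R p n - p (n + 1) - p (n - 1)) - t *\<^sub>R p n" for n
      by (simp add: g_def free_hamiltonian_def lap_eq_shift minus_ell2.rep_eq plus_ell2.rep_eq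
          scaleR_ell2.rep_eq shift.rep_eq id_tensor(2)[OF selfadjointD(1)[OF selfadjoint]] f Qf
          scaleR_add_left)
    \<comment> \<open>Only here can the three-point stencil see an end of \<open>I\<close>: the
      sites just inside and just outside each end.\<close>
    define S where "S = {int N - 1, int N, int N + int L - 1, int N + int L}"
    have g0: "ell2_at g n = 0" if "n \<notin> S" for n
    proof (cases "n \<in> I")
      case True
      with that have "n + 1 \<in> I" "n - 1 \<in> I" by (auto simp: S_def I_def)
      have cis: "cis (\<theta> * real_of_int (n + 1)) = cis (\<theta> * real_of_int n) * cis \<theta>"
        "cis (\<theta> * real_of_int (n - 1)) = cis (\<theta> * real_of_int n) * cis (- \<theta>)"
        by (simp_all add: cis_mult algebra_simps)
      have "complex_of_real (1 / h\<^sup>2) * (2 - cis \<theta> - cis (- \<theta>)) - of_real t = of_real ((2 - 2 * cos \<theta>) / h\<^sup>2 - t)"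
        by (simp add: complex_eq_iff)
      also have "\<dots> = 0" unfolding cos using h by simp
      finally have zero: "complex_of_real (1 / h\<^sup>2) * (2 - cis \<theta> - cis (- \<theta>)) - of_real t = 0" .
      have "ell2_at g n = ((complex_of_real (1 / h\<^sup>2) * (2 - cis \<theta> - cis (- \<theta>)) - of_real t) * cis (\<theta> * real_of_int n)) *\<^sub>C e"
        unfolding g p_def cis using True \<open>n + 1 \<in> I\<close> \<open>n - 1 \<in> I\<close>
        by (simp add: scaleC_scaleC complex_vec.scale_left_diff_distrib complex_vec.scale_right_diff_distrib
            scaleC_add_left add_divide_distrib algebra_simps flip: scaleC_of_real)
      then show ?thesis unfolding zero by simp
    next
      case False
      with that have "n + 1 \<notin> I" "n - 1 \<notin> I" by (auto simp: S_def I_def)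
      with False show ?thesis by (simp add: g p_def)
    qed
    \<comment> \<open>The Laplacian and the term with \<open>t\<close> contribute
      \<open>4 / h\<^sup>2\<close> each; over the at most four sites of \<open>S\<close> this gives
      the square of \<open>16 / h\<^sup>2\<close>.\<close>
    have g8: "norm (ell2_at g n) \<le> 8 / h\<^sup>2" for n
    proof -
      have p1: "norm (p m) \<le> 1" for m by (simp add: p)
      have "norm (2 *\<^sub>R p n - p (n + 1) - p (n - 1)) \<le> 2 * norm (p n) + norm (p (n + 1)) + norm (p (n - 1))"
        using norm_triangle_ineq4[of "2 *\<^sub>R p n - p (n + 1)" "p (n - 1)"] norm_triangle_ineq4[of "2 *\<^sub>R p n" "p (n + 1)"]
        by simp
      then have 4: "norm (2 *\<^sub>R p n - p (n + 1) - p (n - 1)) \<le> 4"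
        using p1[of n] p1[of "n + 1"] p1[of "n - 1"] by linarith
      have "norm (ell2_at g n) \<le> (1 / h\<^sup>2) * norm (2 *\<^sub>R p n - p (n + 1) - p (n - 1)) + t * norm (p n)"
        unfolding g using norm_triangle_ineq4[of "(1 / h\<^sup>2) *\<^sub>R (2 *\<^sub>R p n - p (n + 1) - p (n - 1))" "t *\<^sub>R p n"] t(1)
        by simp
      also have "\<dots> \<le> (1 / h\<^sup>2) * 4 + 4 / h\<^sup>2 * 1"
        using 4 p1 t by (intro add_mono mult_mono) auto
      finally show ?thesis by simp
    qed
    have "(norm g)\<^sup>2 \<le> (16 / h\<^sup>2)\<^sup>2"
      unfolding ell2_norm_sq
    proof (rule infsum_le_finite_sums)
      fix G :: "int set" assume "finite G"
      have "finite S" by (simp add: S_def)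
      moreover have "card S \<le> 4"
        using card_length[of "[int N - 1, int N, int N + int L - 1, int N + int L]"] by (simp add: S_def)
      ultimately have S: "finite S" "card S \<le> 4" .
      have "(\<Sum>n\<in>G. (norm (ell2_at g n))\<^sup>2) = (\<Sum>n\<in>G \<inter> S. (norm (ell2_at g n))\<^sup>2)"
        using \<open>finite G\<close> g0 by (intro sum.mono_neutral_right) auto
      also have "\<dots> \<le> (\<Sum>n\<in>G \<inter> S. (8 / h\<^sup>2)\<^sup>2)" by (intro sum_mono power_mono g8) simp
      also have "\<dots> = real (card (G \<inter> S)) * (8 / h\<^sup>2)\<^sup>2" by simp
      also have "\<dots> \<le> 4 * (8 / h\<^sup>2)\<^sup>2"
        using card_mono[OF S(1), of "G \<inter> S"] S(2) by (intro mult_right_mono) auto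
      also have "\<dots> = (16 / h\<^sup>2)\<^sup>2" by (simp add: power2_eq_square)
      finally show "(\<Sum>n\<in>G. (norm (ell2_at g n))\<^sup>2) \<le> (16 / h\<^sup>2)\<^sup>2" .
    qed (use ell2_at[of g] in simp)
    then have "norm g \<le> 16 / h\<^sup>2" by (rule power2_le_imp_le) simp
    then show "norm (free_hamiltonian h Q f - (t + \<mu> e) *\<^sub>R f) \<le> 16 / h\<^sup>2" by (simp only: g_def)
  qed
qed

text \<open>Test the two-sided bound with \<open>g = U f\<close>, estimate the weight on that side
  by 1, and divide by the norm of \<open>U f\<close>.\<close>

lemma norm_U_le: "norm (U f) \<le> C * norm (decay \<nu> f)"
proof (cases "U f = 0")
  case False
  have "norm (U f) * norm (U f) = inner (U f) (U f)"
    by (simp only: power2_norm_eq_inner[symmetric] power2_eq_square)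
  also have "\<dots> \<le> C * norm (decay \<nu> (U f)) * norm (decay \<nu> f)"
    using U_bound[of "U f" f] by linarith
  also have "\<dots> \<le> C * norm (U f) * norm (decay \<nu> f)"
    using C \<nu> by (intro mult_right_mono mult_left_mono norm_decay_le) auto
  also have "\<dots> = C * norm (decay \<nu> f) * norm (U f)" by simp
  finally show ?thesis by (rule mult_right_le_imp_le) (use False in simp)
qed (use C in simp)

text \<open>A bounded inverse would bound the norm of a truncated plane wave by a multiple of its
  error. Far from the origin the perturbation accounts for at most half of that norm, so the norm
  would stay bounded while \<open>L\<close> grows.\<close>

lemma bands_subset_spectrum:
  assumes "l \<in> bands"
  shows "complex_of_real l \<in> spectrum H"
proof -
  obtain e where e: "e \<in> E" "0 \<le> l - \<mu> e" "l - \<mu> e \<le> 4 / h\<^sup>2" using assms by (auto simp: bands_def)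
  have False if R: "bounded_clinear R" "\<forall>f. R (H f - of_real l *\<^sub>C f) = f" for R
  proof -
    obtain K where K: "K > 0" "\<And>f. norm (R f) \<le> norm f * K"
      using bounded_linear.pos_bounded[OF bounded_clinear_bounded_linear[OF R(1)]] by blast
    \<comment> \<open>Chosen so that the perturbation term is at most half the norm of
      \<open>f\<close>; the added 1 forces \<open>N\<close> to be positive.\<close>
    obtain N :: nat where N: "(2 * C * K + 1)\<^sup>2 \<le> real N" using real_arch_simple ..
    have s: "2 * C * K + 1 \<le> sqrt (real N)" using N by (rule real_le_rsqrt)
    have CK: "C * K \<ge> 0" using C K by simp
    have N0: "N > 0" using s CK by (intro gr0I) simp
    have small: "C * K / sqrt (real N) \<le> 1 / 2"
    proof -
      have "2 * (C * K) \<le> sqrt (real N)" using s by simp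
      then show ?thesis using N0 by (simp add: pos_divide_le_eq)
    qed
    \<comment> \<open>Makes the norm of \<open>f\<close> exceed the bound that remains after the
      perturbation term is absorbed.\<close>
    obtain L :: nat where L: "(2 * (16 / h\<^sup>2 * K) + 1)\<^sup>2 \<le> real L" using real_arch_simple ..
    obtain f where f: "(norm f)\<^sup>2 = real L" "norm (free_hamiltonian h Q f - l *\<^sub>R f) \<le> 16 / h\<^sup>2"
      "norm (decay \<nu> f) \<le> norm f / sqrt (real N)"
      by (rule truncated_plane_wave[OF e N0, of L, unfolded diff_add_cancel])
    have "norm f \<le> norm (H f - l *\<^sub>R f) * K"
      using K(2)[of "H f - l *\<^sub>R f"] R(2) unfolding scaleC_of_real by simp
    also have "norm (H f - l *\<^sub>R f) \<le> 16 / h\<^sup>2 + C * (norm f / sqrt (real N))"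
    proof -
      have "H f - l *\<^sub>R f = (free_hamiltonian h Q f - l *\<^sub>R f) + U f" by (simp add: H_def)
      then have "norm (H f - l *\<^sub>R f) \<le> norm (free_hamiltonian h Q f - l *\<^sub>R f) + norm (U f)"
        by (simp only: norm_triangle_ineq)
      then show ?thesis using f(2) norm_U_le[of f] mult_left_mono[OF f(3) C] by linarith
    qed
    finally have "norm f \<le> (16 / h\<^sup>2 + C * (norm f / sqrt (real N))) * K" using K(1) by simp
    also have "\<dots> = 16 / h\<^sup>2 * K + (C * K / sqrt (real N)) * norm f" by (simp add: algebra_simps)
    also have "\<dots> \<le> 16 / h\<^sup>2 * K + 1 / 2 * norm f" using small by (intro add_left_mono mult_right_mono) auto
    finally have "norm f \<le> 2 * (16 / h\<^sup>2 * K)" by linarith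
    moreover have "2 * (16 / h\<^sup>2 * K) + 1 \<le> norm f"
      using L unfolding f(1)[symmetric] by (rule power2_le_imp_le) simp
    ultimately show False by linarith
  qed
  then show ?thesis unfolding spectrum_def resolvent_set_def by blast
qed

text \<open>Each band is connected and has more than one point, so it has no isolated points, and it
  lies in the spectrum.\<close>

lemma bands_islimpt:
  assumes "l \<in> bands"
  shows "complex_of_real l islimpt spectrum H"
proof -
  obtain e where e: "e \<in> E" "l \<in> {\<mu> e .. \<mu> e + 4 / h\<^sup>2}" using assms by (auto simp: bands_def)
  let ?B = "complex_of_real ` {\<mu> e .. \<mu> e + 4 / h\<^sup>2}"
  have "connected ?B" by (intro connected_continuous_image continuous_intros) simp
  moreover have "\<nexists>x. ?B = {x}"
  proof
    assume "\<exists>x. ?B = {x}"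
    then obtain x where "?B = {x}" by blast
    moreover have "complex_of_real (\<mu> e) \<in> ?B" "complex_of_real (\<mu> e + 4 / h\<^sup>2) \<in> ?B"
      by (rule imageI, use h in simp)+
    ultimately have "complex_of_real (\<mu> e) = complex_of_real (\<mu> e + 4 / h\<^sup>2)" by (metis singletonD)
    then show False using h by (simp only: of_real_eq_iff) simp
  qed
  ultimately have "complex_of_real l islimpt ?B" using e(2) by (intro connected_imp_perfect imageI) blast+
  moreover have "?B \<subseteq> spectrum H"
  proof
    fix z assume "z \<in> ?B"
    then show "z \<in> spectrum H" using bands_subset_spectrum e(1) unfolding bands_def by blast
  qed
  ultimately show ?thesis by (rule islimpt_subset)
qed

text \<open>Take the nearest upper band edge below \<open>l\<close> and the nearest lower band edge
  above it, with \<open>- \<rho>\<close> and \<rho> as outer limits. The end points come from finite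
  sets that do not depend on \<open>l\<close>.\<close>

lemma gap_exists:
  assumes "l \<notin> bands" "\<bar>l\<bar> < \<rho>"
  shows "\<exists>a\<in>insert (- \<rho>) ((\<lambda>e. \<mu> e + 4 / h\<^sup>2) ` E). \<exists>b\<in>insert \<rho> (\<mu> ` E). a < l \<and> l < b \<and> gap a b"
proof -
  let ?A = "{a \<in> insert (- \<rho>) ((\<lambda>e. \<mu> e + 4 / h\<^sup>2) ` E). a < l}"
  let ?B = "{b \<in> insert \<rho> (\<mu> ` E). l < b}"
  have A: "finite ?A" "?A \<noteq> {}" and B: "finite ?B" "?B \<noteq> {}" using finite assms(2) by auto
  have "gap (Max ?A) (Min ?B)"
    unfolding gap_def
  proof
    fix e assume e: "e \<in> E"
    then have "l < \<mu> e \<or> \<mu> e + 4 / h\<^sup>2 < l" using assms(1) by (force simp: bands_def)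
    then show "Min ?B \<le> \<mu> e \<or> \<mu> e + 4 / h\<^sup>2 \<le> Max ?A"
      using e A B by (auto intro!: Min_le Max_ge)
  qed
  moreover have "Max ?A \<in> ?A" "Min ?B \<in> ?B" using Max_in[OF A] Min_in[OF B] by blast+
  ultimately show ?thesis by blast
qed

lemma spectrum_off_bands:
  assumes "z \<in> spectrum H" "z \<notin> complex_of_real ` bands"
  shows "z \<in> eigenvalues H" "cfinite_dim (eigenspace H z)"
proof -
  have "Im z = 0" using nonreal_resolvent_set[OF selfadjoint_H, of z] assms(1) by (auto simp: spectrum_def)
  then obtain l where l: "z = complex_of_real l" by (metis complex_is_Real_iff Reals_cases)
  then have "l \<notin> bands" using assms(2) by blast
  then obtain a b where ab: "a < l" "l < b" "gap a b" using gap_exists[of l "\<bar>l\<bar> + 1"] by auto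
  show "z \<in> eigenvalues H"
    using gap_resolvent_set[OF ab] assms(1) unfolding l spectrum_def by blast
  obtain B where "finite B" "\<And>l. a < l \<Longrightarrow> l < b \<Longrightarrow> eigenspace H (of_real l) \<subseteq> cspan B"
    using gap_finite_dim[of a b] ab by auto
  then show "cfinite_dim (eigenspace H z)" using ab unfolding l cfinite_dim_def by blast
qed

text \<open>Eigenvalues are bounded by the bound \<open>K\<close> of \<open>H\<close>, so each one
  off the bands lies in a gap with end points in the finite set \<open>P\<close>, and every gap
  holds finitely many.\<close>

lemma finite_eigenvalues_off_bands: "finite (eigenvalues H - complex_of_real ` bands)"
proof -
  obtain K where K: "K > 0" "\<And>f. norm (H f) \<le> norm f * K" using bounded_linear.pos_bounded[OF bounded_linear_H] by blast
  define \<rho> where "\<rho> = K + 1"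
  let ?S = "\<lambda>a b. {l. a < l \<and> l < b \<and> complex_of_real l \<in> eigenvalues H}"
  define P where "P = {(a, b) \<in> insert (- \<rho>) ((\<lambda>e. \<mu> e + 4 / h\<^sup>2) ` E) \<times> insert \<rho> (\<mu> ` E). a < b \<and> gap a b}"
  have "finite P" unfolding P_def
    by (rule finite_subset[of _ "insert (- \<rho>) ((\<lambda>e. \<mu> e + 4 / h\<^sup>2) ` E) \<times> insert \<rho> (\<mu> ` E)"]) (use finite in auto)
  then have fin: "finite (\<Union>(a, b)\<in>P. ?S a b)"
    by (rule finite_UN_I) (auto simp: P_def intro: gap_finite_eigenvalues)
  have "eigenvalues H - complex_of_real ` bands \<subseteq> complex_of_real ` (\<Union>(a, b)\<in>P. ?S a b)"
  proof
    fix z assume z: "z \<in> eigenvalues H - complex_of_real ` bands"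
    then obtain l where l: "z = complex_of_real l" using eigenvalue_real[OF selfadjoint_H] by blast
    obtain f where f: "f \<noteq> 0" "H f = z *\<^sub>C f" using z by (auto simp: eigenvalues_def)
    have "norm z * norm f \<le> K * norm f" using K(2)[of f] by (simp add: f(2) norm_scaleC mult.commute)
    then have "norm z \<le> K" using f(1) by simp
    then have "\<bar>l\<bar> < \<rho>" by (simp add: \<rho>_def l)
    moreover have "l \<notin> bands" using z l by blast
    ultimately obtain a b where ab: "a \<in> insert (- \<rho>) ((\<lambda>e. \<mu> e + 4 / h\<^sup>2) ` E)" "b \<in> insert \<rho> (\<mu> ` E)"
      "a < l" "l < b" "gap a b" using gap_exists by blast
    then have "(a, b) \<in> P" by (auto simp: P_def)
    moreover have "l \<in> ?S a b" using ab z l by blast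
    ultimately have "l \<in> (\<Union>(a, b)\<in>P. ?S a b)" by blast
    then show "z \<in> complex_of_real ` (\<Union>(a, b)\<in>P. ?S a b)" unfolding l by (rule imageI)
  qed
  then show ?thesis using fin finite_surj by blast
qed

section \<open>Discrete and essential spectrum\<close>

lemma closed_bands: "closed (complex_of_real ` bands)"
proof -
  have "compact bands" unfolding bands_def by (intro compact_UN finite compact_Icc)
  then have "compact (complex_of_real ` bands)" by (intro compact_continuous_image continuous_intros)
  then show ?thesis by (rule compact_imp_closed)
qed

text \<open>Band points are limit points of the spectrum. Off the bands the spectrum is a finite set
  of eigenvalues and the bands are closed, so every such eigenvalue is isolated.\<close>

lemma discrete_spectrum_eq: "discrete_spectrum H = eigenvalues H - complex_of_real ` bands"
proof (intro equalityI subsetI)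
  fix z assume "z \<in> discrete_spectrum H"
  then show "z \<in> eigenvalues H - complex_of_real ` bands"
    using bands_islimpt by (auto simp: discrete_spectrum_def)
next
  fix z assume z: "z \<in> eigenvalues H - complex_of_real ` bands"
  have "spectrum H \<subseteq> complex_of_real ` bands \<union> (eigenvalues H - complex_of_real ` bands)"
    using spectrum_off_bands(1) by blast
  then have "z islimpt complex_of_real ` bands \<or> z islimpt (eigenvalues H - complex_of_real ` bands)"
    if "z islimpt spectrum H"
    using islimpt_subset[OF that] islimpt_Un by blast
  moreover have "\<not> z islimpt complex_of_real ` bands"
    using closed_bands z closed_limpt by blast
  moreover have "\<not> z islimpt (eigenvalues H - complex_of_real ` bands)"
    using finite_eigenvalues_off_bands by (rule islimpt_finite)
  ultimately have "\<not> z islimpt spectrum H" by blast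
  moreover have "z \<in> spectrum H" using z eigenvalue_spectrum by blast
  ultimately show "z \<in> discrete_spectrum H"
    using z spectrum_off_bands(2)[of z] by (simp add: discrete_spectrum_def)
qed

lemma finite_discrete_spectrum: "finite (discrete_spectrum H)"
  unfolding discrete_spectrum_eq by (rule finite_eigenvalues_off_bands)

lemma essential_spectrum_eq: "essential_spectrum H = complex_of_real ` bands"
proof -
  have "complex_of_real ` bands \<subseteq> spectrum H" using bands_subset_spectrum by blast
  then show ?thesis
    using spectrum_off_bands(1) unfolding essential_spectrum_def discrete_spectrum_eq by blast
qed

text \<open>A finite sum of finite multiplicities; finite-dimensional eigenspaces are part of
  \<open>discrete_spectrum\<close>, so \<open>cdim\<close> is the true multiplicity.\<close>

lemma discrete_count_finite: "discrete_count H < \<infinity>"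
proof -
  have "(\<Sum>z\<in>A. enat (f z)) = enat (\<Sum>z\<in>A. f z)" if "finite A" for A :: "complex set" and f
    using that by (induction A rule: finite_induct) (simp_all add: zero_enat_def)
  then show ?thesis
    unfolding discrete_count_def infsum_finite[OF finite_discrete_spectrum]
    using finite_discrete_spectrum by simp
qed

end

lemma (in perturbed_hamiltonian) bands_eq:
  "complex_of_real ` bands = {complex_of_real t + z | t z. t \<in> {0..4 / h\<^sup>2} \<and> z \<in> spectrum Q}"
proof -
  have "cfinite_dim (UNIV :: 'g set)"
    unfolding cfinite_dim_def
  proof (intro exI[of _ E] conjI finite subsetI)
    fix x :: 'g
    have "(\<Sum>e\<in>E. cinner e x *\<^sub>C e) \<in> cspan E"
      by (intro complex_vec.span_sum complex_vec.span_scale complex_vec.span_base)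
    then show "x \<in> cspan E" by (simp only: expand)
  qed
  then have spec: "spectrum Q = (\<lambda>e. complex_of_real (\<mu> e)) ` E"
    using finite_dim_spectrum_eq_eigenvalues[OF selfadjoint]
      eigenvalues_eigenbasis[OF selfadjoint orthonormal eigen expand] by simp
  show ?thesis
  proof (intro equalityI subsetI)
    fix z assume "z \<in> complex_of_real ` bands"
    then obtain e l where l: "e \<in> E" "\<mu> e \<le> l" "l \<le> \<mu> e + 4 / h\<^sup>2" "z = complex_of_real l"
      by (auto simp: bands_def)
    then have "l - \<mu> e \<in> {0..4 / h\<^sup>2}" "z = complex_of_real (l - \<mu> e) + complex_of_real (\<mu> e)" by auto
    then show "z \<in> {complex_of_real t + z | t z. t \<in> {0..4 / h\<^sup>2} \<and> z \<in> spectrum Q}"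
      unfolding spec using l(1) by blast
  next
    fix z assume "z \<in> {complex_of_real t + z | t z. t \<in> {0..4 / h\<^sup>2} \<and> z \<in> spectrum Q}"
    then obtain t e where t: "0 \<le> t" "t \<le> 4 / h\<^sup>2" "e \<in> E" "z = complex_of_real (t + \<mu> e)"
      unfolding spec by auto
    then have "t + \<mu> e \<in> bands" by (auto simp: bands_def intro!: bexI[of _ e])
    then show "z \<in> complex_of_real ` bands" unfolding t(4) by (rule imageI)
  qed
qed

section \<open>Application to both signs of the perturbation\<close>

lemma (in eigenbasis) essential_and_discrete_spectrum:
  assumes "h > 0" "\<nu> \<ge> 3" "C \<ge> 0" "selfadjoint U"
    and "\<And>f g. \<bar>inner g (U f)\<bar> \<le> C * norm (decay \<nu> g) * norm (decay \<nu> f)"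
    and H: "H = (\<lambda>f. free_hamiltonian h Q f + U f)"
  shows "essential_spectrum H = {complex_of_real t + z | t z. t \<in> {0..4 / h\<^sup>2} \<and> z \<in> spectrum Q}"
    and "finite (discrete_spectrum H)" and "discrete_count H < \<infinity>"
proof -
  interpret P: perturbed_hamiltonian Q E \<mu> h \<nu> C U
    by unfold_locales (use assms in auto)
  have "P.H = H" by (simp add: H P.H_def[abs_def])
  then show "essential_spectrum H = {complex_of_real t + z | t z. t \<in> {0..4 / h\<^sup>2} \<and> z \<in> spectrum Q}"
    "finite (discrete_spectrum H)" "discrete_count H < \<infinity>"
    using P.essential_spectrum_eq P.bands_eq P.finite_discrete_spectrum P.discrete_count_finite by simp_all
qed

lemma cinner_mult_op_tensor:
  assumes \<nu>: "\<nu> \<ge> 0" and K: "bounded_clinear K" "bounded_clinear K'" "\<And>x y. cinner (K x) y = cinner x (K' y)"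
  shows "cinner ((mult_op (weight \<nu>) \<otimes>\<^sub>o K) f) g = cinner f ((mult_op (weight \<nu>) \<otimes>\<^sub>o K') g)"
  unfolding ell2_cinner
  by (simp add: mult_op_tensor(2)[OF norm_weight_le[OF \<nu>]] K cinner_scaleC_left cinner_scaleC_right weight_def)

theorem corollary5p10:
  fixes h \<nu>\<^sub>0 :: real
    and Q K :: "'g::complex_hilbert_space \<Rightarrow> 'g"
    and W V :: "'g ell2 \<Rightarrow> 'g ell2"
  assumes "h > 0"
    and "selfadjoint Q"
    and "V = (mult_op (weight \<nu>\<^sub>0) \<otimes>\<^sub>o cadjoint K) \<circ> W \<circ> (mult_op (weight \<nu>\<^sub>0) \<otimes>\<^sub>o K)"
    and "\<nu>\<^sub>0 > 3"
    and "bounded_clinear W" and "nonneg_operator W"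
    and "hilbert_schmidt K"
    and "cfinite_dim (UNIV :: 'g set)"
  shows "\<forall>H \<in> {\<lambda>f. free_hamiltonian h Q f + V f, \<lambda>f. free_hamiltonian h Q f - V f}.
    (essential_spectrum H = essential_spectrum (free_hamiltonian h Q) \<and>
     essential_spectrum (free_hamiltonian h Q) =
       {complex_of_real t + \<mu> | t \<mu>. t \<in> {0..4 / h\<^sup>2} \<and> \<mu> \<in> spectrum Q}) \<and>
    (\<forall>e \<in> threshold_set h Q. \<not> e islimpt discrete_spectrum H) \<and>
    discrete_count H < \<infinity>"
proof -
  have \<nu>: "\<nu>\<^sub>0 \<ge> 0" "\<nu>\<^sub>0 \<ge> 3" using assms(4) by simp_all
  obtain E :: "'g set" and \<mu> where E: "eigenbasis Q E \<mu>"
    using selfadjoint_eigenbasis[OF assms(2,8)] by blast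
  interpret eigenbasis Q E \<mu> by (rule E)
  have K: "bounded_clinear K" using assms(7) by (simp add: hilbert_schmidt_def)
  note K' = finite_dim_cadjoint[OF K finite expand]
  have adj: "cinner (K x) y = cinner x (cadjoint K y)" for x y
    using K'(2)[of y x] cinner_commute[of "K x" y] cinner_commute[of x "cadjoint K y"] by simp
  have W: "selfadjoint W" by (rule nonneg_operator_selfadjoint[OF assms(5,6)])
  define A B where "A = mult_op (weight \<nu>\<^sub>0) \<otimes>\<^sub>o K" and "B = mult_op (weight \<nu>\<^sub>0) \<otimes>\<^sub>o cadjoint K"
  have V: "V = (\<lambda>f. B (W (A f)))" by (simp add: assms(3) A_def B_def comp_def)
  have AB: "cinner (A f) g = cinner f (B g)" for f g
    unfolding A_def B_def by (rule cinner_mult_op_tensor[OF \<nu>(1) K K'(1) adj])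
  have BA: "cinner (B f) g = cinner f (A g)" for f g
    using AB[of g f] cinner_commute[of "B f" g] cinner_commute[of f "A g"] by simp
  have A: "bounded_clinear A" and B: "bounded_clinear B"
    unfolding A_def B_def by (intro mult_op_tensor(1)[OF norm_weight_le[OF \<nu>(1)]] K K'(1))+
  have "bounded_clinear V"
    unfolding V by (rule bounded_clinear_compose[OF B bounded_clinear_compose[OF assms(5) A]])
  moreover have "cinner (V f) g = cinner f (V g)" for f g
    unfolding V BA by (simp only: selfadjointD(2)[OF W] AB)
  ultimately have saV: "selfadjoint V" by (simp add: selfadjoint_def)
  obtain k where k: "k \<ge> 0" "\<And>x. norm (K x) \<le> norm x * k"
    using bounded_linear.nonneg_bounded[OF bounded_clinear_bounded_linear[OF K]] by blast
  obtain w where w: "w \<ge> 0" "\<And>f. norm (W f) \<le> norm f * w"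
    using bounded_linear.nonneg_bounded[OF bounded_clinear_bounded_linear[OF assms(5)]] by blast
  have A_le: "norm (A f) \<le> k * norm (decay \<nu>\<^sub>0 f)" for f
  proof (rule ell2_norm_leI)
    fix n
    have "norm (ell2_at (A f) n) = norm (weight \<nu>\<^sub>0 n) * norm (K (ell2_at f n))"
      by (simp add: A_def mult_op_tensor(2)[OF norm_weight_le[OF \<nu>(1)] K] norm_scaleC)
    also have "\<dots> \<le> norm (weight \<nu>\<^sub>0 n) * (norm (ell2_at f n) * k)"
      by (intro mult_left_mono k) simp
    also have "\<dots> = k * norm (ell2_at (decay \<nu>\<^sub>0 f) n)"
      unfolding decay(2)[OF \<nu>(1)] norm_scaleC by (simp only: ac_simps)
    finally show "norm (ell2_at (A f) n) \<le> k * norm (ell2_at (decay \<nu>\<^sub>0 f) n)" .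
  qed (rule k)
  \<comment> \<open>One factor \<open>k\<close> for the weighted bound of each copy of
    \<open>A\<close> and the factor \<open>w\<close> for \<open>W\<close>; moving \<open>B\<close>
    across the scalar product puts one weight on each argument.\<close>
  define C where "C = k * w * k"
  have C: "C \<ge> 0" using k w by (simp add: C_def)
  have bound: "\<bar>inner g (V f)\<bar> \<le> C * norm (decay \<nu>\<^sub>0 g) * norm (decay \<nu>\<^sub>0 f)" for f g
  proof -
    have "inner g (V f) = inner (A g) (W (A f))" by (simp only: inner_eq_Re_cinner V AB)
    then have "\<bar>inner g (V f)\<bar> \<le> norm (A g) * norm (W (A f))" by (simp only: Cauchy_Schwarz_ineq2)
    also have "\<dots> \<le> norm (A g) * (norm (A f) * w)" by (intro mult_left_mono w) simp
    also have "\<dots> \<le> (k * norm (decay \<nu>\<^sub>0 g)) * ((k * norm (decay \<nu>\<^sub>0 f)) * w)"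
      by (intro mult_mono A_le mult_right_mono w mult_nonneg_nonneg k) auto
    finally show ?thesis by (simp only: C_def ac_simps)
  qed
  \<comment> \<open>The free operator is the instance with zero perturbation and bound 0.\<close>
  have "selfadjoint (\<lambda>f :: 'g ell2. 0)"
    using bounded_clinear_scale[of 0] by (simp add: selfadjoint_def)
  then have free: "essential_spectrum (free_hamiltonian h Q) =
      {complex_of_real t + z | t z. t \<in> {0..4 / h\<^sup>2} \<and> z \<in> spectrum Q}"
    by (rule essential_and_discrete_spectrum(1)[OF assms(1) \<nu>(2) order_refl]) simp_all
  show ?thesis
  proof
    fix H assume "H \<in> {\<lambda>f. free_hamiltonian h Q f + V f, \<lambda>f. free_hamiltonian h Q f - V f}"
    then obtain U where U: "selfadjoint U" "H = (\<lambda>f. free_hamiltonian h Q f + U f)"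
      "\<And>f g. \<bar>inner g (U f)\<bar> \<le> C * norm (decay \<nu>\<^sub>0 g) * norm (decay \<nu>\<^sub>0 f)"
    proof (elim insertE emptyE)
      assume "H = (\<lambda>f. free_hamiltonian h Q f + V f)"
      then show thesis by (rule that[OF saV _ bound])
    next
      assume "H = (\<lambda>f. free_hamiltonian h Q f - V f)"
      then have "H = (\<lambda>f. free_hamiltonian h Q f + - V f)" by simp
      then show thesis
        by (rule that[OF selfadjoint_minus[OF saV]]) (simp only: inner_minus_right abs_minus_cancel bound)
    qed
    note H = essential_and_discrete_spectrum[OF assms(1) \<nu>(2) C U(1) U(3) U(2)]
    show "(essential_spectrum H = essential_spectrum (free_hamiltonian h Q) \<and>
       essential_spectrum (free_hamiltonian h Q) =
         {complex_of_real t + \<mu> | t \<mu>. t \<in> {0..4 / h\<^sup>2} \<and> \<mu> \<in> spectrum Q}) \<and>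
      (\<forall>e \<in> threshold_set h Q. \<not> e islimpt discrete_spectrum H) \<and>
      discrete_count H < \<infinity>"
      \<comment> \<open>A finite discrete spectrum has no accumulation points at all, in particular
        none at a threshold.\<close>
      unfolding H(1) free using H(3) islimpt_finite[OF H(2)] by blast
  qed
qed

end
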